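(* Let $V:S^1\to\mathbb{R}$ be of class $C^{k-1,1}(S^1)$ with $k\ge1$, let $\phi(\theta)=e^{-V(\theta)}$, and let $\pi_n$ be the monic degree-$n$ orthogonal polynomial with respect to $\phi$ on the unit circle. Then for each $\rho\in(0,1)$ there are constants $K_\rho^\pm>0$ such that for all sufficiently large $n$, \[ \sup_{\rho<|z|<1}\left|\pi_n(z)-z^ne^{-V_0-\overline{N(1/\overline{z})}}e^{E_kV(r,\theta)}\right|\le K_\rho^-\frac{\log(n)}{n^k}, \qquad \sup_{|z|<\rho}|\pi_n(z)|\le\frac{K_\rho^+}{n^k}, \] where $z=re^{i\theta}$.
   Context: $C^{k-1,1}(S^1)$: functions on the circle whose periodic extension has $k-1$ Lipschitz continuous derivatives. Orthogonality is with respect to $\langle f,g\rangle_\phi=\frac{1}{2\pi}\int_{-\pi}^{\pi}f(e^{i\theta})\overline{g(e^{i\theta})}\phi(\theta)d\theta$. $V_j=\frac{1}{2\pi}\int_{-\pi}^\pi V(\theta)e^{-ij\theta}d\theta$, $V_0$ is the mean of $V$, and $N(z)=\sum_{j\ge1}V_{-j}z^{-j}$ for $|z|\ge1$. For a $C^{m-1}$ function $f$ on $S^1$, the extension is $E_mf(r,\theta)=\sum_{p=0}^{m-1}\frac{f^{(p)}(\theta)}{p!}(-i\log r)^p$ for $r>0$. *)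

theory Defs
  imports "HOL-Analysis.Analysis" "HOL-Computational_Algebra.Polynomial"
begin

text \<open>Functions on the circle are represented by their 2pi-periodic parametrisation
  theta |-> f(e^{i theta}).  Class C^{k-1,1}(S^1): 2pi-periodic, the derivatives of order
  < k-1 exist everywhere (hence are continuous), and the (k-1)-st derivative is Lipschitz.\<close>
definition C_k_minus_1_1 :: "nat \<Rightarrow> (real \<Rightarrow> real) \<Rightarrow> bool" where
  "C_k_minus_1_1 k V \<longleftrightarrow>
     (\<forall>\<theta>. V (\<theta> + 2 * pi) = V \<theta>) \<and>
     (\<forall>p. p + 1 < k \<longrightarrow> (\<forall>x. ((deriv ^^ p) V) differentiable (at x))) \<and>
     (\<exists>L. \<forall>x y. \<bar>(deriv ^^ (k - 1)) V x - (deriv ^^ (k - 1)) V y\<bar> \<le> L * \<bar>x - y\<bar>)"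

definition circ_inner :: "(real \<Rightarrow> real) \<Rightarrow> (complex \<Rightarrow> complex) \<Rightarrow> (complex \<Rightarrow> complex) \<Rightarrow> complex" where
  "circ_inner \<phi> f g =
     integral {-pi..pi} (\<lambda>\<theta>. f (cis \<theta>) * cnj (g (cis \<theta>)) * complex_of_real (\<phi> \<theta>)) / complex_of_real (2 * pi)"

definition monic_OP :: "(real \<Rightarrow> real) \<Rightarrow> nat \<Rightarrow> complex poly" where
  "monic_OP \<phi> n = (THE p. degree p = n \<and> lead_coeff p = 1 \<and>
       (\<forall>j<n. circ_inner \<phi> (poly p) (\<lambda>z. z ^ j) = 0))"

definition fourier_coeff :: "(real \<Rightarrow> real) \<Rightarrow> int \<Rightarrow> complex" where
  "fourier_coeff V j =
     integral {-pi..pi} (\<lambda>\<theta>. complex_of_real (V \<theta>) * cis (- (of_int j * \<theta>))) / complex_of_real (2 * pi)"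

definition N_fun :: "(real \<Rightarrow> real) \<Rightarrow> complex \<Rightarrow> complex" where
  "N_fun V z = (\<Sum>j. fourier_coeff V (- int (Suc j)) * (1 / z) ^ Suc j)"

definition E_ext :: "nat \<Rightarrow> (real \<Rightarrow> real) \<Rightarrow> real \<Rightarrow> real \<Rightarrow> complex" where
  "E_ext m f r \<theta> = (\<Sum>p<m. complex_of_real ((deriv ^^ p) f \<theta> / fact p) * (- \<i> * complex_of_real (ln r)) ^ p)"

end

theory Submission
  imports Defs "HOL-Complex_Analysis.Complex_Analysis"
begin

text \<open>
  Write \<open>V = V\<^sub>0 + v + cnj v\<close> on the circle with \<open>v\<close> analytic in the disc, and \<open>g = exp v\<close>, so that the weight is
  \<open>exp (- V\<^sub>0) / |g|\<^sup>2\<close>. Let \<open>M\<^sub>n = z ^ n cnj (S\<^sub>n g)\<close>, where \<open>S\<^sub>n g\<close> is the \<open>n\<close>-th Taylor polynomial of \<open>g\<close>. Since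
  \<open>q / g\<close> has mean value \<open>1\<close> for every polynomial \<open>q\<close> with \<open>q 0 = 1\<close>, the extremal property of the orthogonal
  polynomials gives \<open>\<parallel>\<pi>\<^sub>n - M\<^sub>n\<parallel>\<^sub>2 = O(n^-k)\<close>. A comparison with the Dirichlet kernel, which only uses that the
  weight is Lipschitz, upgrades this to the supremum norm on the circle and hence on the disc. On \<open>|z| < \<rho>\<close> the
  decay of the Taylor coefficients of \<open>g\<close> bounds \<open>M\<^sub>n\<close>.

  On the annulus, \<open>M\<^sub>n g exp V\<^sub>0\<close> is compared on the circle with \<open>z ^ n T\<close>, where \<open>T\<close> is the Fourier partial sum of
  order \<open>n div 2\<close> of \<open>exp V\<close>. Both are analytic in the disc, so the maximum principle carries the estimate
  inside, where \<open>T\<close> is expanded around the boundary point \<open>exp (i \<theta>)\<close>; the factor \<open>|z| ^ n\<close> absorbs the remainders.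
  The logarithm comes from the Lebesgue constants of Fourier partial sums.
\<close>

section \<open>Coefficients of the exponential of a power series\<close>

text \<open>Two features shape the argument. Only \<open>k - 1\<close> derivatives exist everywhere
  and the last one is merely Lipschitz, so the \<open>k\<close>-th derivative is never formed: its
  Fourier coefficients are reached as limits of those of difference quotients. And the bound on the
  inner disc has no logarithm, so \<open>\<pi>\<^sub>n - M\<^sub>n\<close> cannot be estimated
  through supremum norms of Fourier tails; the route through the \<open>L2\<close> norm and the
  Dirichlet kernel comparison loses none.

  In the annulus the target is not analytic, because \<open>E_ext k V\<close> is built from the jet
  of \<open>V\<close> at the boundary point. The maximum principle therefore acts on
  \<open>z ^ n T\<close>, a polynomial as long as the order of \<open>T\<close> is at most
  \<open>n\<close>. The choice \<open>n div 2\<close> is a balance: small enough that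
  \<open>|z| ^ n\<close> times the growth \<open>|z| ^ (-n/2)\<close> of \<open>T\<close> still
  decays, large enough that truncation costs only order \<open>n^-k\<close> up to the logarithm. It
  is \<open>exp V\<close> and not \<open>V\<close> that is expanded, because
  \<open>exp V = exp V\<^sub>0 |g|\<^sup>2\<close> on the circle turns
  \<open>M\<^sub>n g exp V\<^sub>0\<close> into \<open>z ^ n exp V\<close> up to a Taylor tail of
  \<open>g\<close>.\<close>

fun expseq :: "(nat \<Rightarrow> 'a::field_char_0) \<Rightarrow> nat \<Rightarrow> 'a" where
  "expseq a 0 = 1"
| "expseq a (Suc n) = (\<Sum>i\<le>n. of_nat (Suc i) * a (Suc i) * expseq a (n - i)) / of_nat (Suc n)"

declare expseq.simps(2) [simp del]

text \<open>The differential equation \<open>f' = a' f\<close> for \<open>f = exp a\<close>, read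
  off coefficient by coefficient. The recursion starts at \<open>a 1\<close>, so it describes the
  exponential of the series without its constant term. It serves twice: for the Taylor coefficients
  of the Szego function, and for the derivatives of \<open>exp V\<close> in place of Faa di Bruno's
  formula.\<close>

lemma expseq_Suc_mult:
  "of_nat (Suc n) * expseq a (Suc n) = (\<Sum>i\<le>n. of_nat (Suc i) * a (Suc i) * expseq a (n - i))"
  unfolding expseq.simps(2) using of_nat_neq_0[of n, where 'a='a] by (simp del: of_nat_Suc)

lemma expseq_cong:
  assumes "\<And>i. \<lbrakk>1 \<le> i; i \<le> n\<rbrakk> \<Longrightarrow> a i = b i"
  shows "expseq a n = expseq b n"
  using assms
proof (induction n rule: less_induct)
  case (less n)
  show ?case
  proof (cases n)
    case (Suc m)
    have "(\<Sum>i\<le>m. of_nat (Suc i) * a (Suc i) * expseq a (m - i))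
        = (\<Sum>i\<le>m. of_nat (Suc i) * b (Suc i) * expseq b (m - i))"
    proof (rule sum.cong)
      fix i assume "i \<in> {..m}"
      then show "of_nat (Suc i) * a (Suc i) * expseq a (m - i) = of_nat (Suc i) * b (Suc i) * expseq b (m - i)"
        using less.IH[of "m - i"] less.prems Suc by auto
    qed auto
    then show ?thesis by (simp add: Suc expseq.simps(2))
  qed auto
qed

text \<open>The \<open>n\<close>-th coefficient is a polynomial in the \<open>a i\<close> of weight
  \<open>n\<close>. Moving the variable into the coefficients lets a bound on the coefficient sum
  act at any radius.\<close>

lemma expseq_scale: "expseq (\<lambda>i. a i * t ^ i) n = expseq a n * t ^ n"
proof (induction n rule: less_induct)
  case (less n)
  show ?case
  proof (cases n)
    case (Suc m)
    have "(\<Sum>i\<le>m. of_nat (Suc i) * (a (Suc i) * t ^ Suc i) * expseq (\<lambda>i. a i * t ^ i) (m - i))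
        = (\<Sum>i\<le>m. of_nat (Suc i) * a (Suc i) * expseq a (m - i)) * t ^ Suc m"
      unfolding sum_distrib_right
    proof (rule sum.cong)
      fix i assume i: "i \<in> {..m}"
      then have "t ^ Suc m = t ^ Suc i * t ^ (m - i)" by (simp flip: power_add)
      then show "of_nat (Suc i) * (a (Suc i) * t ^ Suc i) * expseq (\<lambda>i. a i * t ^ i) (m - i)
          = of_nat (Suc i) * a (Suc i) * expseq a (m - i) * t ^ Suc m"
        using less.IH[of "m - i"] Suc by (simp del: of_nat_Suc power_Suc)
    qed auto
    then show ?thesis by (simp add: Suc expseq.simps(2) del: of_nat_Suc power_Suc)
  qed auto
qed

lemma expseq_of_real:
  "of_real (expseq a n) = (expseq (\<lambda>i. of_real (a i)) n :: 'a::{field_char_0,real_field})"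
proof (induction n rule: less_induct)
  case (less n)
  show ?case
  proof (cases n)
    case (Suc m)
    then show ?thesis using less.IH
      by (simp add: expseq.simps(2) del: of_nat_Suc)
  qed auto
qed

lemma expseq_nonneg:
  fixes a :: "nat \<Rightarrow> real"
  assumes "\<And>i. 0 \<le> a i"
  shows "0 \<le> expseq a n"
proof (induction n rule: less_induct)
  case (less n)
  show ?case
    using less assms by (cases n) (auto simp: expseq.simps(2) intro!: divide_nonneg_nonneg sum_nonneg)
qed

text \<open>The recursion has nonnegative rational coefficients, so the sequence of norms yields a
  majorant.\<close>

lemma norm_expseq_le:
  fixes a :: "nat \<Rightarrow> 'a::{field_char_0,real_normed_field}"
  shows "norm (expseq a n) \<le> expseq (\<lambda>i. norm (a i)) n"
proof (induction n rule: less_induct)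
  case (less n)
  show ?case
  proof (cases n)
    case (Suc m)
    have "norm (\<Sum>i\<le>m. of_nat (Suc i) * a (Suc i) * expseq a (m - i))
        \<le> (\<Sum>i\<le>m. of_nat (Suc i) * norm (a (Suc i)) * expseq (\<lambda>i. norm (a i)) (m - i))"
      using less.IH Suc
      by (intro sum_norm_le) (auto simp: norm_mult simp del: of_nat_Suc intro!: mult_left_mono)
    then show ?thesis
      by (simp add: Suc expseq.simps(2) norm_divide divide_right_mono del: of_nat_Suc)
  qed auto
qed

text \<open>The partial sum \<open>P\<close> of the exponential of a series with nonnegative coefficients \<open>a\<close>
  satisfies \<open>P' \<le> a' P\<close> on \<open>[0,1]\<close>, because truncation only discards nonnegative terms.\<close>
lemma sum_expseq_le:
  fixes a :: "nat \<Rightarrow> real"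
  assumes a: "\<And>i. 0 \<le> a i"
  shows "(\<Sum>l\<le>L. expseq a l) \<le> exp (\<Sum>i<L. a (Suc i))"
proof -
  define c where "c = expseq a"
  define p where "p x = (\<Sum>l\<le>L. c l * x ^ l)" for x :: real
  define p' where "p' x = (\<Sum>l<L. of_nat (Suc l) * c (Suc l) * x ^ l)" for x :: real
  define q where "q x = (\<Sum>i<L. a (Suc i) * x ^ Suc i)" for x :: real
  define q' where "q' x = (\<Sum>i<L. of_nat (Suc i) * a (Suc i) * x ^ i)" for x :: real
  have c0: "0 \<le> c l" for l using a expseq_nonneg c_def by auto
  have p_alt: "p x = c 0 + (\<Sum>l<L. c (Suc l) * x ^ Suc l)" for x
    unfolding p_def lessThan_Suc_atMost [symmetric] by (subst sum.lessThan_Suc_shift) simp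
  have dp: "(p has_real_derivative p' x) (at x)" for x
    unfolding p_alt[abs_def] p'_def
    by (auto intro!: derivative_eq_intros sum.cong simp del: of_nat_Suc power_Suc simp: algebra_simps)
  have dq: "(q has_real_derivative q' x) (at x)" for x
    unfolding q_def q'_def
    by (auto intro!: derivative_eq_intros sum.cong simp del: of_nat_Suc power_Suc simp: algebra_simps)
  have le: "p' x \<le> q' x * p x" if x: "0 \<le> x" for x
  proof -
    let ?f = "\<lambda>i j. of_nat (Suc i) * a (Suc i) * x ^ i * (c j * x ^ j)"
    have "p' x = (\<Sum>l<L. \<Sum>i\<le>l. ?f i (l - i))"
      unfolding p'_def
    proof (rule sum.cong)
      fix l assume "l \<in> {..<L}"
      show "of_nat (Suc l) * c (Suc l) * x ^ l = (\<Sum>i\<le>l. ?f i (l - i))"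
        unfolding c_def expseq_Suc_mult sum_distrib_right
        by (rule sum.cong) (auto simp: algebra_simps simp del: of_nat_Suc simp flip: power_add)
    qed auto
    also have "\<dots> = (\<Sum>(i,j)\<in>{(i,j). i + j < L}. ?f i j)"
      by (rule sum.triangle_reindex [symmetric])
    also have "\<dots> \<le> (\<Sum>(i,j)\<in>{..<L}\<times>{..L}. ?f i j)"
      using x a c0 by (intro sum_mono2) (auto intro!: mult_nonneg_nonneg simp del: of_nat_Suc)
    also have "\<dots> = q' x * p x"
      unfolding q'_def p_def sum_product sum.cartesian_product by simp
    finally show ?thesis .
  qed
  have "p 1 * exp (- q 1) \<le> p 0 * exp (- q 0)"
  proof (rule DERIV_nonpos_imp_nonincreasing[of 0 1 "\<lambda>x. p x * exp (- q x)"])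
    fix x :: real assume x: "0 \<le> x"
    have "((\<lambda>x. p x * exp (- q x)) has_real_derivative (p' x - q' x * p x) * exp (- q x)) (at x)"
      by (auto intro!: derivative_eq_intros dp dq simp: algebra_simps)
    moreover have "(p' x - q' x * p x) * exp (- q x) \<le> 0"
      using le[OF x] by (simp add: mult_nonpos_nonneg)
    ultimately show "\<exists>y. ((\<lambda>x. p x * exp (- q x)) has_real_derivative y) (at x) \<and> y \<le> 0" by blast
  qed simp
  moreover have "q 0 = 0" "p 0 = 1" by (simp_all add: q_def p_alt c_def)
  ultimately have "p 1 \<le> exp (q 1)" by (simp add: exp_minus field_simps)
  then show ?thesis by (simp add: p_def q_def c_def)
qed

lemma
  fixes a :: "nat \<Rightarrow> complex"
  assumes "summable (\<lambda>i. norm (a i))"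
  shows summable_norm_expseq: "summable (\<lambda>l. norm (expseq a l))"
    and suminf_norm_expseq_le: "(\<Sum>l. norm (expseq a l)) \<le> exp (\<Sum>i. norm (a i))"
proof -
  have le: "(\<Sum>l<L. norm (expseq a l)) \<le> exp (\<Sum>i. norm (a i))" for L
  proof -
    have "(\<Sum>l<L. norm (expseq a l)) \<le> (\<Sum>l\<le>L. expseq (\<lambda>i. norm (a i)) l)"
      by (rule order_trans[OF sum_mono[OF norm_expseq_le]])
         (auto intro!: sum_mono2 expseq_nonneg)
    also have "\<dots> \<le> exp (\<Sum>i<L. norm (a (Suc i)))" by (rule sum_expseq_le) auto
    also have "(\<Sum>i<L. norm (a (Suc i))) \<le> (\<Sum>i<Suc L. norm (a i))"
      by (subst sum.lessThan_Suc_shift) simp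
    also have "\<dots> \<le> (\<Sum>i. norm (a i))" by (rule sum_le_suminf[OF assms]) auto
    finally show ?thesis by simp
  qed
  show *: "summable (\<lambda>l. norm (expseq a l))"
    by (rule summableI_nonneg_bounded[OF _ le]) auto
  show "(\<Sum>l. norm (expseq a l)) \<le> exp (\<Sum>i. norm (a i))"
    by (rule suminf_le_const[OF * le])
qed

section \<open>Absolutely convergent power series on the closed unit disc\<close>

lemma summable_power_series_disc:
  fixes c :: "nat \<Rightarrow> complex"
  assumes "summable (\<lambda>i. norm (c i))" "norm z \<le> 1"
  shows "summable (\<lambda>i. norm (c i * z ^ i))" "summable (\<lambda>i. c i * z ^ i)"
proof -
  show "summable (\<lambda>i. norm (c i * z ^ i))"
    using assms(2) by (intro summable_comparison_test'[OF assms(1)])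
      (auto simp: norm_mult norm_power intro!: mult_left_le power_le_one)
  then show "summable (\<lambda>i. c i * z ^ i)" by (rule summable_norm_cancel)
qed

lemma continuous_on_power_series_disc:
  fixes c :: "nat \<Rightarrow> complex"
  assumes "summable (\<lambda>i. norm (c i))"
  shows "continuous_on (cball 0 1) (\<lambda>z. \<Sum>i. c i * z ^ i)"
proof (rule uniform_limit_theorem)
  show "uniform_limit (cball 0 1) (\<lambda>n z. \<Sum>i<n. c i * z ^ i) (\<lambda>z. \<Sum>i. c i * z ^ i) sequentially"
    using assms by (intro Weierstrass_m_test)
      (auto simp: norm_mult norm_power intro!: mult_left_le power_le_one)
  show "\<forall>\<^sub>F n in sequentially. continuous_on (cball 0 1) (\<lambda>z. \<Sum>i<n. c i * z ^ i)"
    by (intro always_eventually allI continuous_intros)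
qed auto

lemma holomorphic_power_series_disc:
  fixes c :: "nat \<Rightarrow> complex"
  assumes "summable (\<lambda>i. norm (c i))"
  shows "(\<lambda>z. \<Sum>i. c i * z ^ i) holomorphic_on ball 0 1"
proof -
  have "((\<lambda>z. \<Sum>i. c i * z ^ i) has_field_derivative (\<Sum>n. diffs c n * z ^ n)) (at z)" if "norm z < 1" for z
    by (rule termdiffs_strong'[of 1]) (use summable_power_series_disc[OF assms] that in auto)
  then show ?thesis unfolding holomorphic_on_def field_differentiable_def
    by (metis has_field_derivative_at_within mem_ball_0)
qed

text \<open>In the open disc both sides solve \<open>f' = h' f\<close> with the same value at
  \<open>0\<close>, so \<open>f z * exp (- h z)\<close> is constant. The boundary circle, where the
  identity is mostly used, is reached by continuity, which rests on absolute convergence on the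
  closed disc.\<close>

lemma expseq_power_series:
  fixes a :: "nat \<Rightarrow> complex"
  assumes a: "summable (\<lambda>i. norm (a i))" and a0: "a 0 = 0" and z: "norm z \<le> 1"
  shows "(\<Sum>l. expseq a l * z ^ l) = exp (\<Sum>i. a i * z ^ i)"
proof -
  define c where "c = expseq a"
  have c: "summable (\<lambda>i. norm (c i))" unfolding c_def by (rule summable_norm_expseq[OF a])
  define f where "f z = (\<Sum>i. c i * z ^ i)" for z
  define h where "h z = (\<Sum>i. a i * z ^ i)" for z
  define F where "F z = f z * exp (- h z)" for z
  have df: "(f has_field_derivative (\<Sum>n. diffs c n * z ^ n)) (at z)" if "norm z < 1" for z
    unfolding f_def by (rule termdiffs_strong'[of 1]) (use summable_power_series_disc[OF c] that in auto)
  have dh: "(h has_field_derivative (\<Sum>n. diffs a n * z ^ n)) (at z)" if "norm z < 1" for z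
    unfolding h_def by (rule termdiffs_strong'[of 1]) (use summable_power_series_disc[OF a] that in auto)
  have ode: "(\<Sum>n. diffs c n * z ^ n) = (\<Sum>n. diffs a n * z ^ n) * f z" if z: "norm z < 1" for z
  proof -
    \<comment> \<open>Differentiation costs radius: the derived series converges absolutely at
      \<open>z\<close> because it converges at some \<open>K\<close> strictly between
      \<open>norm z\<close> and \<open>1\<close>.\<close>
    have s: "summable (\<lambda>n. norm (diffs a n * z ^ n))"
    proof -
      obtain K where K: "norm z < K" "K < 1" using dense z by blast
      have "summable (\<lambda>n. diffs a n * of_real K ^ n)"
        by (rule termdiff_converges[of _ 1])
           (use K summable_power_series_disc[OF a] order_le_less_trans[OF norm_ge_zero K(1)] in auto)
      then show ?thesis by (rule powser_insidea) (use K in auto)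
    qed
    have "(\<Sum>n. diffs a n * z ^ n) * f z = (\<Sum>k. \<Sum>i\<le>k. (diffs a i * z ^ i) * (c (k - i) * z ^ (k - i)))"
      unfolding f_def by (rule Cauchy_product[OF s]) (use summable_power_series_disc[OF c] z in auto)
    also have "(\<lambda>k. \<Sum>i\<le>k. (diffs a i * z ^ i) * (c (k - i) * z ^ (k - i))) = (\<lambda>k. diffs c k * z ^ k)"
    proof
      fix k
      have "diffs c k * z ^ k = (\<Sum>i\<le>k. of_nat (Suc i) * a (Suc i) * expseq a (k - i)) * z ^ k"
        unfolding c_def diffs_def expseq_Suc_mult ..
      also have "\<dots> = (\<Sum>i\<le>k. (diffs a i * z ^ i) * (c (k - i) * z ^ (k - i)))"
        unfolding sum_distrib_right
      proof (rule sum.cong)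
        fix i assume "i \<in> {..k}"
        then have "z ^ k = z ^ i * z ^ (k - i)" by (simp flip: power_add)
        then show "of_nat (Suc i) * a (Suc i) * expseq a (k - i) * z ^ k
            = (diffs a i * z ^ i) * (c (k - i) * z ^ (k - i))"
          by (simp add: diffs_def c_def del: of_nat_Suc)
      qed auto
      finally show "(\<Sum>i\<le>k. (diffs a i * z ^ i) * (c (k - i) * z ^ (k - i))) = diffs c k * z ^ k" ..
    qed
    finally show ?thesis ..
  qed
  have cont: "continuous_on (cball 0 1) F"
    unfolding F_def f_def h_def using continuous_on_power_series_disc[OF c] continuous_on_power_series_disc[OF a]
    by (intro continuous_intros)
  have dF: "(F has_field_derivative 0) (at z)" if "z \<in> ball 0 1" for z
  proof -
    have z: "norm z < 1" using that by simp
    show ?thesis unfolding F_def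
      by (rule derivative_eq_intros df[OF z] dh[OF z] refl)+ (simp add: ode[OF z])
  qed
  have F0: "F 0 = 1"
    using a0 by (simp add: F_def f_def h_def powser_zero c_def)
  have "F w = 1" if "w \<in> ball 0 1" for w
  proof -
    obtain k where "\<And>x. x \<in> ball 0 1 \<Longrightarrow> F x = k"
      using has_field_derivative_zero_constant[OF convex_ball[of 0 1] has_field_derivative_at_within[OF dF]]
      by blast
    then show ?thesis using F0 that by (metis centre_in_ball zero_less_one)
  qed
  then have "F z = 1"
    using continuous_constant_on_closure[of "ball 0 1" F 1 z] z cont by simp
  then show ?thesis by (simp add: F_def f_def h_def c_def exp_minus field_simps)
qed

text \<open>Summation by parts against \<open>j^-q\<close>; the boundary terms telescope since
  \<open>(c j - c (j+1)) \<ell> j \<le> c j (\<ell> j + 1) - c (j+1) (\<ell> (j+1) + 1)\<close> for \<open>\<ell> j = 1 + ln j\<close> and \<open>c j = j^-q\<close>.\<close>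
lemma log_abel_tail:
  fixes a :: "nat \<Rightarrow> complex"
  assumes A: "\<And>J. 1 \<le> J \<Longrightarrow> norm (\<Sum>j=1..J. a j) \<le> \<Lambda> * (1 + ln (real J))"
    and q: "1 \<le> q" and N: "1 \<le> N"
  shows "norm (\<Sum>j\<in>{N<..M}. a j / of_nat j ^ q) \<le> 3 * \<Lambda> * (1 + ln (real (Suc N))) / real (Suc N) ^ q"
proof -
  define S where "S J = (\<Sum>j=1..J. a j)" for J
  define l where "l j = 1 + ln (real j)" for j
  define c where "c j = 1 / real j ^ q" for j
  have "norm (a 1) \<le> \<Lambda>" using A[of 1] by simp
  then have L0: "0 \<le> \<Lambda>" using norm_ge_zero order_trans by blast
  have l0: "0 \<le> l j" if "1 \<le> j" for j using that by (simp add: l_def)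
  have lmono: "l j \<le> l (Suc j)" if "1 \<le> j" for j using that by (simp add: l_def)
  have c0: "0 \<le> c j" for j by (simp add: c_def)
  have cmono: "c (Suc j) \<le> c j" if "1 \<le> j" for j
    using that by (auto simp: c_def intro!: divide_left_mono power_mono)
  have SJ: "norm (S J) \<le> \<Lambda> * l J" if "1 \<le> J" for J using A[OF that] by (simp add: S_def l_def)
  have key: "(c j - c (Suc j)) * l j \<le> c j * (l j + 1) - c (Suc j) * (l (Suc j) + 1)" if j: "1 \<le> j" for j
  proof -
    have "ln (real (Suc j)) - ln (real j) = ln (1 + 1 / real j)"
      using j ln_div[of "real (Suc j)" "real j"] by (simp add: add_divide_distrib add.commute)
    also have "\<dots> \<le> 1 / real j" by (rule ln_add_one_self_le_self) simp
    finally have 1: "l (Suc j) - l j \<le> 1 / real j" by (simp add: l_def)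
    have "1 + 1 / real j \<le> (1 + 1 / real j) ^ q"
      using q by (intro self_le_power) auto
    also have "\<dots> = (real (Suc j) / real j) ^ q" using j by (simp add: field_simps)
    finally have "c (Suc j) * (1 + 1 / real j) \<le> c (Suc j) * (real (Suc j) / real j) ^ q"
      using c0 by (intro mult_left_mono) auto
    also have "\<dots> = c j" by (simp add: c_def power_divide)
    finally have "c (Suc j) * (1 / real j) \<le> c j - c (Suc j)" by (simp add: algebra_simps)
    then have "c (Suc j) * (l (Suc j) - l j) \<le> c j - c (Suc j)"
      using mult_left_mono[OF 1 c0[of "Suc j"]] by linarith
    then show ?thesis by (simp add: algebra_simps)
  qed
  \<comment> \<open>Both boundary terms of the summation by parts are kept on the left, so that the
    induction only has to add up increments controlled by \<open>key\<close>.\<close>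
  have main: "norm ((\<Sum>j\<in>{N<..M}. a j * of_real (c j)) - S M * of_real (c M) + S N * of_real (c (Suc N)))
      \<le> \<Lambda> * (c (Suc N) * (l (Suc N) + 1) - c M * (l M + 1))" if "Suc N \<le> M" for M
    using that
  proof (induction M rule: dec_induct)
    case base
    have "{N<..Suc N} = {Suc N}" by auto
    then show ?case by (simp add: S_def algebra_simps)
  next
    case (step M)
    have M: "1 \<le> M" "N \<le> M" using step N by auto
    have "{N<..Suc M} = insert (Suc M) {N<..M}" using step by auto
    then have "(\<Sum>j\<in>{N<..Suc M}. a j * of_real (c j)) - S (Suc M) * of_real (c (Suc M)) + S N * of_real (c (Suc N))
       = ((\<Sum>j\<in>{N<..M}. a j * of_real (c j)) - S M * of_real (c M) + S N * of_real (c (Suc N)))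
         + S M * of_real (c M - c (Suc M))"
      by (simp add: S_def algebra_simps)
    also have "norm \<dots> \<le> \<Lambda> * (c (Suc N) * (l (Suc N) + 1) - c M * (l M + 1))
         + (\<Lambda> * l M) * (c M - c (Suc M))"
      using SJ[OF M(1)] cmono[OF M(1)] L0 l0[OF M(1)]
      by (intro norm_triangle_mono step.IH) (auto simp: norm_mult simp flip: of_real_diff intro!: mult_mono)
    also have "\<dots> \<le> \<Lambda> * (c (Suc N) * (l (Suc N) + 1) - c (Suc M) * (l (Suc M) + 1))"
      using mult_left_mono[OF key[OF M(1)] L0] by (simp add: algebra_simps)
    finally show ?case .
  qed
  show ?thesis
  proof (cases "Suc N \<le> M")
    case True
    let ?T = "\<Sum>j\<in>{N<..M}. a j * of_real (c j)"
    have l1: "1 \<le> l (Suc N)" by (simp add: l_def)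
    have "norm ?T \<le> norm (?T - S M * of_real (c M) + S N * of_real (c (Suc N))) + norm (S M * of_real (c M)) + norm (S N * of_real (c (Suc N)))"
      using norm_triangle_ineq4[of "?T - S M * of_real (c M) + S N * of_real (c (Suc N))" "S N * of_real (c (Suc N))"]
        norm_triangle_ineq[of "?T - S M * of_real (c M)" "S M * of_real (c M)"] by simp
    also have "\<dots> \<le> \<Lambda> * (c (Suc N) * (l (Suc N) + 1) - c M * (l M + 1)) + \<Lambda> * l M * c M + \<Lambda> * l N * c (Suc N)"
      using SJ[of M] SJ[of N] N True c0 by (intro add_mono main[OF True]) (auto simp: norm_mult intro!: mult_right_mono)
    also have "\<dots> \<le> \<Lambda> * (c (Suc N) * (l (Suc N) + 1)) + \<Lambda> * l N * c (Suc N)"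
      using mult_nonneg_nonneg[OF L0 c0[of M]] by (simp add: algebra_simps)
    also have "\<dots> = \<Lambda> * c (Suc N) * (l (Suc N) + 1 + l N)" by (simp add: algebra_simps)
    \<comment> \<open>All three summands \<open>l (Suc N)\<close>, \<open>1\<close> and
      \<open>l N\<close> are at most \<open>l (Suc N)\<close>, whence the factor 3.\<close>
    also have "\<dots> \<le> \<Lambda> * c (Suc N) * (3 * l (Suc N))"
      using lmono[OF N] l1 L0 c0 by (intro mult_left_mono mult_nonneg_nonneg) auto
    finally show ?thesis by (simp add: c_def l_def algebra_simps add_divide_distrib)
  next
    case False
    then have "{N<..M} = {}" by auto
    moreover have "0 \<le> 3 * \<Lambda> * (1 + ln (real (Suc N))) / real (Suc N) ^ q" 
      using L0 l0[of "Suc N"] by (auto simp: l_def intro!: divide_nonneg_nonneg mult_nonneg_nonneg)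
    ultimately show ?thesis by simp
  qed
qed

section \<open>Fourier coefficients and Lebesgue constants\<close>

definition cavg :: "(real \<Rightarrow> 'a::banach) \<Rightarrow> 'a" where
  "cavg f = integral {-pi..pi} f /\<^sub>R (2 * pi)"

definition fc :: "(real \<Rightarrow> complex) \<Rightarrow> int \<Rightarrow> complex" where
  "fc f j = cavg (\<lambda>t. f t * cis (- (of_int j * t)))"

abbreviation circ_integrable :: "(real \<Rightarrow> 'a::banach) \<Rightarrow> bool" where
  "circ_integrable f \<equiv> f integrable_on {-pi..pi}"

lemma circ_integrable_continuous: "continuous_on UNIV f \<Longrightarrow> circ_integrable f"
  by (rule integrable_continuous_interval) (rule continuous_on_subset, auto)

lemma circ_integrable_measurable:
  fixes f :: "real \<Rightarrow> 'a::euclidean_space"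
  assumes "f \<in> borel_measurable borel" and "\<And>t. t \<in> {-pi..pi} \<Longrightarrow> norm (f t) \<le> M"
  shows "circ_integrable f"
proof (rule measurable_bounded_by_integrable_imp_integrable)
  show "f \<in> borel_measurable (lebesgue_on {-pi..pi})"
    using assms(1) by (intro measurable_restrict_space1 measurable_completion) auto
qed (use assms in auto)

lemma cavg_add: "circ_integrable f \<Longrightarrow> circ_integrable g \<Longrightarrow> cavg (\<lambda>t. f t + g t) = cavg f + cavg g"
  by (simp add: cavg_def integral_add scaleR_add_right)

lemma cavg_diff: "circ_integrable f \<Longrightarrow> circ_integrable g \<Longrightarrow> cavg (\<lambda>t. f t - g t) = cavg f - cavg g"
  by (simp add: cavg_def integral_diff scaleR_diff_right)

lemma cavg_mult_left:
  fixes f :: "real \<Rightarrow> 'a::{real_normed_field,euclidean_space}"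
  shows "cavg (\<lambda>t. c * f t) = c * cavg f"
  by (simp add: cavg_def)

lemma cavg_mult_right:
  fixes f :: "real \<Rightarrow> 'a::{real_normed_field,euclidean_space}"
  shows "cavg (\<lambda>t. f t * c) = cavg f * c"
  by (simp add: cavg_def)

lemma cavg_sum:
  assumes "finite I" "\<And>i. i \<in> I \<Longrightarrow> circ_integrable (f i)"
  shows "cavg (\<lambda>t. \<Sum>i\<in>I. f i t) = (\<Sum>i\<in>I. cavg (f i))"
  using assms by (simp add: cavg_def integral_sum scaleR_sum_right)

lemma cavg_const [simp]: "cavg (\<lambda>t. c) = c"
  by (simp add: cavg_def)

lemma cavg_cong: "(\<And>t. t \<in> {-pi..pi} \<Longrightarrow> f t = g t) \<Longrightarrow> cavg f = cavg g"
  unfolding cavg_def using integral_cong[of "{-pi..pi}" f g] by simp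

lemma norm_cavg_le:
  assumes "circ_integrable f" "circ_integrable g" "\<And>t. t \<in> {-pi..pi} \<Longrightarrow> norm (f t) \<le> g t"
  shows "norm (cavg f) \<le> cavg g"
  using Henstock_Kurzweil_Integration.integral_norm_bound_integral[OF assms]
  unfolding cavg_def norm_scaleR real_scaleR_def by (intro mult_mono) auto

lemma cavg_mono:
  fixes f g :: "real \<Rightarrow> real"
  assumes "circ_integrable f" "circ_integrable g" "\<And>t. t \<in> {-pi..pi} \<Longrightarrow> f t \<le> g t"
  shows "cavg f \<le> cavg g"
  unfolding cavg_def real_scaleR_def using integral_le[OF assms] by (intro mult_left_mono) auto

lemma cavg_nonneg:
  fixes f :: "real \<Rightarrow> real"
  assumes "\<And>t. t \<in> {-pi..pi} \<Longrightarrow> 0 \<le> f t"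
  shows "0 \<le> cavg f"
proof (cases "circ_integrable f")
  case True
  then show ?thesis unfolding cavg_def
    using integral_nonneg[OF True assms] by simp
next
  case False
  then show ?thesis by (simp add: cavg_def not_integrable_integral)
qed

lemma cavg_of_real: 
  assumes "circ_integrable f"
  shows "cavg (\<lambda>t. complex_of_real (f t)) = of_real (cavg f)"
  using has_integral_linear[OF integrable_integral[OF assms] bounded_linear_of_real[where 'a=complex]]
  by (simp add: cavg_def o_def integral_unique scaleR_conv_of_real)

lemma cavg_cnj:
  assumes "circ_integrable f"
  shows "cavg (\<lambda>t. cnj (f t)) = cnj (cavg f)"
  using has_integral_linear[OF integrable_integral[OF assms] bounded_linear_cnj]
  by (simp add: cavg_def o_def integral_unique scaleR_conv_of_real)

lemma cavg_Re:
  assumes "circ_integrable f"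
  shows "cavg (\<lambda>t. Re (f t)) = Re (cavg f)"
  using has_integral_linear[OF integrable_integral[OF assms] bounded_linear_Re]
  by (simp add: cavg_def o_def integral_unique)

lemma circ_integrable_Re: "circ_integrable f \<Longrightarrow> circ_integrable (\<lambda>t. Re (f t))"
  using integrable_linear[OF _ bounded_linear_Re, of f "{-pi..pi}"] by (simp add: o_def)

lemma cis_int_periodic: "cis (of_int j * (t + 2 * pi)) = cis (of_int j * t)"
proof -
  have "cis (of_int j * (t + 2 * pi)) = cis (of_int j * t) * cis (2 * pi * of_int j)"
    by (simp add: cis_mult algebra_simps)
  then show ?thesis by simp
qed

lemma cis_minus_int_periodic: "cis (- (of_int j * (t + 2 * pi))) = cis (- (of_int j * t))"
  using cis_int_periodic[of "-j" t] by simp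

lemma has_vector_derivative_cis_mult:
  "((\<lambda>t. cis (c * t)) has_vector_derivative (\<i> * of_real c * cis (c * t))) (at t within S)"
proof -
  have "((\<lambda>t. c * t) has_derivative (\<lambda>s. c * s)) (at t within S)"
    by (intro derivative_intros)
  from has_derivative_cis[OF this] show ?thesis
    by (simp add: has_vector_derivative_def scaleR_conv_of_real mult_ac)
qed

lemma cavg_deriv_periodic:
  fixes F :: "real \<Rightarrow> 'a::banach"
  assumes "\<And>t. (F has_vector_derivative f t) (at t)" and "\<And>t. F (t + 2 * pi) = F t"
  shows "cavg f = 0"
proof -
  have "(f has_integral (F pi - F (-pi))) {-pi..pi}"
    by (rule fundamental_theorem_of_calculus) (auto intro: assms(1) has_vector_derivative_at_within)
  then show ?thesis using assms(2)[of "-pi"] by (simp add: cavg_def integral_unique)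
qed

lemma cavg_cis: "cavg (\<lambda>t. cis (of_int j * t)) = (if j = 0 then 1 else 0)"
proof (cases "j = 0")
  case False
  let ?F = "\<lambda>t. cis (of_int j * t) * (1 / (\<i> * of_int j))"
  have "cavg (\<lambda>t. cis (of_int j * t)) = 0"
  proof (rule cavg_deriv_periodic[of ?F])
    fix t
    have "(?F has_vector_derivative (\<i> * of_real (of_int j) * cis (of_int j * t)) * (1 / (\<i> * of_int j))) (at t)"
      by (rule has_vector_derivative_mult_left has_vector_derivative_cis_mult)+
    then show "(?F has_vector_derivative cis (of_int j * t)) (at t)" using False by simp
  next
    fix t show "?F (t + 2 * pi) = ?F t" by (simp only: cis_int_periodic)
  qed
  then show ?thesis using False by simp
qed simp

lemma continuous_on_cis_mult [continuous_intros]: "continuous_on S (\<lambda>t. cis (c * t))"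
  by (intro continuous_intros)

text \<open>With an antiderivative \<open>g\<close> the integral over the shifted period is
  \<open>g (pi + y) - g (-pi + y)\<close>, whose derivative in \<open>y\<close> vanishes by
  periodicity.\<close>

lemma cavg_shift:
  fixes f :: "real \<Rightarrow> 'a::banach"
  assumes f: "continuous_on UNIV f" and per: "\<And>t. f (t + 2 * pi) = f t"
  shows "cavg (\<lambda>t. f (t + x)) = cavg f"
proof -
  \<comment> \<open>Large enough for one antiderivative to serve all shifts up to \<open>x\<close>,
    with a margin of 1 that keeps the end points interior, where two-sided derivatives
    exist.\<close>
  define R where "R = \<bar>x\<bar> + pi + 1"
  obtain g where "\<And>t. t \<in> {-R..R} \<Longrightarrow> (g has_vector_derivative f t) (at t within {-R..R})"
    using antiderivative_continuous[of "-R" R f] continuous_on_subset[OF f] by auto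
  then have g: "(g has_vector_derivative f t) (at t)" if "t \<in> {-R<..<R}" for t
    using that at_within_interior[of t "{-R..R}"]
    by (metis atLeastAtMost_iff greaterThanLessThan_iff interior_atLeastAtMost_real less_imp_le)
  have gs: "((\<lambda>t. g (t + y)) has_vector_derivative f (t + y)) (at t)" if "t + y \<in> {-R<..<R}" for t y
  proof -
    have "((\<lambda>t. t + y) has_vector_derivative 1) (at t)"
      by (auto intro!: derivative_eq_intros)
    from vector_diff_chain_at[OF this g[OF that]] show ?thesis by (simp add: o_def)
  qed
  have I: "integral {-pi..pi} (\<lambda>t. f (t + y)) = g (pi + y) - g (-pi + y)" if "\<bar>y\<bar> \<le> \<bar>x\<bar>" for y
    using that by (intro integral_unique fundamental_theorem_of_calculus)
      (auto intro!: has_vector_derivative_at_within gs simp: R_def)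
  have d0: "((\<lambda>y. g (pi + y) - g (-pi + y)) has_vector_derivative 0) (at y within {-\<bar>x\<bar>..\<bar>x\<bar>})"
    if "y \<in> {-\<bar>x\<bar>..\<bar>x\<bar>}" for y
  proof -
    have 1: "pi + y \<in> {-R<..<R}" "-pi + y \<in> {-R<..<R}"
      using that pi_gt_zero unfolding R_def atLeastAtMost_iff greaterThanLessThan_iff by linarith+
    have "((\<lambda>y. g (y + pi) - g (y + - pi)) has_vector_derivative f (y + pi) - f (y + - pi)) (at y)"
      using 1 by (intro has_vector_derivative_diff gs) (auto simp: add.commute)
    moreover have "f (y + pi) = f (y + - pi)" using per[of "y - pi"] by (simp add: algebra_simps)
    ultimately show ?thesis by (simp add: add.commute has_vector_derivative_at_within)
  qed
  obtain c where "\<And>y. y \<in> {-\<bar>x\<bar>..\<bar>x\<bar>} \<Longrightarrow> g (pi + y) - g (-pi + y) = c"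
    using has_vector_derivative_zero_constant[OF _ d0] by auto
  then have "g (pi + x) - g (-pi + x) = g (pi + 0) - g (-pi + 0)"
    by (smt (verit) atLeastAtMost_iff)
  then have "integral {-pi..pi} (\<lambda>t. f (t + x)) = integral {-pi..pi} (\<lambda>t. f (t + 0))"
    using I[of x] I[of 0] by simp
  then show ?thesis by (simp add: cavg_def)
qed

lemma fc_shift:
  assumes "continuous_on UNIV f" "\<And>t. f (t + 2 * pi) = f t"
  shows "fc (\<lambda>t. f (t + x)) j = cis (of_int j * x) * fc f j"
proof -
  have "fc f j = cavg (\<lambda>t. f (t + x) * cis (- (of_int j * (t + x))))"
    unfolding fc_def using assms cis_minus_int_periodic[of j]
    by (intro cavg_shift[symmetric]) (auto intro!: continuous_intros)
  also have "\<dots> = cavg (\<lambda>t. cis (- (of_int j * x)) * (f (t + x) * cis (- (of_int j * t))))"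
    by (rule arg_cong[where f=cavg]) (auto simp: cis_mult algebra_simps)
  also have "\<dots> = cis (- (of_int j * x)) * fc (\<lambda>t. f (t + x)) j"
    by (simp add: cavg_mult_left fc_def)
  finally show ?thesis by (simp add: cis_mult flip: mult.assoc)
qed

lemma circ_integrable_mult_cis:
  fixes f :: "real \<Rightarrow> complex"
  assumes "f \<in> borel_measurable borel" and "\<And>t. t \<in> {-pi..pi} \<Longrightarrow> norm (f t) \<le> M"
  shows "circ_integrable (\<lambda>t. f t * cis (c * t))"
proof (rule circ_integrable_measurable[of _ M])
  have "(\<lambda>t. cis (c * t)) \<in> borel_measurable borel"
    by (intro borel_measurable_continuous_onI continuous_intros)
  then show "(\<lambda>t. f t * cis (c * t)) \<in> borel_measurable borel"
    using assms(1) by measurable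
qed (use assms in \<open>auto simp: norm_mult\<close>)

text \<open>Stated for bounded measurable functions rather than continuous ones because it is later
  applied to a quotient by \<open>cis t - 1\<close>, which may jump at \<open>0\<close>. The proof
  expands the mean square of \<open>f - s\<close>, where \<open>s\<close> is the trigonometric
  polynomial with the coefficients of \<open>f\<close> on \<open>F\<close>.\<close>

lemma bessel:
  fixes f :: "real \<Rightarrow> complex"
  assumes meas: "f \<in> borel_measurable borel" and M: "\<And>t. t \<in> {-pi..pi} \<Longrightarrow> norm (f t) \<le> M"
    and F: "finite F"
  shows "(\<Sum>j\<in>F. (norm (fc f j))\<^sup>2) \<le> M\<^sup>2"
proof -
  define s where "s t = (\<Sum>j\<in>F. fc f j * cis (of_int j * t))" for t
  have M0: "0 \<le> M" using order_trans[OF norm_ge_zero M[of 0]] by simp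
  have contS: "continuous_on UNIV s" unfolding s_def by (intro continuous_intros)
  have int: "circ_integrable (\<lambda>t. f t * cis (c * t))" for c
    by (rule circ_integrable_mult_cis[OF meas M])
  have cnjs: "f t * cnj (s t) = (\<Sum>j\<in>F. cnj (fc f j) * (f t * cis (-of_int j * t)))" for t
    by (simp add: s_def cis_cnj sum_distrib_left algebra_simps)
  have ifs: "circ_integrable (\<lambda>t. f t * cnj (s t))"
    unfolding cnjs using F by (intro integrable_sum integrable_on_mult_right int)
  have afs: "cavg (\<lambda>t. f t * cnj (s t)) = of_real (\<Sum>j\<in>F. (norm (fc f j))\<^sup>2)"
  proof -
    have "cavg (\<lambda>t. f t * cnj (s t)) = (\<Sum>j\<in>F. cavg (\<lambda>t. cnj (fc f j) * (f t * cis (-of_int j * t))))"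
      unfolding cnjs using F by (intro cavg_sum integrable_on_mult_right int)
    also have "\<dots> = (\<Sum>j\<in>F. cnj (fc f j) * fc f j)"
      by (simp add: cavg_mult_left fc_def)
    finally show ?thesis by (simp add: complex_norm_square mult.commute del: of_real_power)
  qed
  have ass: "cavg (\<lambda>t. s t * cnj (s t)) = of_real (\<Sum>j\<in>F. (norm (fc f j))\<^sup>2)"
  proof -
    have "cavg (\<lambda>t. s t * cnj (s t)) = cavg (\<lambda>t. \<Sum>i\<in>F. \<Sum>j\<in>F. fc f i * cnj (fc f j) * cis (of_int (i - j) * t))"
      by (rule arg_cong[where f=cavg])
         (auto simp: s_def sum_product cis_cnj cis_mult algebra_simps intro!: sum.cong)
    also have "\<dots> = (\<Sum>i\<in>F. cavg (\<lambda>t. \<Sum>j\<in>F. fc f i * cnj (fc f j) * cis (of_int (i - j) * t)))"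
      using F by (intro cavg_sum circ_integrable_continuous continuous_intros)
    also have "\<dots> = (\<Sum>i\<in>F. \<Sum>j\<in>F. cavg (\<lambda>t. fc f i * cnj (fc f j) * cis (of_int (i - j) * t)))"
      using F by (intro sum.cong refl cavg_sum circ_integrable_continuous continuous_intros)
    also have "\<dots> = (\<Sum>i\<in>F. \<Sum>j\<in>F. fc f i * cnj (fc f j) * cavg (\<lambda>t. cis (of_int (i - j) * t)))"
      by (simp only: cavg_mult_left)
    also have "\<dots> = (\<Sum>i\<in>F. \<Sum>j\<in>F. if i = j then fc f i * cnj (fc f j) else 0)"
      unfolding cavg_cis by (intro sum.cong refl) simp
    also have "\<dots> = (\<Sum>i\<in>F. fc f i * cnj (fc f i))" using F by simp
    finally show ?thesis by (simp add: complex_norm_square del: of_real_power)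
  qed
  have iff: "circ_integrable (\<lambda>t. (norm (f t))\<^sup>2)"
    using meas M M0 by (intro circ_integrable_measurable[of _ "M\<^sup>2"]) (auto intro!: power_mono)
  have iss: "circ_integrable (\<lambda>t. s t * cnj (s t))"
    by (intro circ_integrable_continuous continuous_intros contS)
  have eq: "(norm (f t - s t))\<^sup>2 = (norm (f t))\<^sup>2 - 2 * Re (f t * cnj (s t)) + Re (s t * cnj (s t))" for t
    unfolding cmod_power2 by (simp add: power2_eq_square algebra_simps)
  have "0 \<le> cavg (\<lambda>t. (norm (f t - s t))\<^sup>2)" by (rule cavg_nonneg) simp
  also have "\<dots> = cavg (\<lambda>t. (norm (f t))\<^sup>2) - 2 * Re (cavg (\<lambda>t. f t * cnj (s t))) + Re (cavg (\<lambda>t. s t * cnj (s t)))"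
  proof -
    note i1 = integrable_on_mult_right[OF circ_integrable_Re[OF ifs], of 2]
    show ?thesis unfolding eq
      by (simp only: cavg_add[OF integrable_diff[OF iff i1] circ_integrable_Re[OF iss]] cavg_diff[OF iff i1]
          cavg_mult_left cavg_Re[OF ifs] cavg_Re[OF iss])
  qed
  also have "\<dots> = cavg (\<lambda>t. (norm (f t))\<^sup>2) - (\<Sum>j\<in>F. (norm (fc f j))\<^sup>2)"
    unfolding afs ass by simp
  also have "cavg (\<lambda>t. (norm (f t))\<^sup>2) \<le> cavg (\<lambda>t. M\<^sup>2)"
    using iff M by (intro cavg_mono) (auto intro!: power_mono)
  finally show ?thesis by simp
qed

section \<open>Dirichlet kernel and Lebesgue constants\<close>

lemma norm_cis_diff_one_ge:
  assumes "\<bar>t\<bar> \<le> pi"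
  shows "\<bar>t\<bar> / 3 \<le> norm (cis t - 1)"
proof -
  define x where "x = \<bar>t\<bar> / 2"
  have x: "0 \<le> x" "x \<le> 2" using assms pi_less_4 by (auto simp: x_def)
  have "\<bar>sin x - x\<bar> \<le> \<bar>x\<bar> ^ 3 / 6"
    using Maclaurin_sin_bound[of x 3]
    by (simp add: sin_coeff_def eval_nat_numeral divide_simps)
  moreover have "x ^ 3 \<le> 4 * x"
    using x mult_mono[of x 2 x 2] mult_right_mono[of "x * x" 4 x] by (simp add: power3_eq_cube)
  ultimately have "x / 3 \<le> sin x" using x by linarith
  moreover have "norm (cis t - 1) = 2 * \<bar>sin (t / 2)\<bar>"
  proof -
    have "(norm (cis t - 1))\<^sup>2 = (2 * sin (t / 2))\<^sup>2"
      using cos_double_sin[of "t / 2"] sin_cos_squared_add[of t]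
      by (simp add: cmod_def power2_eq_square algebra_simps)
    then have "\<bar>norm (cis t - 1)\<bar> = \<bar>2 * sin (t / 2)\<bar>" by (simp only: power2_eq_iff abs_eq_iff)
    then show ?thesis by (simp add: abs_mult)
  qed
  moreover have "sin x \<le> \<bar>sin (t / 2)\<bar>" by (cases "0 \<le> t") (auto simp: x_def)
  ultimately show ?thesis by (auto simp: x_def)
qed

text \<open>The trivial bound \<open>J\<close> and the geometric series bound
  \<open>6 / \<bar>t\<bar>\<close> are merged into one function whose mean is an elementary
  logarithm: each of the two products with \<open>norm X\<close> is at most 6, and their sum gives
  12.\<close>

lemma norm_dirichlet_le:
  assumes t: "\<bar>t\<bar> \<le> pi" and J: "1 \<le> J"
  shows "norm (\<Sum>j=1..J. cis (- (of_int (int j) * t))) \<le> 12 / (6 / real J + \<bar>t\<bar>)"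
proof -
  define X where "X = (\<Sum>j=1..J. cis (- (of_int (int j) * t)))"
  have X_alt: "X = (\<Sum>j=1..J. cis (-t) ^ j)"
    unfolding X_def by (simp add: Complex.DeMoivre)
  have "norm X \<le> (\<Sum>j=1..J. norm (cis (-t) ^ j))" unfolding X_alt by (rule norm_sum)
  then have 1: "norm X \<le> real J" by (simp add: norm_power)
  have "X * (cis (-t) - 1) = cis (-t) ^ Suc J - cis (-t)"
    unfolding X_alt by (induction J) (auto simp: algebra_simps)
  then have "norm X * norm (cis (-t) - 1) = norm (cis (-t) ^ Suc J - cis (-t))"
    by (metis norm_mult)
  also have "\<dots> \<le> 2"
    using norm_triangle_ineq4[of "cis (-t) ^ Suc J" "cis (-t)"] by (simp add: norm_power norm_mult)
  finally have "norm X * norm (cis (-t) - 1) \<le> 2" .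
  moreover have "norm X * (\<bar>t\<bar> / 3) \<le> norm X * norm (cis (-t) - 1)"
    using norm_cis_diff_one_ge[of "-t"] t by (intro mult_left_mono) auto
  ultimately have "norm X * \<bar>t\<bar> \<le> 6" by linarith
  moreover have "norm X * (6 / real J) \<le> 6" using 1 J by (simp add: field_simps)
  ultimately have "norm X * (6 / real J + \<bar>t\<bar>) \<le> 12" by (simp add: distrib_left)
  moreover have "0 < 6 / real J + \<bar>t\<bar>" using J by (intro add_pos_nonneg) auto
  ultimately show ?thesis by (simp add: X_def pos_le_divide_eq)
qed

lemma cavg_inverse_abs:
  assumes a: "0 < a"
  shows "circ_integrable (\<lambda>t. 12 / (a + \<bar>t\<bar>))" "cavg (\<lambda>t. 12 / (a + \<bar>t\<bar>)) = 12 / pi * ln (1 + pi / a)"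
proof -
  have 1: "((\<lambda>t. 12 / (a + \<bar>t\<bar>)) has_integral (12 * ln (a + pi) - 12 * ln (a + 0))) {0..pi}"
  proof (rule fundamental_theorem_of_calculus)
    fix x assume x: "x \<in> {0..pi}"
    have "((\<lambda>t. 12 * ln (a + t)) has_real_derivative 12 / (a + x)) (at x within {0..pi})"
      using a x by (auto intro!: derivative_eq_intros)
    then show "((\<lambda>t. 12 * ln (a + t)) has_vector_derivative 12 / (a + \<bar>x\<bar>)) (at x within {0..pi})"
      using x by (simp add: has_real_derivative_iff_has_vector_derivative)
  qed simp
  have 2: "((\<lambda>t. 12 / (a + \<bar>t\<bar>)) has_integral (12 * ln (a + pi) - 12 * ln (a + 0))) {-pi..0}"
    using 1 has_integral_reflect_real[where a=0 and b=pi and f="\<lambda>t. 12 / (a + \<bar>t\<bar>)"] by simp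
  have 3: "((\<lambda>t. 12 / (a + \<bar>t\<bar>)) has_integral (24 * (ln (a + pi) - ln a))) {-pi..pi}"
    using has_integral_combine[OF _ _ 2 1] by simp
  show "circ_integrable (\<lambda>t. 12 / (a + \<bar>t\<bar>))" using 3 by blast
  have "ln (a + pi) - ln a = ln (1 + pi / a)"
    using a ln_div[of "a + pi" a] pi_gt_zero by (simp add: add_divide_distrib)
  then show "cavg (\<lambda>t. 12 / (a + \<bar>t\<bar>)) = 12 / pi * ln (1 + pi / a)"
    using 3 by (simp add: cavg_def integral_unique field_simps)
qed

text \<open>Translation moves the evaluation point to \<open>0\<close>, where the partial sum is the
  mean of \<open>f\<close> against a one-sided Dirichlet kernel; the bound is the \<open>L1\<close>
  norm of that kernel. The constant 4 comes from \<open>12 / pi \<le> 4\<close>.\<close>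

lemma fourier_partial_sum_log:
  fixes f :: "real \<Rightarrow> complex"
  assumes f: "continuous_on UNIV f" and per: "\<And>t. f (t + 2 * pi) = f t"
    and M: "\<And>t. norm (f t) \<le> M" and J: "1 \<le> J"
  shows "norm (\<Sum>j=1..J. fc f (int j) * cis (of_int (int j) * \<theta>)) \<le> 4 * M * (1 + ln (real J))"
proof -
  define g where "g t = f (t + \<theta>)" for t
  have g: "continuous_on UNIV g" unfolding g_def
    by (intro continuous_on_compose2[OF f] continuous_intros) auto
  have M0: "0 \<le> M" using M[of 0] norm_ge_zero order_trans by blast
  have ci: "circ_integrable (\<lambda>t. g t * cis (c * t))" for c
    by (intro circ_integrable_continuous continuous_intros g)
  have "(\<Sum>j=1..J. fc f (int j) * cis (of_int (int j) * \<theta>)) = (\<Sum>j=1..J. fc g (int j))"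
    unfolding g_def by (simp only: fc_shift[OF f per] mult.commute)
  also have "\<dots> = cavg (\<lambda>t. \<Sum>j=1..J. g t * cis (- (of_int (int j) * t)))"
    unfolding fc_def using ci[of "- of_int (int j)" for j] by (subst cavg_sum) auto
  also have "\<dots> = cavg (\<lambda>t. g t * (\<Sum>j=1..J. cis (- (of_int (int j) * t))))"
    by (simp add: sum_distrib_left)
  also have "norm \<dots> \<le> cavg (\<lambda>t. M * (12 / (6 / real J + \<bar>t\<bar>)))"
  proof (rule norm_cavg_le)
    show "circ_integrable (\<lambda>t. g t * (\<Sum>j = 1..J. cis (- (of_int (int j) * t))))"
      by (intro circ_integrable_continuous continuous_intros g)
    show "circ_integrable (\<lambda>t. M * (12 / (6 / real J + \<bar>t\<bar>)))"
      using J by (intro integrable_on_mult_right cavg_inverse_abs) auto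
    fix t :: real assume "t \<in> {-pi..pi}"
    then show "norm (g t * (\<Sum>j = 1..J. cis (- (of_int (int j) * t)))) \<le> M * (12 / (6 / real J + \<bar>t\<bar>))"
      unfolding norm_mult using M M0 J
      by (intro mult_mono norm_dirichlet_le) (auto simp: g_def)
  qed
  also have "\<dots> = M * (12 / pi * ln (1 + pi / (6 / real J)))"
    using J by (simp only: cavg_mult_left) (subst cavg_inverse_abs, auto)
  also have "\<dots> \<le> M * (4 * (1 + ln (real J)))"
  proof (intro mult_left_mono M0 mult_mono)
    show "12 / pi \<le> 4" using pi_gt3 by (simp add: divide_simps)
    have "1 + pi / (6 / real J) \<le> exp 1 * real J"
    proof -
      have "pi * real J \<le> 4 * real J" using pi_less_4 by (intro mult_right_mono) auto
      moreover have "2 * real J \<le> exp 1 * real J" using exp_ge_add_one_self[of 1] by (intro mult_right_mono) auto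
      moreover have "1 \<le> real J" using J by simp
      ultimately have "1 + pi * real J / 6 \<le> exp 1 * real J" by linarith
      then show ?thesis by simp
    qed
    then have "ln (1 + pi / (6 / real J)) \<le> ln (exp 1 * real J)"
      using J by (subst ln_le_cancel_iff) (auto intro!: add_pos_nonneg)
    then show "ln (1 + pi / (6 / real J)) \<le> 1 + ln (real J)" using J by (simp add: ln_mult)
  qed (use J in auto)
  finally show ?thesis by (simp add: algebra_simps)
qed

section \<open>Fourier series of Lipschitz functions\<close>

lemma tendsto_cis_difference_quotient:
  "((\<lambda>h. (cis (c * h) - 1) / of_real h) \<longlongrightarrow> \<i> * of_real c) (at 0)"
proof -
  have "((\<lambda>z. exp (\<i> * of_real c * z)) has_field_derivative \<i> * of_real c) (at 0)"
    by (auto intro!: derivative_eq_intros)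
  then have "((\<lambda>z. (exp (\<i> * of_real c * z) - 1) / z) \<longlongrightarrow> \<i> * of_real c) (at 0)"
    by (simp add: has_field_derivative_iff)
  moreover have "filterlim complex_of_real (at 0) (at 0)"
    unfolding filterlim_at
    by (auto simp: eventually_at_filter intro!: tendsto_eq_intros)
  ultimately have "((\<lambda>h. (exp (\<i> * of_real c * of_real h) - 1) / of_real h) \<longlongrightarrow> \<i> * of_real c) (at (0::real))"
    by (rule filterlim_compose)
  then show ?thesis by (simp add: cis_conv_exp mult.assoc)
qed

locale lipschitz_circle =
  fixes W :: "real \<Rightarrow> complex" and L :: real
  assumes lip: "\<And>x y. norm (W x - W y) \<le> L * \<bar>x - y\<bar>"
    and per: "\<And>t. W (t + 2 * pi) = W t"
begin

lemma L_nonneg: "0 \<le> L"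
  using order_trans[OF norm_ge_zero lip[of 1 0]] by simp

lemma cont: "continuous_on UNIV W"
proof -
  have "L-lipschitz_on UNIV W"
    using lip L_nonneg by (intro lipschitz_onI) (auto simp: dist_norm)
  then show ?thesis by (rule lipschitz_on_continuous_on)
qed

text \<open>Substitute for the derivative of \<open>W\<close>, which exists only almost everywhere.
  The quotients are continuous, periodic and bounded by \<open>L\<close> uniformly in
  \<open>h\<close>, and their Fourier coefficients tend to those of the formal derivative.
  Inequalities between finitely many coefficients, such as Bessel's and the logarithmic bound below,
  therefore pass to the limit \<open>h \<rightarrow> 0\<close>.\<close>

definition dq :: "real \<Rightarrow> real \<Rightarrow> complex" where
  "dq h t = (W (t + h) - W t) / of_real h"

lemma cont_shift: "continuous_on UNIV (\<lambda>t. W (t + h))"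
  by (intro continuous_on_compose2[OF cont] continuous_intros) auto

lemma dq_cont: "continuous_on UNIV (dq h)"
  unfolding dq_def divide_inverse by (intro continuous_intros cont_shift cont)

lemma dq_bound:
  assumes "h \<noteq> 0"
  shows "norm (dq h t) \<le> L"
  using lip[of "t + h" t] assms by (simp add: dq_def norm_divide pos_divide_le_eq)

lemma dq_per: "dq h (t + 2 * pi) = dq h t"
  using per[of t] per[of "t + h"] by (simp add: dq_def add_ac)

lemma fc_dq: "fc (dq h) j = fc W j * ((cis (of_int j * h) - 1) / of_real h)"
proof -
  have ci: "circ_integrable (\<lambda>t. W (t + x) * cis (- (of_int j * t)))" for x
    using cont_shift by (intro circ_integrable_continuous continuous_intros)
  have "fc (dq h) j = cavg (\<lambda>t. (W (t + h) * cis (- (of_int j * t)) - W t * cis (- (of_int j * t))) * (1 / of_real h))"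
    unfolding fc_def dq_def by (simp add: left_diff_distrib)
  also have "\<dots> = (fc (\<lambda>t. W (t + h)) j - fc W j) * (1 / of_real h)"
    unfolding fc_def using ci[of h] ci[of 0] by (simp only: cavg_mult_right add_0_right cavg_diff)
  finally show ?thesis by (simp only: fc_shift[OF cont per]) (simp add: algebra_simps diff_divide_distrib)
qed

lemma tendsto_fc_dq: "((\<lambda>h. fc (dq h) j) \<longlongrightarrow> fc W j * (\<i> * of_int j)) (at 0)"
  using tendsto_mult[OF tendsto_const tendsto_cis_difference_quotient[of "of_int j"]]
  unfolding fc_dq by simp

lemma bessel_deriv:
  assumes "finite F"
  shows "(\<Sum>j\<in>F. (norm (of_int j * fc W j))\<^sup>2) \<le> L\<^sup>2"
proof (rule tendsto_upperbound)
  show "((\<lambda>h. \<Sum>j\<in>F. (norm (fc (dq h) j))\<^sup>2) \<longlongrightarrow> (\<Sum>j\<in>F. (norm (of_int j * fc W j))\<^sup>2)) (at 0)"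
  proof (intro tendsto_sum)
    fix j
    have "((\<lambda>h. (norm (fc (dq h) j))\<^sup>2) \<longlongrightarrow> (norm (fc W j * (\<i> * of_int j)))\<^sup>2) (at 0)"
      by (intro tendsto_power tendsto_norm tendsto_fc_dq)
    then show "((\<lambda>h. (norm (fc (dq h) j))\<^sup>2) \<longlongrightarrow> (norm (of_int j * fc W j))\<^sup>2) (at 0)"
      by (simp add: norm_mult mult.commute)
  qed
  show "\<forall>\<^sub>F h in at 0. (\<Sum>j\<in>F. (norm (fc (dq h) j))\<^sup>2) \<le> L\<^sup>2"
    unfolding eventually_at_filter
    using dq_bound dq_cont assms
    by (intro always_eventually allI impI bessel) (auto intro: borel_measurable_continuous_onI)
qed auto

lemma deriv_partial_sum_log:
  assumes "1 \<le> J"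
  shows "norm (\<Sum>j=1..J. of_nat j * fc W (int j) * cis (of_int (int j) * \<theta>)) \<le> 4 * L * (1 + ln (real J))"
proof (rule tendsto_upperbound)
  show "((\<lambda>h. norm (\<Sum>j=1..J. fc (dq h) (int j) * cis (of_int (int j) * \<theta>))) \<longlongrightarrow>
      norm (\<Sum>j=1..J. of_nat j * fc W (int j) * cis (of_int (int j) * \<theta>))) (at 0)"
  proof -
    have "((\<lambda>h. norm (\<Sum>j=1..J. fc (dq h) (int j) * cis (of_int (int j) * \<theta>))) \<longlongrightarrow>
      norm (\<Sum>j=1..J. (fc W (int j) * (\<i> * of_int (int j))) * cis (of_int (int j) * \<theta>))) (at 0)"
      by (intro tendsto_norm tendsto_sum tendsto_mult tendsto_fc_dq tendsto_const)
    moreover have "(\<Sum>j=1..J. (fc W (int j) * (\<i> * of_int (int j))) * cis (of_int (int j) * \<theta>))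
       = \<i> * (\<Sum>j=1..J. of_nat j * fc W (int j) * cis (of_int (int j) * \<theta>))"
      by (simp add: sum_distrib_left mult_ac)
    ultimately show ?thesis by (simp only: norm_mult norm_ii mult_1)
  qed
  show "\<forall>\<^sub>F h in at 0. norm (\<Sum>j=1..J. fc (dq h) (int j) * cis (of_int (int j) * \<theta>)) \<le> 4 * L * (1 + ln (real J))"
    unfolding eventually_at_filter
    using dq_bound dq_cont dq_per assms
    by (intro always_eventually allI impI fourier_partial_sum_log) auto
qed auto

text \<open>With \<open>A t = W (\<theta> + t) - W \<theta> = (cis t - 1) B t\<close> the Fourier coefficients of \<open>A\<close> are differences of
  consecutive coefficients of the bounded function \<open>B\<close>, so the partial sums of \<open>A\<close> at \<open>0\<close> telescope.\<close>
lemma fourier_series_tendsto: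
  "(\<lambda>J. \<Sum>j=-int J..int J. fc W j * cis (of_int j * \<theta>)) \<longlonglongrightarrow> W \<theta>"
proof -
  define A where "A t = W (t + \<theta>) - W \<theta>" for t
  define B where "B t = A t / (cis t - 1)" for t
  have contA: "continuous_on UNIV A" unfolding A_def by (intro continuous_intros cont_shift)
  have measB: "B \<in> borel_measurable borel"
  proof -
    have "A \<in> borel_measurable borel" "(\<lambda>t. cis t - 1) \<in> borel_measurable borel"
      using contA by (auto intro!: borel_measurable_continuous_onI continuous_intros)
    then show ?thesis unfolding B_def by measurable
  qed
  have ge: "norm (cis t - 1) \<ge> \<bar>t\<bar> / 3" if "t \<in> {-pi..pi}" for t
    using that by (intro norm_cis_diff_one_ge) auto
  \<comment> \<open>The Lipschitz bound \<open>L * \<bar>t\<bar>\<close> for \<open>A\<close> is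
    divided by the chord bound \<open>\<bar>t\<bar> / 3\<close>.\<close>
  have Bb: "norm (B t) \<le> 3 * L" if t: "t \<in> {-pi..pi}" for t
  proof (cases "t = 0")
    case False
    then have "0 < norm (cis t - 1)" using ge[OF t] by (rule_tac less_le_trans[of 0 "\<bar>t\<bar> / 3"]) auto
    moreover have "norm (A t) \<le> 3 * L * (\<bar>t\<bar> / 3)"
      using lip[of "t + \<theta>" \<theta>] by (simp add: A_def)
    moreover have "3 * L * (\<bar>t\<bar> / 3) \<le> 3 * L * norm (cis t - 1)"
      using ge[OF t] L_nonneg by (intro mult_left_mono) auto
    ultimately show ?thesis by (simp add: B_def norm_divide pos_divide_le_eq)
  qed (use L_nonneg in \<open>simp add: B_def\<close>)
  have AB: "A t = (cis t - 1) * B t" if "t \<in> {-pi..pi}" for t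
  proof (cases "t = 0")
    case False
    then have "cis t - 1 \<noteq> 0" using ge[OF that] by auto
    then show ?thesis by (simp add: B_def)
  qed (simp add: A_def)
  have ciB: "circ_integrable (\<lambda>t. B t * cis (- (of_int j * t)))" for j
    using circ_integrable_mult_cis[OF measB Bb, of "- of_int j"] by simp
  have fcA: "fc A j = fc B (j - 1) - fc B j" for j
  proof -
    have "fc A j = cavg (\<lambda>t. B t * cis (- (of_int (j - 1) * t)) - B t * cis (- (of_int j * t)))"
      unfolding fc_def by (rule cavg_cong) (simp add: AB algebra_simps cis_mult)
    then show ?thesis unfolding fc_def cavg_diff[OF ciB ciB] .
  qed
  have tel: "(\<Sum>j=-int J..int J. fc A j) = fc B (- 1 - int J) - fc B (int J)" for J
  proof (induction J)
    case (Suc J)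
    have "{-int (Suc J)..int (Suc J)} = insert (int (Suc J)) (insert (-int (Suc J)) {-int J..int J})" by auto
    then show ?case using Suc by (simp add: fcA algebra_simps)
  qed (simp add: fcA)
  have fcA': "fc A j = fc W j * cis (of_int j * \<theta>) - (if j = 0 then W \<theta> else 0)" for j
  proof -
    have "fc A j = cavg (\<lambda>t. W (t + \<theta>) * cis (- (of_int j * t)) - W \<theta> * cis (of_int (-j) * t))"
      unfolding fc_def A_def by (rule arg_cong[where f=cavg]) (auto simp: algebra_simps)
    also have "\<dots> = fc (\<lambda>t. W (t + \<theta>)) j - W \<theta> * (if j = 0 then 1 else 0)"
      unfolding fc_def
      by (subst cavg_diff) (auto simp: cavg_mult_left cavg_cis simp del: of_int_minus
          intro!: circ_integrable_continuous continuous_intros cont_shift)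
    finally show ?thesis by (simp add: fc_shift[OF cont per])
  qed
  have eq: "(\<Sum>j=-int J..int J. fc W j * cis (of_int j * \<theta>)) = W \<theta> + (fc B (- 1 - int J) - fc B (int J))" for J
    unfolding tel[symmetric] fcA' by (simp add: sum_subtractf)
  \<comment> \<open>The Riemann-Lebesgue lemma for \<open>B\<close>, obtained from Bessel: along any
    injective sequence of indices the squared coefficients are summable and hence tend to 0.\<close>
  have null: "(\<lambda>J. fc B (g J)) \<longlonglongrightarrow> 0" if "inj g" for g :: "nat \<Rightarrow> int"
  proof -
    have "summable (\<lambda>J. (norm (fc B (g J)))\<^sup>2)"
    proof (rule summableI_nonneg_bounded)
      fix n
      have "(\<Sum>J<n. (norm (fc B (g J)))\<^sup>2) = (\<Sum>j\<in>g ` {..<n}. (norm (fc B j))\<^sup>2)"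
        using that by (subst sum.reindex) (auto intro: inj_on_subset)
      also have "\<dots> \<le> (3 * L)\<^sup>2" by (rule bessel[OF measB Bb]) auto
      finally show "(\<Sum>J<n. (norm (fc B (g J)))\<^sup>2) \<le> (3 * L)\<^sup>2" .
    qed auto
    then have "(\<lambda>J. sqrt ((norm (fc B (g J)))\<^sup>2)) \<longlonglongrightarrow> sqrt 0"
      by (intro tendsto_real_sqrt summable_LIMSEQ_zero)
    then show ?thesis by (simp add: tendsto_norm_zero_iff)
  qed
  have "(\<lambda>J. W \<theta> + (fc B (- 1 - int J) - fc B (int J))) \<longlonglongrightarrow> W \<theta> + (0 - 0)"
    by (intro tendsto_intros null) (auto simp: inj_def)
  then show ?thesis unfolding eq by simp
qed

end

lemma fc_deriv:
  assumes "\<And>t. (f has_vector_derivative f' t) (at t)" "continuous_on UNIV f'" "\<And>t. f (t + 2 * pi) = f t"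
  shows "fc f' j = \<i> * of_int j * fc f j"
proof -
  have contf: "continuous_on UNIV f"
    using assms(1) by (meson continuous_on_vector_derivative has_vector_derivative_at_within)
  let ?e = "\<lambda>t. cis (- of_int j * t)"
  have "cavg (\<lambda>t. f t * (\<i> * of_real (- of_int j) * ?e t) + f' t * ?e t) = 0"
  proof (rule cavg_deriv_periodic[of "\<lambda>t. f t * ?e t"])
    show "((\<lambda>t. f t * ?e t) has_vector_derivative f t * (\<i> * of_real (- of_int j) * ?e t) + f' t * ?e t) (at t)" for t
      by (intro has_vector_derivative_mult assms has_vector_derivative_cis_mult)
    show "f (t + 2 * pi) * ?e (t + 2 * pi) = f t * ?e t" for t
      using assms(3) cis_minus_int_periodic[of j t] by simp
  qed
  also have "cavg (\<lambda>t. f t * (\<i> * of_real (- of_int j) * ?e t) + f' t * ?e t)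
     = cavg (\<lambda>t. (\<i> * of_real (- of_int j)) * (f t * ?e t)) + cavg (\<lambda>t. f' t * ?e t)"
    by (subst cavg_add) (auto intro!: circ_integrable_continuous continuous_intros contf assms(2) arg_cong[where f=cavg] simp: mult_ac)
  finally show ?thesis unfolding cavg_mult_left by (simp add: fc_def)
qed

section \<open>Jets of functions with Lipschitz top derivative\<close>

lemma periodic_int:
  fixes f :: "real \<Rightarrow> 'a"
  assumes "\<And>x. f (x + 2 * pi) = f x"
  shows "f (x + 2 * pi * of_int n) = f x"
proof -
  have nat: "f (x + 2 * pi * of_nat k) = f x" for k x
  proof (induction k)
    case (Suc k)
    then show ?case using assms[of "x + 2 * pi * of_nat k"] by (simp add: algebra_simps)
  qed simp
  show ?thesis
  proof (cases "0 \<le> n")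
    case True
    then show ?thesis using nat[of x "nat n"] by simp
  next
    case False
    then show ?thesis using nat[of "x + 2 * pi * of_int n" "nat (-n)"] by simp
  qed
qed

lemma circle_reduce:
  obtains n :: int where "\<bar>x - y - 2 * pi * of_int n\<bar> \<le> pi"
proof
  let ?q = "(x - y + pi) / (2 * pi)"
  have p: "0 < 2 * pi" by simp
  have "of_int \<lfloor>?q\<rfloor> * (2 * pi) \<le> x - y + pi"
    using of_int_floor_le[of ?q] unfolding pos_le_divide_eq[OF p] .
  moreover have "x - y + pi < (of_int \<lfloor>?q\<rfloor> + 1) * (2 * pi)"
    using real_of_int_floor_add_one_gt[of ?q] unfolding pos_divide_less_eq[OF p] .
  ultimately show "\<bar>x - y - 2 * pi * of_int \<lfloor>?q\<rfloor>\<bar> \<le> pi" by (auto simp: algebra_simps abs_le_iff)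
qed

lemma lipschitz_periodic_bounded:
  fixes f :: "real \<Rightarrow> real"
  assumes "\<And>x y. \<bar>f x - f y\<bar> \<le> L * \<bar>x - y\<bar>" "\<And>x. f (x + 2 * pi) = f x"
  shows "\<bar>f x\<bar> \<le> \<bar>f 0\<bar> + L * pi"
proof -
  have L0: "0 \<le> L" using order_trans[OF abs_ge_zero assms(1)[of 1 0]] by simp
  obtain n :: int where n: "\<bar>x - 0 - 2 * pi * of_int n\<bar> \<le> pi" by (rule circle_reduce)
  define y where "y = x - 2 * pi * of_int n"
  have "f x = f y" using periodic_int[of f y n] assms(2) by (simp add: y_def)
  moreover have "\<bar>f y - f 0\<bar> \<le> L * pi"
    using assms(1)[of y 0] n mult_left_mono[OF _ L0, of "\<bar>y\<bar>" pi] by (simp add: y_def)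
  ultimately show ?thesis by linarith
qed

text \<open>Boundedness is built in because Lipschitz functions alone are not closed under products;
  one constant for both keeps the closure lemmas short.\<close>

definition bounded_lipschitz :: "(real \<Rightarrow> real) \<Rightarrow> bool" where
  "bounded_lipschitz f \<longleftrightarrow> (\<exists>C. \<forall>x y. \<bar>f x - f y\<bar> \<le> C * \<bar>x - y\<bar> \<and> \<bar>f x\<bar> \<le> C)"

lemma bounded_lipschitz_const: "bounded_lipschitz (\<lambda>x. c)"
  unfolding bounded_lipschitz_def by (rule exI[of _ "\<bar>c\<bar>"]) simp

lemma bounded_lipschitzI:
  assumes "\<And>x y. \<bar>f x - f y\<bar> \<le> L * \<bar>x - y\<bar>" "\<And>x. \<bar>f x\<bar> \<le> B"
  shows "bounded_lipschitz f"
proof -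
  have "L * \<bar>x - y\<bar> \<le> max L B * \<bar>x - y\<bar>" for x y by (intro mult_right_mono) auto
  moreover have "B \<le> max L B" by simp
  ultimately show ?thesis unfolding bounded_lipschitz_def using assms by (meson order_trans)
qed

lemma bounded_lipschitz_add:
  assumes "bounded_lipschitz f" "bounded_lipschitz g"
  shows "bounded_lipschitz (\<lambda>x. f x + g x)"
proof -
  obtain C D where C: "\<And>x y. \<bar>f x - f y\<bar> \<le> C * \<bar>x - y\<bar>" "\<And>x. \<bar>f x\<bar> \<le> C"
    and D: "\<And>x y. \<bar>g x - g y\<bar> \<le> D * \<bar>x - y\<bar>" "\<And>x. \<bar>g x\<bar> \<le> D"
    using assms unfolding bounded_lipschitz_def by metis
  show ?thesis
  proof (rule bounded_lipschitzI)
    fix x y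
    show "\<bar>f x + g x - (f y + g y)\<bar> \<le> (C + D) * \<bar>x - y\<bar>"
      using C(1)[of x y] D(1)[of x y] by (simp add: distrib_right)
    show "\<bar>f x + g x\<bar> \<le> C + D" using C(2)[of x] D(2)[of x] by linarith
  qed
qed

lemma bounded_lipschitz_mult:
  assumes "bounded_lipschitz f" "bounded_lipschitz g"
  shows "bounded_lipschitz (\<lambda>x. f x * g x)"
proof -
  obtain C D where C: "\<And>x y. \<bar>f x - f y\<bar> \<le> C * \<bar>x - y\<bar>" "\<And>x. \<bar>f x\<bar> \<le> C"
    and D: "\<And>x y. \<bar>g x - g y\<bar> \<le> D * \<bar>x - y\<bar>" "\<And>x. \<bar>g x\<bar> \<le> D"
    using assms unfolding bounded_lipschitz_def by metis
  have C0: "0 \<le> C" using order_trans[OF abs_ge_zero C(2)] .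
  have D0: "0 \<le> D" using order_trans[OF abs_ge_zero D(2)] .
  show ?thesis
  proof (rule bounded_lipschitzI)
    fix x y
    have "f x * g x - f y * g y = f x * (g x - g y) + (f x - f y) * g y" by (simp add: algebra_simps)
    also have "\<bar>\<dots>\<bar> \<le> \<bar>f x\<bar> * \<bar>g x - g y\<bar> + \<bar>f x - f y\<bar> * \<bar>g y\<bar>"
      by (metis abs_mult abs_triangle_ineq)
    also have "\<dots> \<le> C * (D * \<bar>x - y\<bar>) + (C * \<bar>x - y\<bar>) * D"
      using C D C0 D0 by (intro add_mono mult_mono) auto
    finally show "\<bar>f x * g x - f y * g y\<bar> \<le> (2 * C * D) * \<bar>x - y\<bar>" by (simp add: algebra_simps)
    show "\<bar>f x * g x\<bar> \<le> C * D" unfolding abs_mult using C D C0 by (intro mult_mono) auto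
  qed
qed

lemma bounded_lipschitz_sum:
  assumes "\<And>i. i \<in> I \<Longrightarrow> bounded_lipschitz (f i)"
  shows "bounded_lipschitz (\<lambda>x. \<Sum>i\<in>I. f i x)"
  using assms
  by (induction I rule: infinite_finite_induct) (auto intro: bounded_lipschitz_const bounded_lipschitz_add)

lemma bounded_lipschitz_exp:
  assumes "bounded_lipschitz f"
  shows "bounded_lipschitz (\<lambda>x. exp (f x))"
proof -
  obtain C where C: "\<And>x y. \<bar>f x - f y\<bar> \<le> C * \<bar>x - y\<bar>" "\<And>x. \<bar>f x\<bar> \<le> C"
    using assms unfolding bounded_lipschitz_def by metis
  have C0: "0 \<le> C" using order_trans[OF abs_ge_zero C(2)] .
  have le: "exp (f x) \<le> exp C" for x using C(2)[of x] by simp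
  have "exp (f x) - exp (f y) \<le> exp C * (C * \<bar>x - y\<bar>)" for x y
  proof -
    have "exp (f x) * (1 + (f y - f x)) \<le> exp (f x) * exp (f y - f x)"
      by (intro mult_left_mono exp_ge_add_one_self) auto
    then have "exp (f x) - exp (f y) \<le> exp (f x) * (f x - f y)"
      by (simp add: exp_add[symmetric] algebra_simps)
    also have "\<dots> \<le> exp (f x) * (C * \<bar>x - y\<bar>)"
      using C(1)[of x y] by (intro mult_left_mono) auto
    also have "\<dots> \<le> exp C * (C * \<bar>x - y\<bar>)"
      using le C0 by (intro mult_right_mono) auto
    finally show ?thesis .
  qed
  then have "\<bar>exp (f x) - exp (f y)\<bar> \<le> exp C * C * \<bar>x - y\<bar>" for x y
    by (simp add: abs_le_iff) (metis abs_minus_commute mult.assoc)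
  then show ?thesis using le by (intro bounded_lipschitzI[where B = "exp C"]) auto
qed

text \<open>\<open>d p\<close> plays the role of the \<open>p\<close>-th derivative and
  \<open>m\<close> that of \<open>k - 1\<close>. The derivatives are parameters because the theory
  is instantiated twice: with the jet of \<open>V\<close> and with the jet of
  \<open>exp V\<close>.\<close>

locale circle_jet =
  fixes m :: nat and d :: "nat \<Rightarrow> real \<Rightarrow> real"
  assumes deriv: "\<And>p x. p < m \<Longrightarrow> (d p has_real_derivative d (Suc p) x) (at x)"
    and periodic: "\<And>p x. p \<le> m \<Longrightarrow> d p (x + 2 * pi) = d p x"
    and top_lipschitz: "\<exists>L. \<forall>x y. \<bar>d m x - d m y\<bar> \<le> L * \<bar>x - y\<bar>"
begin

text \<open>Downward induction from the Lipschitz top derivative: a bound for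
  \<open>d (Suc p)\<close> is a Lipschitz constant for \<open>d p\<close>, and periodicity turns
  that into a bound for \<open>d p\<close>.\<close>

lemma bounded_lipschitz_jet:
  assumes "p \<le> m"
  shows "bounded_lipschitz (d p)"
  using assms
proof (induction p rule: inc_induct)
  case base
  obtain L where L: "\<And>x y. \<bar>d m x - d m y\<bar> \<le> L * \<bar>x - y\<bar>" using top_lipschitz by blast
  show ?case
    using lipschitz_periodic_bounded[OF L periodic[OF order_refl]] by (rule bounded_lipschitzI[OF L])
next
  case (step p)
  obtain C where C: "\<And>x. \<bar>d (Suc p) x\<bar> \<le> C"
    using step.IH unfolding bounded_lipschitz_def by metis
  have L: "\<bar>d p x - d p y\<bar> \<le> C * \<bar>x - y\<bar>" for x y
    using field_differentiable_bound[of UNIV "d p" "d (Suc p)" C x y] deriv[of p] step C by auto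
  show ?case
    using lipschitz_periodic_bounded[OF L periodic] step by (intro bounded_lipschitzI[OF L]) auto
qed

lemma lipschitz_circle_jet:
  assumes "p \<le> m"
  obtains L where "lipschitz_circle (\<lambda>t. complex_of_real (d p t)) L"
proof -
  obtain C where "\<And>x y. \<bar>d p x - d p y\<bar> \<le> C * \<bar>x - y\<bar>"
    using bounded_lipschitz_jet[OF assms] unfolding bounded_lipschitz_def by metis
  then show ?thesis
    using periodic[OF assms] by (intro that[of C], unfold_locales) (simp_all flip: of_real_diff)
qed

lemma cont_jet: "p \<le> m \<Longrightarrow> continuous_on UNIV (\<lambda>t. complex_of_real (d p t))"
  using lipschitz_circle_jet[of p] lipschitz_circle.cont by blast

section \<open>Fourier coefficients and partial sums of a jet\<close>

definition u :: "int \<Rightarrow> complex" where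
  "u = fc (\<lambda>t. complex_of_real (d 0 t))"

lemma fc_jet: "p \<le> m \<Longrightarrow> fc (\<lambda>t. complex_of_real (d p t)) j = (\<i> * of_int j) ^ p * u j"
proof (induction p)
  case (Suc p)
  have "((\<lambda>t. complex_of_real (d p t)) has_vector_derivative complex_of_real (d (Suc p) t)) (at t)" for t
    using Suc.prems deriv[of p t] has_vector_derivative_of_real by (auto simp: has_real_derivative_iff_has_vector_derivative)
  then have "fc (\<lambda>t. complex_of_real (d (Suc p) t)) j = \<i> * of_int j * fc (\<lambda>t. complex_of_real (d p t)) j"
    using Suc.prems by (intro fc_deriv cont_jet) (auto simp: periodic)
  then show ?case using Suc by simp
qed (simp add: u_def)

lemma u_uminus: "u (- j) = cnj (u j)"
proof -
  have "cnj (u j) = cavg (\<lambda>t. cnj (complex_of_real (d 0 t) * cis (- of_int j * t)))"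
    unfolding u_def fc_def
    by (subst cavg_cnj) (auto intro!: circ_integrable_continuous continuous_intros cont_jet)
  then show ?thesis by (simp add: u_def fc_def cis_cnj)
qed

text \<open>Integration by parts supplies \<open>m\<close> factors \<open>j\<close>; the last one
  comes from the Lipschitz bound on \<open>d m\<close> through difference quotients.\<close>

lemma sum_squares_bounded: "\<exists>C. \<forall>F. finite F \<longrightarrow> (\<Sum>j\<in>F. (norm (of_int j ^ Suc m * u j))\<^sup>2) \<le> C"
proof -
  obtain L where "lipschitz_circle (\<lambda>t. complex_of_real (d m t)) L"
    using lipschitz_circle_jet by blast
  then have "(\<Sum>j\<in>F. (norm (of_int j * ((\<i> * of_int j) ^ m * u j)))\<^sup>2) \<le> L\<^sup>2" if "finite F" for F
    using lipschitz_circle.bessel_deriv[OF _ that] fc_jet[of m] by fastforce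
  then show ?thesis by (intro exI[of _ "L\<^sup>2"]) (simp add: norm_mult norm_power power_mult_distrib mult.assoc)
qed

lemma partial_sum_log:
  "\<exists>C\<ge>0. \<forall>J\<ge>1. \<forall>\<theta>. norm (\<Sum>j=1..J. of_nat j ^ Suc m * u (int j) * cis (real j * \<theta>)) \<le> C * (1 + ln (real J))"
proof -
  obtain L where L: "lipschitz_circle (\<lambda>t. complex_of_real (d m t)) L"
    using lipschitz_circle_jet by blast
  have "norm (\<Sum>j=1..J. of_nat j ^ Suc m * u (int j) * cis (real j * \<theta>)) \<le> 4 * L * (1 + ln (real J))"
    if "1 \<le> J" for J \<theta>
  proof -
    have "(\<Sum>j=1..J. of_nat j * fc (\<lambda>t. complex_of_real (d m t)) (int j) * cis (of_int (int j) * \<theta>))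
        = \<i> ^ m * (\<Sum>j=1..J. of_nat j ^ Suc m * u (int j) * cis (real j * \<theta>))"
      unfolding fc_jet[OF order_refl] sum_distrib_left
      by (intro sum.cong refl) (simp add: power_mult_distrib mult_ac)
    then show ?thesis
      using lipschitz_circle.deriv_partial_sum_log[OF L that, of \<theta>] by (simp add: norm_mult norm_power)
  qed
  then show ?thesis using lipschitz_circle.L_nonneg[OF L] by (intro exI[of _ "4 * L"]) auto
qed

text \<open>By \<open>fc_jet\<close> this is, for \<open>p \<le> m\<close>, the symmetric Fourier
  partial sum of order \<open>N\<close> of \<open>d p\<close>.\<close>

definition partial_jet :: "nat \<Rightarrow> nat \<Rightarrow> real \<Rightarrow> complex" where
  "partial_jet p N \<theta> = (\<Sum>j=-int N..int N. (\<i> * of_int j) ^ p * u j * cis (of_int j * \<theta>))"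

lemma partial_jet_term_cnj:
  "(\<i> * of_int (- int n)) ^ p * u (- int n) * cis (of_int (- int n) * \<theta>)
    = cnj ((\<i> * of_nat n) ^ p * u (int n) * cis (real n * \<theta>))"
  by (simp add: u_uminus cis_cnj)

text \<open>The jet is real, so negative frequencies are conjugates of positive ones, and estimates
  for one-sided sums suffice.\<close>

lemma partial_jet_tail:
  assumes "N \<le> M"
  shows "partial_jet p M \<theta> - partial_jet p N \<theta> =
    (\<Sum>j\<in>{N<..M}. (\<i> * of_nat j) ^ p * u (int j) * cis (real j * \<theta>))
    + cnj (\<Sum>j\<in>{N<..M}. (\<i> * of_nat j) ^ p * u (int j) * cis (real j * \<theta>))"
  using assms
proof (induction M rule: dec_induct)
  case (step M)
  have s1: "{-int (Suc M)..int (Suc M)} = insert (int (Suc M)) (insert (-int (Suc M)) {-int M..int M})" by auto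
  have s2: "{N<..Suc M} = insert (Suc M) {N<..M}" using step by auto
  have "partial_jet p (Suc M) \<theta> - partial_jet p N \<theta> = (partial_jet p M \<theta> - partial_jet p N \<theta>)
     + (\<i> * of_nat (Suc M)) ^ p * u (int (Suc M)) * cis (real (Suc M) * \<theta>)
     + (\<i> * of_int (- int (Suc M))) ^ p * u (- int (Suc M)) * cis (of_int (- int (Suc M)) * \<theta>)"
    unfolding partial_jet_def s1 by (subst sum.insert sum.insert | simp)+
  then show ?case
    unfolding step.IH s2 partial_jet_term_cnj by (simp add: algebra_simps del: of_nat_Suc complex_cnj_mult complex_cnj_power)
qed simp

text \<open>The tail of \<open>d p\<close> is, up to a unimodular factor, the series with terms
  \<open>j ^ Suc m * u j * cis (j * \<theta>)\<close> divided by \<open>j ^ (Suc m - p)\<close>.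
  Abel summation against the logarithmic bound for its partial sums gives one constant for all
  \<open>p\<close>; convergence of the Fourier series then lets the upper end of the tail go to
  infinity.\<close>

lemma partial_jet_error:
  "\<exists>C\<ge>0. \<forall>p\<le>m. \<forall>N\<ge>1. \<forall>\<theta>. norm (of_real (d p \<theta>) - partial_jet p N \<theta>)
      \<le> C * (1 + ln (real (Suc N))) / real (Suc N) ^ (Suc m - p)"
proof -
  obtain C where C0: "0 \<le> C" and C: "\<And>J \<theta>. 1 \<le> J \<Longrightarrow>
      norm (\<Sum>j=1..J. of_nat j ^ Suc m * u (int j) * cis (real j * \<theta>)) \<le> C * (1 + ln (real J))"
    using partial_sum_log by metis
  have "norm (of_real (d p \<theta>) - partial_jet p N \<theta>) \<le> 6 * C * (1 + ln (real (Suc N))) / real (Suc N) ^ (Suc m - p)"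
    if p: "p \<le> m" and N: "1 \<le> N" for p N \<theta>
  proof (rule tendsto_upperbound)
    obtain L where L: "lipschitz_circle (\<lambda>t. complex_of_real (d p t)) L"
      using lipschitz_circle_jet[OF p] by blast
    have "(\<lambda>M. partial_jet p M \<theta>) \<longlonglongrightarrow> of_real (d p \<theta>)"
      using lipschitz_circle.fourier_series_tendsto[OF L, of \<theta>] by (simp add: partial_jet_def fc_jet[OF p])
    then show "(\<lambda>M. norm (partial_jet p M \<theta> - partial_jet p N \<theta>)) \<longlonglongrightarrow> norm (of_real (d p \<theta>) - partial_jet p N \<theta>)"
      by (intro tendsto_intros)
    have "norm (partial_jet p M \<theta> - partial_jet p N \<theta>) \<le> 6 * C * (1 + ln (real (Suc N))) / real (Suc N) ^ (Suc m - p)"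
      if "N \<le> M" for M
    proof -
      let ?a = "\<lambda>j. of_nat j ^ Suc m * u (int j) * cis (real j * \<theta>)"
      let ?T = "\<Sum>j\<in>{N<..M}. (\<i> * of_nat j) ^ p * u (int j) * cis (real j * \<theta>)"
      have "?T = \<i> ^ p * (\<Sum>j\<in>{N<..M}. ?a j / of_nat j ^ (Suc m - p))"
        unfolding sum_distrib_left
      proof (rule sum.cong)
        fix j assume "j \<in> {N<..M}"
        then have j: "j \<noteq> 0" by auto
        have "complex_of_nat j ^ Suc m = of_nat j ^ p * of_nat j ^ (Suc m - p)"
          using p by (simp flip: power_add del: power_Suc)
        then show "(\<i> * of_nat j) ^ p * u (int j) * cis (real j * \<theta>) = \<i> ^ p * (?a j / of_nat j ^ (Suc m - p))"
          using j by (simp add: power_mult_distrib del: power_Suc)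
      qed auto
      then have "norm ?T = norm (\<Sum>j\<in>{N<..M}. ?a j / of_nat j ^ (Suc m - p))"
        by (simp add: norm_mult norm_power)
      also have "\<dots> \<le> 3 * C * (1 + ln (real (Suc N))) / real (Suc N) ^ (Suc m - p)"
        by (rule log_abel_tail) (use C p N in auto)
      finally have "norm ?T \<le> 3 * C * (1 + ln (real (Suc N))) / real (Suc N) ^ (Suc m - p)" .
      moreover have "norm (?T + cnj ?T) \<le> norm ?T + norm ?T"
        using norm_triangle_ineq[of ?T "cnj ?T"] by (simp only: complex_mod_cnj)
      ultimately have "norm (?T + cnj ?T) \<le> 2 * (3 * C * (1 + ln (real (Suc N))) / real (Suc N) ^ (Suc m - p))"
        by linarith
      also have "\<dots> = 6 * C * (1 + ln (real (Suc N))) / real (Suc N) ^ (Suc m - p)" by simp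
      finally show ?thesis unfolding partial_jet_tail[OF that] .
    qed
    then show "\<forall>\<^sub>F M in sequentially. norm (partial_jet p M \<theta> - partial_jet p N \<theta>)
        \<le> 6 * C * (1 + ln (real (Suc N))) / real (Suc N) ^ (Suc m - p)"
      by (intro eventually_sequentiallyI[of N]) auto
  qed auto
  then show ?thesis using C0 by (intro exI[of _ "6 * C"]) auto
qed

end

text \<open>The recursion is compatible with the derivation that sends each Taylor coefficient
  \<open>a i\<close> to \<open>(i + 1) a (i + 1)\<close>: the left side is the derivative of the
  recursion's right side. The two halves of the product rule carry the weights \<open>i\<close> and
  \<open>Suc q - i\<close>, which add up to \<open>Suc q\<close>.\<close>

lemma expseq_derivation:
  fixes a c :: "nat \<Rightarrow> 'a::field_char_0"
  assumes c: "\<And>n. of_nat (Suc n) * c (Suc n) = (\<Sum>i\<le>n. of_nat (Suc i) * a (Suc i) * c (n - i))"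
  shows "(\<Sum>i\<le>q. of_nat (Suc i) * (of_nat (Suc (Suc i)) * a (Suc (Suc i))) * c (q - i)
      + of_nat (Suc i) * a (Suc i) * (of_nat (Suc (q - i)) * c (Suc (q - i))))
    = of_nat (Suc q) * (of_nat (Suc (Suc q)) * c (Suc (Suc q)))"
proof -
  let ?f = "\<lambda>i. of_nat (Suc i) * a (Suc i) * c (Suc q - i)"
  have 1: "(\<Sum>i\<le>q. of_nat (Suc i) * (of_nat (Suc (Suc i)) * a (Suc (Suc i))) * c (q - i)) = (\<Sum>i\<le>Suc q. of_nat i * ?f i)"
    by (subst sum.atMost_Suc_shift) (simp add: mult_ac)
  have 2: "(\<Sum>i\<le>q. of_nat (Suc i) * a (Suc i) * (of_nat (Suc (q - i)) * c (Suc (q - i)))) = (\<Sum>i\<le>Suc q. of_nat (Suc q - i) * ?f i)"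
    unfolding sum.atMost_Suc by (simp add: Suc_diff_le mult_ac del: of_nat_diff of_nat_Suc)
  have "of_nat (Suc q) * (of_nat (Suc (Suc q)) * c (Suc (Suc q))) = (\<Sum>i\<le>Suc q. of_nat (Suc q) * ?f i)"
    unfolding c sum_distrib_left ..
  also have "\<dots> = (\<Sum>i\<le>Suc q. of_nat i * ?f i + of_nat (Suc q - i) * ?f i)"
  proof (rule sum.cong)
    fix i assume "i \<in> {..Suc q}"
    then have "of_nat (Suc q) = (of_nat i + of_nat (Suc q - i) :: 'a)" by (simp flip: of_nat_add)
    then show "of_nat (Suc q) * ?f i = of_nat i * ?f i + of_nat (Suc q - i) * ?f i"
      by (simp only: distrib_right)
  qed auto
  also have "\<dots> = (\<Sum>i\<le>Suc q. of_nat i * ?f i) + (\<Sum>i\<le>Suc q. of_nat (Suc q - i) * ?f i)"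
    by (rule sum.distrib)
  finally show ?thesis unfolding sum.distrib 1 2 ..
qed

section \<open>The jet of the exponential\<close>

context circle_jet
begin

text \<open>For \<open>p \<le> m\<close> this is the \<open>p\<close>-th Taylor coefficient of
  \<open>exp (d 0)\<close> at \<open>x\<close>; the factor \<open>exp (d 0 x)\<close> restores the
  constant term that \<open>expseq\<close> leaves out.\<close>

definition exp_jet :: "nat \<Rightarrow> real \<Rightarrow> real" where
  "exp_jet p x = exp (d 0 x) * expseq (\<lambda>i. d i x / fact i) p"

lemma exp_jet_Suc:
  "real (Suc n) * exp_jet (Suc n) x = (\<Sum>i\<le>n. real (Suc i) * (d (Suc i) x / fact (Suc i)) * exp_jet (n - i) x)"
proof -
  have "real (Suc n) * exp_jet (Suc n) x = exp (d 0 x) * (real (Suc n) * expseq (\<lambda>i. d i x / fact i) (Suc n))"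
    by (simp only: exp_jet_def mult_ac)
  also have "\<dots> = (\<Sum>i\<le>n. real (Suc i) * (d (Suc i) x / fact (Suc i)) * exp_jet (n - i) x)"
    unfolding expseq_Suc_mult sum_distrib_left exp_jet_def by (simp only: mult_ac)
  finally show ?thesis .
qed

text \<open>The recursion builds \<open>exp_jet p\<close> from sums and products of
  \<open>d 1, \<dots>, d p\<close> and lower \<open>exp_jet\<close>s, so the top coefficient is
  Lipschitz without differentiating \<open>d m\<close>.\<close>

lemma bounded_lipschitz_exp_jet: "p \<le> m \<Longrightarrow> bounded_lipschitz (exp_jet p)"
proof (induction p rule: less_induct)
  case (less p)
  show ?case
  proof (cases p)
    case 0
    then show ?thesis using bounded_lipschitz_exp[OF bounded_lipschitz_jet[of 0]] by (simp add: exp_jet_def)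
  next
    case (Suc n)
    have "exp_jet (Suc n) = (\<lambda>x. 1 / real (Suc n) * (\<Sum>i\<le>n. real (Suc i) / fact (Suc i) * d (Suc i) x * exp_jet (n - i) x))"
      using exp_jet_Suc[of n] by (auto simp: field_simps simp del: of_nat_Suc fact_Suc)
    moreover have "bounded_lipschitz \<dots>"
      using less Suc by (intro bounded_lipschitz_mult bounded_lipschitz_sum bounded_lipschitz_const bounded_lipschitz_jet) auto
    ultimately show ?thesis using Suc by simp
  qed
qed

lemma exp_jet_deriv: "p < m \<Longrightarrow> (exp_jet p has_real_derivative real (Suc p) * exp_jet (Suc p) x) (at x)"
proof (induction p rule: less_induct)
  case (less p)
  show ?case
  proof (cases p)
    case 0
    have "((\<lambda>x. exp (d 0 x)) has_real_derivative exp (d 0 x) * d 1 x) (at x)"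
      using deriv[of 0 x] less 0 by (auto intro!: derivative_eq_intros)
    then show ?thesis using 0 by (simp add: exp_jet_def[abs_def] expseq.simps(2))
  next
    case (Suc q)
    let ?a = "\<lambda>i x. d i x / fact i"
    have da: "((\<lambda>x. ?a i x) has_real_derivative real (Suc i) * ?a (Suc i) x) (at x)" if "i < m" for i
    proof -
      have "real (Suc i) * ?a (Suc i) x = d (Suc i) x / fact i" by (simp del: of_nat_Suc)
      then show ?thesis using DERIV_cdivide[OF deriv[OF that, of x], of "fact i"] by simp
    qed
    have eq: "exp_jet (Suc q) = (\<lambda>x. (\<Sum>i\<le>q. real (Suc i) * ?a (Suc i) x * exp_jet (q - i) x) / real (Suc q))"
      using exp_jet_Suc[of q] by (auto simp: field_simps simp del: of_nat_Suc fact_Suc)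
    have "((\<lambda>x. \<Sum>i\<le>q. real (Suc i) * ?a (Suc i) x * exp_jet (q - i) x) has_real_derivative
       (\<Sum>i\<le>q. real (Suc i) * (real (Suc (Suc i)) * ?a (Suc (Suc i)) x) * exp_jet (q - i) x
        + real (Suc i) * ?a (Suc i) x * (real (Suc (q - i)) * exp_jet (Suc (q - i)) x))) (at x)"
    proof (rule DERIV_sum)
      fix i assume i: "i \<in> {..q}"
      have 1: "((\<lambda>x. real (Suc i) * ?a (Suc i) x) has_real_derivative real (Suc i) * (real (Suc (Suc i)) * ?a (Suc (Suc i)) x)) (at x)"
        using i less Suc by (intro DERIV_cmult da) auto
      have 2: "(exp_jet (q - i) has_real_derivative real (Suc (q - i)) * exp_jet (Suc (q - i)) x) (at x)"
        using i less Suc by (intro less.IH) auto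
      show "((\<lambda>x. real (Suc i) * ?a (Suc i) x * exp_jet (q - i) x) has_real_derivative
         real (Suc i) * (real (Suc (Suc i)) * ?a (Suc (Suc i)) x) * exp_jet (q - i) x
        + real (Suc i) * ?a (Suc i) x * (real (Suc (q - i)) * exp_jet (Suc (q - i)) x)) (at x)"
        using DERIV_mult[OF 1 2] by (simp add: mult_ac add.commute del: of_nat_Suc fact_Suc)
    qed
    from DERIV_cdivide[OF this, of "real (Suc q)"]
    show ?thesis unfolding Suc eq
      using expseq_derivation[of "\<lambda>n. exp_jet n x" "\<lambda>i. ?a i x" q] exp_jet_Suc
      by (simp del: of_nat_Suc fact_Suc)
  qed
qed

text \<open>The factor \<open>fact p\<close> turns Taylor coefficients into derivatives. With this
  instance all Fourier estimates for jets become available for \<open>exp V\<close>, with the same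
  order \<open>m\<close>.\<close>

lemma circle_jet_exp: "circle_jet m (\<lambda>p x. fact p * exp_jet p x)"
proof
  fix p x assume "p < m"
  from DERIV_cmult[OF exp_jet_deriv[OF this], of "fact p"]
  show "((\<lambda>x. fact p * exp_jet p x) has_real_derivative fact (Suc p) * exp_jet (Suc p) x) (at x)"
    by (simp add: algebra_simps)
next
  fix p x assume "p \<le> m"
  then have "expseq (\<lambda>i. d i (x + 2 * pi) / fact i) p = expseq (\<lambda>i. d i x / fact i) p"
    by (intro expseq_cong) (simp add: periodic)
  then show "fact p * exp_jet p (x + 2 * pi) = fact p * exp_jet p x"
    using periodic[of 0 x] by (simp add: exp_jet_def)
next
  have "bounded_lipschitz (\<lambda>x. fact m * exp_jet m x)"
    by (intro bounded_lipschitz_mult bounded_lipschitz_const bounded_lipschitz_exp_jet) auto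
  then show "\<exists>L. \<forall>x y. \<bar>fact m * exp_jet m x - fact m * exp_jet m y\<bar> \<le> L * \<bar>x - y\<bar>"
    unfolding bounded_lipschitz_def by blast
qed

end

lemma circle_jet_of_C_k_minus_1_1:
  assumes "1 \<le> k" "C_k_minus_1_1 k V"
  shows "circle_jet (k - 1) (\<lambda>p. (deriv ^^ p) V)"
proof
  have d: "((deriv ^^ p) V has_real_derivative (deriv ^^ Suc p) V x) (at x)" if "p < k - 1" for p x
  proof -
    have "(deriv ^^ p) V differentiable (at x)" using assms that unfolding C_k_minus_1_1_def by auto
    then show ?thesis by (simp add: DERIV_deriv_iff_real_differentiable)
  qed
  then show "((deriv ^^ p) V has_real_derivative (deriv ^^ Suc p) V x) (at x)" if "p < k - 1" for p x
    using that by blast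
  show "(deriv ^^ p) V (x + 2 * pi) = (deriv ^^ p) V x" if "p \<le> k - 1" for p x
    using that
  proof (induction p arbitrary: x)
    case 0
    then show ?case using assms unfolding C_k_minus_1_1_def by simp
  next
    case (Suc p)
    have "((\<lambda>x. (deriv ^^ p) V (x + 2 * pi)) has_real_derivative (deriv ^^ Suc p) V (x + 2 * pi)) (at x)"
      using d[of p "x + 2 * pi"] Suc.prems DERIV_shift[of "(deriv ^^ p) V" _ x "2 * pi"] by auto
    moreover have "(\<lambda>x. (deriv ^^ p) V (x + 2 * pi)) = (deriv ^^ p) V" using Suc by auto
    ultimately show ?case using d[of p x] Suc.prems DERIV_unique by fastforce
  qed
  show "\<exists>L. \<forall>x y. \<bar>(deriv ^^ (k - 1)) V x - (deriv ^^ (k - 1)) V y\<bar> \<le> L * \<bar>x - y\<bar>"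
    using assms unfolding C_k_minus_1_1_def by blast
qed

section \<open>Taylor coefficients of the Szego function\<close>

lemma add_power_le:
  fixes x y :: real
  assumes "0 \<le> x" "0 \<le> y"
  shows "(x + y) ^ p \<le> 2 ^ p * (x ^ p + y ^ p)"
proof -
  have "(x + y) ^ p \<le> (2 * max x y) ^ p" using assms by (intro power_mono) auto
  also have "\<dots> = 2 ^ p * max x y ^ p" by (simp add: power_mult_distrib)
  also have "\<dots> \<le> 2 ^ p * (x ^ p + y ^ p)" using assms by (intro mult_left_mono) (auto simp: max_def)
  finally show ?thesis .
qed

lemma power_diff_le:
  fixes x y :: real
  assumes "0 \<le> y" "y \<le> x"
  shows "x ^ Suc n - y ^ Suc n \<le> real (Suc n) * (x - y) * x ^ n"
proof (induction n)
  case (Suc n)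
  have "x ^ Suc (Suc n) - y ^ Suc (Suc n) = x * (x ^ Suc n - y ^ Suc n) + (x - y) * y ^ Suc n"
    by (simp add: algebra_simps)
  also have "\<dots> \<le> x * (real (Suc n) * (x - y) * x ^ n) + (x - y) * x ^ Suc n"
    using assms Suc by (intro add_mono mult_left_mono power_mono) auto
  also have "\<dots> = real (Suc (Suc n)) * (x - y) * x ^ Suc n" by (simp add: algebra_simps)
  finally show ?case .
qed simp

lemma expseq_convolution:
  "of_nat l * expseq a l = (\<Sum>i\<le>l. of_nat i * a i * expseq a (l - i))"
proof (cases l)
  case (Suc n)
  show ?thesis unfolding Suc expseq_Suc_mult by (subst sum.atMost_Suc_shift) simp
qed simp

lemma summable_convolution:
  fixes a b :: "nat \<Rightarrow> real"
  assumes "summable a" "summable b" "\<And>i. 0 \<le> a i" "\<And>i. 0 \<le> b i"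
  shows "summable (\<lambda>l. \<Sum>i\<le>l. a i * b (l - i))"
  by (rule summable_Cauchy_product) (use assms in auto)

text \<open>Young's inequality for the convolution of a square summable and a summable sequence:
  Cauchy-Schwarz after splitting \<open>b\<close> into two square roots.\<close>

lemma summable_square_convolution:
  fixes a b :: "nat \<Rightarrow> real"
  assumes a: "summable (\<lambda>i. (a i)\<^sup>2)" and b: "summable b" and "\<And>i. 0 \<le> b i"
  shows "summable (\<lambda>l. (\<Sum>i\<le>l. a i * b (l - i))\<^sup>2)"
proof (rule summable_comparison_test')
  show "summable (\<lambda>l. (\<Sum>i\<le>l. (a i)\<^sup>2 * b (l - i)) * suminf b)"
    by (intro summable_mult2 summable_convolution) (use assms in auto)
  fix l :: nat assume "0 \<le> l"
  have "(\<Sum>i\<le>l. a i * b (l - i))\<^sup>2 = (\<Sum>i\<le>l. (a i * sqrt (b (l - i))) * sqrt (b (l - i)))\<^sup>2"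
    using assms(3) by (simp add: mult.assoc)
  also have "\<dots> \<le> (\<Sum>i\<le>l. (a i * sqrt (b (l - i)))\<^sup>2) * (\<Sum>i\<le>l. (sqrt (b (l - i)))\<^sup>2)"
    by (rule Cauchy_Schwarz_ineq_sum)
  also have "\<dots> = (\<Sum>i\<le>l. (a i)\<^sup>2 * b (l - i)) * (\<Sum>i\<le>l. b (l - i))"
    using assms(3) by (simp add: power_mult_distrib)
  also have "(\<Sum>i\<le>l. b (l - i)) = (\<Sum>i\<le>l. b i)"
    by (rule sum.nat_diff_reindex[of b "Suc l", simplified lessThan_Suc_atMost diff_Suc_Suc])
  also have "(\<Sum>i\<le>l. (a i)\<^sup>2 * b (l - i)) * (\<Sum>i\<le>l. b i) \<le> (\<Sum>i\<le>l. (a i)\<^sup>2 * b (l - i)) * suminf b"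
    using assms(3) by (intro mult_left_mono sum_le_suminf b sum_nonneg) auto
  finally show "norm ((\<Sum>i\<le>l. a i * b (l - i))\<^sup>2) \<le> (\<Sum>i\<le>l. (a i)\<^sup>2 * b (l - i)) * suminf b" by simp
qed

lemma summable_square_of_summable:
  fixes a :: "nat \<Rightarrow> real"
  assumes "summable a" "\<And>i. 0 \<le> a i"
  shows "summable (\<lambda>i. (a i)\<^sup>2)"
proof (rule summable_comparison_test')
  show "summable (\<lambda>i. suminf a * a i)" by (intro summable_mult assms)
  fix i :: nat
  have "a i \<le> suminf a" using sum_le_suminf[OF assms(1), of "{i}"] assms(2) by simp
  then show "norm ((a i)\<^sup>2) \<le> suminf a * a i"
    using assms(2)[of i] by (simp add: power2_eq_square mult_right_mono)
qed

lemma mult_le_half_squares: "x * y \<le> (x\<^sup>2 + y\<^sup>2) / 2" for x y :: real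
  using zero_le_power2[of "x - y"] by (simp add: power2_diff)

lemma sum_inverse_squares_tail_le:
  "(\<Sum>l\<in>{N<..M}. 1 / (real l)\<^sup>2) \<le> 2 / real (Suc N)"
proof (cases "N \<le> M")
  case True
  then have "(\<Sum>l\<in>{N<..M}. 1 / (real l)\<^sup>2) \<le> 2 / real (Suc N) - 2 / real (Suc M)"
  proof (induction M rule: dec_induct)
    case (step M)
    have "{N<..Suc M} = insert (Suc M) {N<..M}" using step by auto
    moreover have "1 / (real (Suc M))\<^sup>2 \<le> 2 / real (Suc M) - 2 / real (Suc (Suc M))"
    proof -
      have "2 / real (Suc M) - 2 / real (Suc (Suc M)) = 2 / (real (Suc M) * real (Suc (Suc M)))"
        by (simp add: field_simps)
      also have "\<dots> \<ge> 2 / (real (Suc M) * (2 * real (Suc M)))"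
        by (intro divide_left_mono mult_left_mono) auto
      also have "2 / (real (Suc M) * (2 * real (Suc M))) = 1 / (real (Suc M))\<^sup>2"
        by (simp add: power2_eq_square divide_simps del: of_nat_Suc)
      finally show ?thesis .
    qed
    ultimately show ?case using step.IH by simp
  qed simp
  then show ?thesis by (rule order_trans) simp
qed simp

lemma sum_inverse_Suc_le: "(\<Sum>j\<le>J. 1 / real (Suc j)) \<le> 1 + ln (real (Suc J))"
proof (induction J)
  case (Suc J)
  have "ln (real (Suc J) / real (Suc (Suc J))) \<le> real (Suc J) / real (Suc (Suc J)) - 1"
    by (rule ln_le_minus_one) simp
  also have "\<dots> = - (1 / real (Suc (Suc J)))" by (simp add: field_simps)
  finally have "1 / real (Suc (Suc J)) \<le> ln (real (Suc (Suc J))) - ln (real (Suc J))"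
    by (simp add: ln_div)
  then show ?case using Suc by simp
qed simp

context circle_jet
begin

definition v :: "nat \<Rightarrow> complex" where
  "v i = (if i = 0 then 0 else u (int i))"

definition g :: "nat \<Rightarrow> complex" where
  "g = expseq v"

lemma g_0 [simp]: "g 0 = 1" by (simp add: g_def)

lemma summable_v_squares: "summable (\<lambda>i. (real i ^ Suc m * norm (v i))\<^sup>2)"
proof -
  obtain C where C: "\<And>F. finite F \<Longrightarrow> (\<Sum>j\<in>F. (norm (of_int j ^ Suc m * u j))\<^sup>2) \<le> C"
    using sum_squares_bounded by blast
  show ?thesis
  proof (rule summableI_nonneg_bounded)
    fix n
    have "(\<Sum>i<n. (real i ^ Suc m * norm (v i))\<^sup>2) = (\<Sum>i<n. (norm (of_int (int i) ^ Suc m * u (int i)))\<^sup>2)"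
      by (intro sum.cong refl) (auto simp: v_def norm_mult norm_power)
    also have "\<dots> = (\<Sum>j\<in>int ` {..<n}. (norm (of_int j ^ Suc m * u j))\<^sup>2)"
      by (subst sum.reindex) auto
    also have "\<dots> \<le> C" by (rule C) auto
    finally show "(\<Sum>i<n. (real i ^ Suc m * norm (v i))\<^sup>2) \<le> C" .
  qed auto
qed

text \<open>The square summable sequence \<open>i ^ Suc m * norm (v i)\<close> is paired with
  \<open>1 / i\<close>, so one full power is given up for absolute summability.\<close>

lemma summable_v:
  assumes "p \<le> m"
  shows "summable (\<lambda>i. real i ^ p * norm (v i))"
proof (rule summable_comparison_test')
  show "summable (\<lambda>i. ((real i ^ Suc m * norm (v i))\<^sup>2 + (inverse (real i ^ 2))) / 2)"
    by (intro summable_divide summable_add summable_v_squares inverse_power_summable) auto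
  fix i :: nat assume "0 \<le> i"
  show "norm (real i ^ p * norm (v i)) \<le> ((real i ^ Suc m * norm (v i))\<^sup>2 + (inverse (real i ^ 2))) / 2"
  proof (cases "i = 0")
    case False
    have "real i ^ p * norm (v i) \<le> real i ^ m * norm (v i)"
      using False assms by (intro mult_right_mono power_increasing) auto
    also have "\<dots> = (real i ^ Suc m * norm (v i)) * inverse (real i)" using False by simp
    also have "\<dots> \<le> ((real i ^ Suc m * norm (v i))\<^sup>2 + (inverse (real i))\<^sup>2) / 2"
      by (rule mult_le_half_squares)
    finally show ?thesis by (simp add: power_inverse)
  qed (simp add: v_def)
qed

lemma summable_norm_v: "summable (\<lambda>i. norm (v i))"
  using summable_v[of 0] by simp

text \<open>One factor \<open>l\<close> turns \<open>g l\<close> into the convolution of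
  \<open>i * v i\<close> with \<open>g\<close>; the other \<open>p\<close> factors are shared
  between \<open>i\<close> and \<open>l - i\<close> by \<open>add_power_le\<close>. Since
  \<open>Suc p \<le> m\<close>, \<open>v\<close> can carry all powers placed on it, and the
  induction hypothesis takes care of those on \<open>g\<close>.\<close>

lemma summable_g: "p \<le> m \<Longrightarrow> summable (\<lambda>l. real l ^ p * norm (g l))"
proof (induction p)
  case 0
  then show ?case using summable_norm_expseq[OF summable_norm_v] by (simp add: g_def)
next
  case (Suc p)
  note s0 = summable_norm_expseq[OF summable_norm_v, folded g_def]
  let ?b = "\<lambda>l. 2 ^ p * ((\<Sum>i\<le>l. (real i ^ Suc p * norm (v i)) * norm (g (l - i)))
       + (\<Sum>i\<le>l. (real i ^ 1 * norm (v i)) * (real (l - i) ^ p * norm (g (l - i)))))"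
  show ?case
  proof (rule summable_comparison_test')
    show "summable ?b"
      using Suc s0 by (intro summable_mult summable_add summable_convolution summable_v) auto
    fix l :: nat assume "0 \<le> l"
    have "real l ^ Suc p * norm (g l) = real l ^ p * norm (of_nat l * g l)"
      by (simp add: norm_mult)
    also have "\<dots> \<le> real l ^ p * (\<Sum>i\<le>l. real i * norm (v i) * norm (g (l - i)))"
      unfolding g_def expseq_convolution
      by (intro mult_left_mono order_trans[OF norm_sum] sum_mono) (auto simp: norm_mult)
    also have "\<dots> = (\<Sum>i\<le>l. real l ^ p * (real i * norm (v i) * norm (g (l - i))))"
      by (rule sum_distrib_left)
    also have "\<dots> \<le> (\<Sum>i\<le>l. 2 ^ p * (real i ^ p + real (l - i) ^ p) * (real i * norm (v i) * norm (g (l - i))))"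
    proof (intro sum_mono mult_right_mono)
      fix i assume "i \<in> {..l}"
      then show "real l ^ p \<le> 2 ^ p * (real i ^ p + real (l - i) ^ p)"
        using add_power_le[of "real i" "real (l - i)" p] by simp
    qed auto
    also have "\<dots> = ?b l"
      by (simp add: sum_distrib_left sum.distrib[symmetric] algebra_simps)
    finally show "norm (real l ^ Suc p * norm (g l)) \<le> ?b l" by simp
  qed
qed

lemma summable_norm_g: "summable (\<lambda>l. norm (g l))"
  using summable_g[of 0] by simp

text \<open>The price of moving all \<open>Suc m\<close> powers of \<open>l\<close> onto
  \<open>v\<close>, which is the only factor with known behaviour at this critical order.\<close>

definition g_err :: "nat \<Rightarrow> complex" where
  "g_err l = of_nat l ^ Suc m * g l - (\<Sum>i\<le>l. of_nat i ^ Suc m * v i * g (l - i))"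

text \<open>Each term contains \<open>l ^ m - i ^ m\<close>, which is bounded by multiples of
  \<open>(l - i) * i ^ (m - 1)\<close> and \<open>(l - i) ^ m\<close>. At least one power thus falls
  on \<open>g (l - i)\<close>, and \<open>v\<close> has to carry no more than \<open>i ^ m\<close>,
  which is summable. For \<open>m = 0\<close> the difference vanishes and is treated
  separately.\<close>

lemma summable_g_err: "summable (\<lambda>l. norm (g_err l))"
proof -
  have eq: "g_err l = (\<Sum>i\<le>l. (of_nat l ^ m - of_nat i ^ m) * (of_nat i * v i * g (l - i)))" for l
  proof -
    have "of_nat l ^ Suc m * g l = of_nat l ^ m * (of_nat l * g l)" by simp
    also have "\<dots> = (\<Sum>i\<le>l. of_nat l ^ m * (of_nat i * v i * g (l - i)))"
      unfolding g_def expseq_convolution by (rule sum_distrib_left)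
    finally show ?thesis
      unfolding g_err_def by (simp add: sum_subtractf[symmetric] algebra_simps)
  qed
  show ?thesis
  proof (cases m)
    case 0
    have "g_err l = 0" for l by (subst eq) (simp add: 0)
    then show ?thesis by simp
  next
    case (Suc n)
    let ?b = "\<lambda>l. real m * 2 ^ n * ((\<Sum>i\<le>l. (real i ^ m * norm (v i)) * (real (l - i) ^ 1 * norm (g (l - i))))
       + (\<Sum>i\<le>l. (real i ^ 1 * norm (v i)) * (real (l - i) ^ m * norm (g (l - i)))))"
    show ?thesis
    proof (rule summable_comparison_test')
      show "summable ?b"
        using Suc by (intro summable_mult summable_add summable_convolution summable_v summable_g) auto
      fix l :: nat assume "0 \<le> l"
      have "norm (g_err l) \<le> (\<Sum>i\<le>l. (real m * 2 ^ n * (real (l - i) * real i ^ n + real (l - i) ^ m)) * (real i * norm (v i) * norm (g (l - i))))"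
        unfolding eq
      proof (rule sum_norm_le)
        fix i assume i: "i \<in> {..l}"
        have "norm (complex_of_nat l ^ m - of_nat i ^ m) = norm (of_real (real l ^ m - real i ^ m) :: complex)" by simp
        also have "\<dots> = real l ^ m - real i ^ m"
          unfolding norm_of_real using i by (simp add: power_mono)
        also have "\<dots> \<le> real m * (real l - real i) * real l ^ n"
          using i Suc power_diff_le[of "real i" "real l" n] by simp
        also have "\<dots> \<le> real m * (real l - real i) * (2 ^ n * (real i ^ n + real (l - i) ^ n))"
          using i add_power_le[of "real i" "real (l - i)" n] by (intro mult_left_mono mult_nonneg_nonneg) auto
        also have "\<dots> = real m * 2 ^ n * (real (l - i) * real i ^ n + real (l - i) ^ m)"
          using i Suc by (simp add: algebra_simps)
        finally show "norm ((of_nat l ^ m - of_nat i ^ m) * (of_nat i * v i * g (l - i)))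
          \<le> (real m * 2 ^ n * (real (l - i) * real i ^ n + real (l - i) ^ m)) * (real i * norm (v i) * norm (g (l - i)))"
          unfolding norm_mult norm_of_nat by (rule mult_right_mono) auto
      qed
      also have "\<dots> = ?b l"
        using Suc by (simp add: sum_distrib_left sum.distrib[symmetric] algebra_simps)
      finally show "norm (norm (g_err l)) \<le> ?b l" by simp
    qed
  qed
qed

text \<open>The critical regularity of \<open>v\<close> is inherited by \<open>g\<close>: a square
  summable sequence convolved with a summable one, plus the summable \<open>g_err\<close>.\<close>

lemma summable_g_squares: "summable (\<lambda>l. (real l ^ Suc m * norm (g l))\<^sup>2)"
proof (rule summable_comparison_test')
  let ?c = "\<lambda>l. \<Sum>i\<le>l. (real i ^ Suc m * norm (v i)) * norm (g (l - i))"
  show "summable (\<lambda>l. 2 * (?c l)\<^sup>2 + 2 * (norm (g_err l))\<^sup>2)"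
    by (intro summable_add summable_mult summable_square_convolution summable_v_squares summable_norm_g
        summable_square_of_summable summable_g_err) auto
  fix l :: nat assume "0 \<le> l"
  have "real l ^ Suc m * norm (g l) = norm ((\<Sum>i\<le>l. of_nat i ^ Suc m * v i * g (l - i)) + g_err l)"
    by (simp add: g_err_def norm_mult norm_power)
  also have "\<dots> \<le> ?c l + norm (g_err l)"
    by (intro norm_triangle_mono order_trans[OF norm_sum] sum_mono) (auto simp: norm_mult norm_power)
  finally have "(real l ^ Suc m * norm (g l))\<^sup>2 \<le> (?c l + norm (g_err l))\<^sup>2"
    by (intro power_mono) auto
  also have "\<dots> \<le> 2 * (?c l)\<^sup>2 + 2 * (norm (g_err l))\<^sup>2"
    using zero_le_power2[of "?c l - norm (g_err l)"] unfolding power2_sum power2_diff by linarith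
  finally show "norm ((real l ^ Suc m * norm (g l))\<^sup>2) \<le> 2 * (?c l)\<^sup>2 + 2 * (norm (g_err l))\<^sup>2" by simp
qed

lemma g_decay: "\<exists>C\<ge>0. \<forall>l. real l ^ Suc m * norm (g l) \<le> C"
proof -
  let ?s = "\<Sum>l. (real l ^ Suc m * norm (g l))\<^sup>2"
  have "real l ^ Suc m * norm (g l) \<le> sqrt ?s" for l
    using sum_le_suminf[OF summable_g_squares, of "{l}"] by (intro real_le_rsqrt) simp
  moreover have "0 \<le> sqrt ?s" by (intro real_sqrt_ge_zero suminf_nonneg summable_g_squares) auto
  ultimately show ?thesis by blast
qed

lemma g_square_tail: "\<exists>C\<ge>0. \<forall>N M. (\<Sum>l\<in>{N<..M}. (norm (g l))\<^sup>2) \<le> C / real (Suc N) ^ (2 * Suc m)"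
proof -
  let ?s = "\<Sum>l. (real l ^ Suc m * norm (g l))\<^sup>2"
  have "(\<Sum>l\<in>{N<..M}. (norm (g l))\<^sup>2) \<le> ?s / real (Suc N) ^ (2 * Suc m)" for N M
  proof -
    have "real (Suc N) ^ (2 * Suc m) * (\<Sum>l\<in>{N<..M}. (norm (g l))\<^sup>2) \<le> (\<Sum>l\<in>{N<..M}. (real l ^ Suc m * norm (g l))\<^sup>2)"
      unfolding sum_distrib_left
    proof (rule sum_mono)
      fix l assume "l \<in> {N<..M}"
      then have "real (Suc N) ^ (2 * Suc m) \<le> real l ^ (2 * Suc m)" by (intro power_mono) auto
      then show "real (Suc N) ^ (2 * Suc m) * (norm (g l))\<^sup>2 \<le> (real l ^ Suc m * norm (g l))\<^sup>2"
        unfolding power_mult_distrib power_even_eq by (rule mult_right_mono) auto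
    qed
    also have "\<dots> \<le> ?s" by (rule sum_le_suminf[OF summable_g_squares]) auto
    finally show ?thesis by (simp add: pos_le_divide_eq mult.commute)
  qed
  moreover have "0 \<le> ?s" by (intro suminf_nonneg summable_g_squares) auto
  ultimately show ?thesis by blast
qed

definition R :: "nat \<Rightarrow> real" where
  "R N = (\<Sum>l. norm (g (l + Suc N)))"

text \<open>Cauchy-Schwarz between the square summable \<open>l * norm (g l)\<close> and
  \<open>1 / l\<close>, whose squares have a tail of order \<open>1 / N\<close>. Already this weak
  decay is enough for the logarithmic bound that follows.\<close>

lemma R_square_le: "\<exists>C\<ge>0. \<forall>N. (R N)\<^sup>2 \<le> C / real (Suc N)"
proof -
  let ?s = "\<Sum>l. (real l ^ Suc m * norm (g l))\<^sup>2"
  have s0: "0 \<le> ?s" by (intro suminf_nonneg summable_g_squares) auto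
  have "(R N)\<^sup>2 \<le> 2 * ?s / real (Suc N)" for N
  proof (rule tendsto_upperbound)
    have "summable (\<lambda>l. norm (g (l + Suc N)))" by (rule summable_ignore_initial_segment[OF summable_norm_g])
    then show "(\<lambda>M. (\<Sum>l<M. norm (g (l + Suc N)))\<^sup>2) \<longlonglongrightarrow> (R N)\<^sup>2"
      unfolding R_def by (intro tendsto_power summable_LIMSEQ)
    have "(\<Sum>l<M. norm (g (l + Suc N)))\<^sup>2 \<le> 2 * ?s / real (Suc N)" for M
    proof -
      have "(\<Sum>l<M. norm (g (l + Suc N))) = (\<Sum>l\<in>{N<..N + M}. norm (g l))"
        by (rule sum.reindex_bij_witness[of _ "\<lambda>l. l - Suc N" "\<lambda>l. l + Suc N"]) auto
      also have "\<dots> = (\<Sum>l\<in>{N<..N + M}. (real l * norm (g l)) * (1 / real l))"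
        by (rule sum.cong) auto
      also have "(\<dots>)\<^sup>2 \<le> (\<Sum>l\<in>{N<..N + M}. (real l * norm (g l))\<^sup>2) * (\<Sum>l\<in>{N<..N + M}. (1 / real l)\<^sup>2)"
        by (rule Cauchy_Schwarz_ineq_sum)
      also have "\<dots> \<le> ?s * (2 / real (Suc N))"
      proof (intro mult_mono s0)
        have "(\<Sum>l\<in>{N<..N + M}. (real l * norm (g l))\<^sup>2) \<le> (\<Sum>l\<in>{N<..N + M}. (real l ^ Suc m * norm (g l))\<^sup>2)"
          by (intro sum_mono power_mono mult_right_mono self_le_power) auto
        also have "\<dots> \<le> ?s" by (rule sum_le_suminf[OF summable_g_squares]) auto
        finally show "(\<Sum>l\<in>{N<..N + M}. (real l * norm (g l))\<^sup>2) \<le> ?s" .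
        show "(\<Sum>l\<in>{N<..N + M}. (1 / real l)\<^sup>2) \<le> 2 / real (Suc N)"
          using sum_inverse_squares_tail_le[of N "N + M"] by (simp add: power_divide)
      qed (auto intro: sum_nonneg)
      finally show ?thesis by (simp add: mult.commute)
    qed
    then show "\<forall>\<^sub>F M in sequentially. (\<Sum>l<M. norm (g (l + Suc N)))\<^sup>2 \<le> 2 * ?s / real (Suc N)" by simp
  qed auto
  then show ?thesis using s0 by (intro exI[of _ "2 * ?s"]) auto
qed

text \<open>The truncated convolution differs from the product of the partial sum of the first factor with the
  full sum of the second one only by \<open>\<Sum>i\<le>J. |A i| R (J - i)\<close>, where \<open>A\<close> is square summable and
  \<open>R N = O(N^(-1/2))\<close>.\<close>
lemma g_partial_sum_log:
  "\<exists>C\<ge>0. \<forall>J\<ge>1. \<forall>\<theta>. norm (\<Sum>l=1..J. of_nat l ^ Suc m * g l * cis (real l * \<theta>)) \<le> C * (1 + ln (real J))"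
proof -
  obtain Cv where Cv0: "0 \<le> Cv" and Cv: "\<And>J \<theta>. 1 \<le> J \<Longrightarrow>
      norm (\<Sum>j=1..J. of_nat j ^ Suc m * u (int j) * cis (real j * \<theta>)) \<le> Cv * (1 + ln (real J))"
    using partial_sum_log by metis
  obtain CR where CR0: "0 \<le> CR" and CR: "\<And>N. (R N)\<^sup>2 \<le> CR / real (Suc N)"
    using R_square_le by metis
  define G where "G = (\<Sum>l. norm (g l))"
  define E where "E = (\<Sum>l. norm (g_err l))"
  define S where "S = (\<Sum>i. (real i ^ Suc m * norm (v i))\<^sup>2)"
  have G0: "0 \<le> G" unfolding G_def by (intro suminf_nonneg summable_norm_g) auto
  have E0: "0 \<le> E" unfolding E_def by (intro suminf_nonneg summable_g_err) auto
  have S0: "0 \<le> S" unfolding S_def by (intro suminf_nonneg summable_v_squares) auto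
  have "norm (\<Sum>l=1..J. of_nat l ^ Suc m * g l * cis (real l * \<theta>)) \<le> (Cv * G + S + 2 * CR + E) * (1 + ln (real J))"
    if J: "1 \<le> J" for J \<theta>
  proof -
    define \<zeta> where "\<zeta> = cis \<theta>"
    have z: "norm \<zeta> = 1" by (simp add: \<zeta>_def)
    have zl: "cis (real l * \<theta>) = \<zeta> ^ l" for l by (simp add: \<zeta>_def Complex.DeMoivre)
    define A where "A i = of_nat i ^ Suc m * v i" for i
    define T where "T N = (\<Sum>j\<le>N. g j * \<zeta> ^ j)" for N
    define Gz where "Gz = (\<Sum>j. g j * \<zeta> ^ j)"
    have sgz: "summable (\<lambda>j. g j * \<zeta> ^ j)"
      by (rule summable_power_series_disc[OF summable_norm_g]) (simp add: z)
    have normGz: "norm Gz \<le> G"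
      unfolding Gz_def G_def using z
      by (intro order_trans[OF summable_norm] summable_power_series_disc[OF summable_norm_g])
         (simp_all add: norm_mult norm_power)
    have R: "norm (T N - Gz) \<le> R N" for N
    proof -
      have "Gz = (\<Sum>j. g (j + Suc N) * \<zeta> ^ (j + Suc N)) + T N"
        unfolding Gz_def T_def using suminf_split_initial_segment[OF sgz, of "Suc N"]
        by (simp only: lessThan_Suc_atMost)
      then have "norm (T N - Gz) = norm (\<Sum>j. g (j + Suc N) * \<zeta> ^ (j + Suc N))"
        by (simp add: norm_minus_commute del: power_Suc add_Suc_right)
      also have "\<dots> \<le> (\<Sum>j. norm (g (j + Suc N) * \<zeta> ^ (j + Suc N)))"
        using summable_norm_g summable_iff_shift[of "\<lambda>l. norm (g l)" "Suc N"] z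
        by (intro summable_norm) (simp add: norm_mult norm_power)
      also have "\<dots> = R N" unfolding R_def using z by (simp add: norm_mult norm_power)
      finally show ?thesis .
    qed
    have "(\<Sum>l=1..J. of_nat l ^ Suc m * g l * cis (real l * \<theta>)) = (\<Sum>l\<le>J. of_nat l ^ Suc m * g l * \<zeta> ^ l)"
      unfolding zl by (rule sum.mono_neutral_left) (auto simp: not_le less_Suc_eq_0_disj)
    also have "\<dots> = (\<Sum>l\<le>J. (\<Sum>i\<le>l. (A i * \<zeta> ^ i) * (g (l - i) * \<zeta> ^ (l - i)))) + (\<Sum>l\<le>J. g_err l * \<zeta> ^ l)"
    proof -
      have "of_nat l ^ Suc m * g l * \<zeta> ^ l = (\<Sum>i\<le>l. (A i * \<zeta> ^ i) * (g (l - i) * \<zeta> ^ (l - i))) + g_err l * \<zeta> ^ l" for l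
      proof -
        have "(\<Sum>i\<le>l. (A i * \<zeta> ^ i) * (g (l - i) * \<zeta> ^ (l - i))) = (\<Sum>i\<le>l. A i * g (l - i)) * \<zeta> ^ l"
          unfolding sum_distrib_right
        proof (rule sum.cong)
          fix i assume "i \<in> {..l}"
          then have "\<zeta> ^ l = \<zeta> ^ i * \<zeta> ^ (l - i)" by (simp flip: power_add)
          then show "(A i * \<zeta> ^ i) * (g (l - i) * \<zeta> ^ (l - i)) = A i * g (l - i) * \<zeta> ^ l" by simp
        qed auto
        then show ?thesis by (simp add: g_err_def A_def algebra_simps del: power_Suc)
      qed
      then show ?thesis by (simp only: sum.distrib)
    qed
    also have "(\<Sum>l\<le>J. (\<Sum>i\<le>l. (A i * \<zeta> ^ i) * (g (l - i) * \<zeta> ^ (l - i)))) = (\<Sum>i\<le>J. A i * \<zeta> ^ i * T (J - i))"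
    proof -
      have "(\<Sum>l\<le>J. (\<Sum>i\<le>l. (A i * \<zeta> ^ i) * (g (l - i) * \<zeta> ^ (l - i))))
          = (\<Sum>(i,j)\<in>{(i,j). i + j \<le> J}. (A i * \<zeta> ^ i) * (g j * \<zeta> ^ j))"
        by (rule sum.triangle_reindex_eq[symmetric])
      also have "{(i,j). i + j \<le> J} = (SIGMA i:{..J}. {..J - i})" by auto
      finally show ?thesis by (simp add: sum.Sigma[symmetric] T_def sum_distrib_left)
    qed
    also have "\<dots> = (\<Sum>i\<le>J. A i * \<zeta> ^ i) * Gz + (\<Sum>i\<le>J. A i * \<zeta> ^ i * (T (J - i) - Gz))"
      unfolding sum_distrib_right sum.distrib[symmetric] by (rule sum.cong) (auto simp: algebra_simps)
    finally have "norm (\<Sum>l=1..J. of_nat l ^ Suc m * g l * cis (real l * \<theta>))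
      \<le> norm (\<Sum>i\<le>J. A i * \<zeta> ^ i) * norm Gz + (\<Sum>i\<le>J. norm (A i) * R (J - i)) + (\<Sum>l\<le>J. norm (g_err l))"
      using z R by (simp only:)
        (intro norm_triangle_mono order_trans[OF norm_sum] sum_mono order_trans[OF norm_mult_ineq];
         auto simp: norm_mult norm_power intro!: mult_left_mono)
    also have "norm (\<Sum>i\<le>J. A i * \<zeta> ^ i) * norm Gz \<le> Cv * (1 + ln (real J)) * G"
    proof (intro mult_mono normGz)
      have "(\<Sum>i\<le>J. A i * \<zeta> ^ i) = (\<Sum>j=1..J. of_nat j ^ Suc m * u (int j) * cis (real j * \<theta>))"
        unfolding zl A_def by (rule sum.mono_neutral_cong_right) (auto simp: v_def)
      then show "norm (\<Sum>i\<le>J. A i * \<zeta> ^ i) \<le> Cv * (1 + ln (real J))" using Cv[OF J] by simp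
    qed (use Cv0 J in auto)
    also have "(\<Sum>i\<le>J. norm (A i) * R (J - i)) \<le> S + 2 * CR * (1 + ln (real J))"
    proof -
      \<comment> \<open>The squares of \<open>A\<close> have a bounded sum, while those of
        \<open>R\<close> are dominated by the harmonic series, which fits into the permitted
        logarithm.\<close>
      have "(\<Sum>i\<le>J. norm (A i) * R (J - i)) \<le> (\<Sum>i\<le>J. (norm (A i))\<^sup>2 + (R (J - i))\<^sup>2)"
      proof (rule sum_mono)
        fix i
        show "norm (A i) * R (J - i) \<le> (norm (A i))\<^sup>2 + (R (J - i))\<^sup>2"
          by (rule order_trans[OF mult_le_half_squares]) simp
      qed
      also have "\<dots> = (\<Sum>i\<le>J. (norm (A i))\<^sup>2) + (\<Sum>i\<le>J. (R (J - i))\<^sup>2)" by (rule sum.distrib)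
      also have "(\<Sum>i\<le>J. (R (J - i))\<^sup>2) = (\<Sum>i\<le>J. (R i)\<^sup>2)"
        by (rule sum.nat_diff_reindex[of "\<lambda>i. (R i)\<^sup>2" "Suc J", simplified lessThan_Suc_atMost diff_Suc_Suc])
      also have "(\<Sum>i\<le>J. (R i)\<^sup>2) \<le> (\<Sum>i\<le>J. CR * (1 / real (Suc i)))"
        using CR by (intro sum_mono) simp
      also have "\<dots> = CR * (\<Sum>i\<le>J. 1 / real (Suc i))" by (rule sum_distrib_left[symmetric])
      also have "CR * (\<Sum>i\<le>J. 1 / real (Suc i)) \<le> CR * (2 * (1 + ln (real J)))"
      proof (rule mult_left_mono[OF _ CR0])
        have "ln (real (Suc J)) \<le> ln (2 * real J)" using J by (subst ln_le_cancel_iff) auto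
        also have "\<dots> \<le> 1 + ln (real J)" using J ln_le_minus_one[of "2::real"] by (simp add: ln_mult)
        finally have "1 + ln (real (Suc J)) \<le> 1 + (1 + ln (real J))" by (rule add_left_mono)
        also have "\<dots> \<le> 2 * (1 + ln (real J))" using J by simp
        finally show "(\<Sum>i\<le>J. 1 / real (Suc i)) \<le> 2 * (1 + ln (real J))"
          by (rule order_trans[OF sum_inverse_Suc_le])
      qed
      also have "(\<Sum>i\<le>J. (norm (A i))\<^sup>2) \<le> S"
        unfolding S_def A_def using sum_le_suminf[OF summable_v_squares, of "{..J}"] by (simp add: norm_mult norm_power)
      finally show ?thesis by (simp add: mult_ac)
    qed
    also have "(\<Sum>l\<le>J. norm (g_err l)) \<le> E"
      unfolding E_def by (intro sum_le_suminf summable_g_err) auto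
    also have "Cv * (1 + ln (real J)) * G + (S + 2 * CR * (1 + ln (real J))) + E
       \<le> (Cv * G + S + 2 * CR + E) * (1 + ln (real J))"
    proof -
      have "S * 1 \<le> S * (1 + ln (real J))" "E * 1 \<le> E * (1 + ln (real J))"
        using S0 E0 J by (intro mult_left_mono; simp)+
      then show ?thesis by (simp add: algebra_simps)
    qed
    finally show ?thesis by simp
  qed
  then show ?thesis
    using Cv0 G0 S0 CR0 E0 by (intro exI[of _ "Cv * G + S + 2 * CR + E"]) auto
qed

lemma g_tail_log:
  "\<exists>C\<ge>0. \<forall>N\<ge>1. \<forall>M \<theta>. norm (\<Sum>l\<in>{N<..M}. g l * cis (real l * \<theta>)) \<le> C * (1 + ln (real (Suc N))) / real (Suc N) ^ Suc m"
proof -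
  obtain C where C0: "0 \<le> C" and C: "\<And>J \<theta>. 1 \<le> J \<Longrightarrow>
      norm (\<Sum>l=1..J. of_nat l ^ Suc m * g l * cis (real l * \<theta>)) \<le> C * (1 + ln (real J))"
    using g_partial_sum_log by metis
  have "norm (\<Sum>l\<in>{N<..M}. g l * cis (real l * \<theta>)) \<le> 3 * C * (1 + ln (real (Suc N))) / real (Suc N) ^ Suc m"
    if "1 \<le> N" for N M \<theta>
  proof -
    have "(\<Sum>l\<in>{N<..M}. g l * cis (real l * \<theta>)) = (\<Sum>l\<in>{N<..M}. of_nat l ^ Suc m * g l * cis (real l * \<theta>) / of_nat l ^ Suc m)"
      by (rule sum.cong) auto
    also have "norm \<dots> \<le> 3 * C * (1 + ln (real (Suc N))) / real (Suc N) ^ Suc m"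
      by (rule log_abel_tail) (use C that in auto)
    finally show ?thesis .
  qed
  then show ?thesis using C0 by (intro exI[of _ "3 * C"]) auto
qed

end

section \<open>Orthogonal polynomials on the unit circle\<close>

definition cs :: "(nat \<Rightarrow> complex) \<Rightarrow> real \<Rightarrow> complex" where
  "cs c t = (\<Sum>l. c l * cis t ^ l)"

lemma cs_summable:
  assumes "summable (\<lambda>l. norm (c l))"
  shows "summable (\<lambda>l. c l * cis t ^ l)"
  by (rule summable_power_series_disc[OF assms]) simp

lemma continuous_on_cs:
  assumes "summable (\<lambda>l. norm (c l))"
  shows "continuous_on S (cs c)"
proof -
  have "continuous_on S (\<lambda>t. (\<lambda>z. \<Sum>l. c l * z ^ l) (cis t))"
    by (rule continuous_on_compose2[OF continuous_on_power_series_disc[OF assms]]) (auto intro!: continuous_intros)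
  then show ?thesis by (simp add: cs_def[abs_def])
qed

lemma norm_cs_diff_partial_le:
  assumes "summable (\<lambda>l. norm (c l))"
  shows "norm (cs c t - (\<Sum>l<M. c l * cis t ^ l)) \<le> (\<Sum>l. norm (c (l + M)))"
proof -
  have sM: "summable (\<lambda>l. norm (c (l + M)))" by (rule summable_ignore_initial_segment[OF assms])
  have "cs c t - (\<Sum>l<M. c l * cis t ^ l) = (\<Sum>l. c (l + M) * cis t ^ (l + M))"
    unfolding cs_def using suminf_split_initial_segment[OF cs_summable[OF assms], of t M] by simp
  also have "norm \<dots> \<le> (\<Sum>l. norm (c (l + M) * cis t ^ (l + M)))"
    by (rule summable_norm) (use sM in \<open>simp add: norm_mult norm_power\<close>)
  finally show ?thesis by (simp add: norm_mult norm_power)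
qed

lemma norm_cs_le:
  assumes "summable (\<lambda>l. norm (c l))"
  shows "norm (cs c t) \<le> (\<Sum>l. norm (c l))"
  using norm_cs_diff_partial_le[OF assms, of t 0] by simp

text \<open>An absolutely convergent series converges uniformly on the circle, so it can be averaged
  against \<open>F\<close> term by term. Both the vanishing of negative Fourier coefficients of
  \<open>cs c\<close> and Parseval's identity are special cases.\<close>

lemma sums_cavg_times_cnj_cs:
  assumes F: "continuous_on UNIV F" and c: "summable (\<lambda>l. norm (c l))"
  shows "(\<lambda>l. cnj (c l) * fc F (int l)) sums cavg (\<lambda>t. F t * cnj (cs c t))"
proof -
  have "compact (F ` {-pi..pi})"
    by (intro compact_continuous_image continuous_on_subset[OF F]) auto
  then obtain B where B: "\<And>t. t \<in> {-pi..pi} \<Longrightarrow> norm (F t) \<le> B"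
    using compact_imp_bounded bounded_iff by (metis imageI)
  have B0: "0 \<le> B" using order_trans[OF norm_ge_zero B[of 0]] by simp
  define p where "p M t = (\<Sum>l<M. c l * cis t ^ l)" for M t
  have part: "(\<Sum>l<M. cnj (c l) * fc F (int l)) = cavg (\<lambda>t. F t * cnj (p M t))" for M
  proof -
    have "cavg (\<lambda>t. F t * cnj (p M t)) = cavg (\<lambda>t. \<Sum>l<M. cnj (c l) * (F t * cis (- of_int (int l) * t)))"
      by (rule arg_cong[where f=cavg])
         (auto simp: p_def sum_distrib_left Complex.DeMoivre cis_cnj mult_ac intro!: sum.cong)
    also have "\<dots> = (\<Sum>l<M. cavg (\<lambda>t. cnj (c l) * (F t * cis (- of_int (int l) * t))))"
      by (intro cavg_sum circ_integrable_continuous continuous_intros F) auto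
    finally show ?thesis by (simp add: cavg_mult_left fc_def)
  qed
  have le: "norm (cavg (\<lambda>t. F t * cnj (p M t)) - cavg (\<lambda>t. F t * cnj (cs c t))) \<le> B * (\<Sum>l. norm (c (l + M)))" for M
  proof -
    have i1: "circ_integrable (\<lambda>t. F t * cnj (p M t))" "circ_integrable (\<lambda>t. F t * cnj (cs c t))"
      unfolding p_def by (intro circ_integrable_continuous continuous_intros F continuous_on_cs c)+
    have "cavg (\<lambda>t. F t * cnj (p M t)) - cavg (\<lambda>t. F t * cnj (cs c t)) = cavg (\<lambda>t. F t * cnj (p M t) - F t * cnj (cs c t))"
      by (rule cavg_diff[OF i1, symmetric])
    also have "norm \<dots> \<le> cavg (\<lambda>t. B * (\<Sum>l. norm (c (l + M))))"
    proof (rule norm_cavg_le)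
      fix t assume t: "t \<in> {-pi..pi}"
      have "F t * cnj (p M t) - F t * cnj (cs c t) = F t * cnj (p M t - cs c t)" by (simp add: algebra_simps)
      also have "norm \<dots> \<le> B * (\<Sum>l. norm (c (l + M)))"
        unfolding norm_mult complex_mod_cnj p_def
        using norm_cs_diff_partial_le[OF c, of t M] B[OF t] B0
        by (intro mult_mono) (auto simp: norm_minus_commute)
      finally show "norm (F t * cnj (p M t) - F t * cnj (cs c t)) \<le> B * (\<Sum>l. norm (c (l + M)))" .
    qed (use integrable_diff[OF i1] in auto)
    finally show ?thesis by simp
  qed
  have "(\<lambda>M. cavg (\<lambda>t. F t * cnj (p M t)) - cavg (\<lambda>t. F t * cnj (cs c t))) \<longlonglongrightarrow> 0"
  proof (rule Lim_null_comparison)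
    have "(\<lambda>M. \<Sum>l. norm (c (l + M))) \<longlonglongrightarrow> 0" by (rule suminf_exist_split2[OF c])
    then show "(\<lambda>M. B * (\<Sum>l. norm (c (l + M)))) \<longlonglongrightarrow> 0" by (rule tendsto_mult_right_zero)
  qed (use le in auto)
  then show ?thesis unfolding sums_def part by (simp add: LIM_zero_iff)
qed

lemma fc_cis: "fc (\<lambda>t. cis (of_int i * t)) j = (if i = j then 1 else 0)"
proof -
  have "fc (\<lambda>t. cis (of_int i * t)) j = cavg (\<lambda>t. cis (of_int (i - j) * t))"
    unfolding fc_def by (rule arg_cong[where f=cavg]) (auto simp: cis_mult algebra_simps)
  then show ?thesis unfolding cavg_cis by simp
qed

lemma cavg_cs_cis:
  assumes c: "summable (\<lambda>l. norm (c l))"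
  shows "cavg (\<lambda>t. cs c t * cis (- (of_int j * t))) = (if 0 \<le> j then c (nat j) else 0)"
proof -
  have "(\<lambda>l. cnj (c l) * fc (\<lambda>t. cis (of_int j * t)) (int l)) sums cavg (\<lambda>t. cis (of_int j * t) * cnj (cs c t))"
    by (rule sums_cavg_times_cnj_cs[OF _ c]) (intro continuous_intros)
  moreover have "(\<lambda>l. cnj (c l) * fc (\<lambda>t. cis (of_int j * t)) (int l)) = (\<lambda>l. if l = nat j then (if 0 \<le> j then cnj (c (nat j)) else 0) else 0)"
    unfolding fc_cis by auto
  ultimately have "(\<lambda>l. if l = nat j then (if 0 \<le> j then cnj (c (nat j)) else 0) else 0) sums cavg (\<lambda>t. cis (of_int j * t) * cnj (cs c t))"
    by simp
  from sums_unique2[OF this sums_single]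
  have "cavg (\<lambda>t. cis (of_int j * t) * cnj (cs c t)) = (if 0 \<le> j then cnj (c (nat j)) else 0)" .
  moreover have "cavg (\<lambda>t. cnj (cs c t * cis (- (of_int j * t)))) = cnj (cavg (\<lambda>t. cs c t * cis (- (of_int j * t))))"
    by (intro cavg_cnj circ_integrable_continuous continuous_intros continuous_on_cs c)
  ultimately have "cnj (cavg (\<lambda>t. cs c t * cis (- (of_int j * t)))) = (if 0 \<le> j then cnj (c (nat j)) else 0)"
    by (simp add: cis_cnj mult.commute)
  then have "cnj (cnj (cavg (\<lambda>t. cs c t * cis (- (of_int j * t))))) = cnj (if 0 \<le> j then cnj (c (nat j)) else 0)"
    by (rule arg_cong)
  then show ?thesis by (simp split: if_splits)
qed

lemma parseval_cs:
  assumes c: "summable (\<lambda>l. norm (c l))"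
  shows "(\<lambda>l. (norm (c l))\<^sup>2) sums cavg (\<lambda>t. (norm (cs c t))\<^sup>2)"
proof -
  have "(\<lambda>l. cnj (c l) * fc (cs c) (int l)) sums cavg (\<lambda>t. cs c t * cnj (cs c t))"
    by (rule sums_cavg_times_cnj_cs[OF continuous_on_cs[OF c] c])
  moreover have "cnj (c l) * fc (cs c) (int l) = of_real ((norm (c l))\<^sup>2)" for l
    unfolding fc_def cavg_cs_cis[OF c] by (simp add: complex_norm_square mult.commute del: of_real_power)
  moreover have "cavg (\<lambda>t. cs c t * cnj (cs c t)) = of_real (cavg (\<lambda>t. (norm (cs c t))\<^sup>2))"
    unfolding complex_norm_square[symmetric]
    by (intro cavg_of_real circ_integrable_continuous continuous_intros continuous_on_cs c)
  ultimately show ?thesis by (simp only: sums_of_real_iff)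
qed

lemma cavg_square_le:
  fixes f :: "real \<Rightarrow> real"
  assumes "continuous_on UNIV f"
  shows "(cavg f)\<^sup>2 \<le> cavg (\<lambda>t. (f t)\<^sup>2)"
proof -
  have i: "circ_integrable f" "circ_integrable (\<lambda>t. (f t)\<^sup>2)"
    by (intro circ_integrable_continuous continuous_intros assms)+
  have "0 \<le> cavg (\<lambda>t. (f t - cavg f)\<^sup>2)" by (rule cavg_nonneg) simp
  also have "\<dots> = cavg (\<lambda>t. ((f t)\<^sup>2 - 2 * cavg f * f t) + (cavg f)\<^sup>2)"
    by (rule arg_cong[where f=cavg]) (auto simp: power2_eq_square algebra_simps)
  also have "\<dots> = cavg (\<lambda>t. (f t)\<^sup>2) - 2 * cavg f * cavg f + (cavg f)\<^sup>2"
    using i integrable_on_mult_right[OF i(1), of "2 * cavg f"]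
    by (simp only: cavg_add[OF integrable_diff[OF i(2) integrable_on_mult_right[OF i(1), of "2 * cavg f"]] integrable_const_ivl]
        cavg_diff cavg_mult_left cavg_const)
  finally show ?thesis by (simp add: power2_eq_square)
qed

section \<open>Polynomials on the circle\<close>

lemma poly_eq_sum_coeff:
  fixes p :: "complex poly"
  assumes "degree p \<le> n"
  shows "poly p z = (\<Sum>i\<le>n. coeff p i * z ^ i)"
proof -
  have "poly p z = poly (\<Sum>i\<le>n. monom (coeff p i) i) z" by (simp only: poly_as_sum_of_monoms'[OF assms])
  then show ?thesis by (simp add: poly_sum poly_monom)
qed

lemma continuous_on_poly_cis: "continuous_on S (\<lambda>t. poly (p :: complex poly) (cis t))"
  by (intro continuous_intros)

lemma poly_vanishing_on_circle:
  fixes p :: "complex poly"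
  assumes "\<And>t. t \<in> {-pi..pi} \<Longrightarrow> poly p (cis t) = 0"
  shows "p = 0"
proof (rule ccontr)
  assume "p \<noteq> 0"
  then have "finite {z. poly p z = 0}" by (rule poly_roots_finite)
  moreover have "cis ` {-pi<..pi} \<subseteq> {z. poly p z = 0}" using assms by auto
  ultimately have "finite (cis ` {-pi<..pi})" using finite_subset by blast
  moreover have "inj_on cis {-pi<..pi}"
    by (rule inj_on_inverseI[where g=Arg]) (auto intro: Arg_cis)
  ultimately have "finite {-pi<..pi}" using finite_imageD by blast
  then show False using infinite_Ioc[of "-pi" pi] by simp
qed

text \<open>The reversed polynomial \<open>z ^ n * cnj (p (1 / cnj z))\<close> of Szego's theory,
  written through coefficients so that it is visibly a polynomial.\<close>

definition star :: "nat \<Rightarrow> complex poly \<Rightarrow> complex poly" where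
  "star n p = (\<Sum>i\<le>n. monom (cnj (coeff p (n - i))) i)"

lemma coeff_star: "coeff (star n p) i = (if i \<le> n then cnj (coeff p (n - i)) else 0)"
  unfolding star_def coeff_sum by simp

lemma degree_star_le: "degree (star n p) \<le> n"
  by (rule degree_le) (simp add: coeff_star)

lemma poly_star_cis:
  assumes "degree p \<le> n"
  shows "poly (star n p) (cis t) = cis (real n * t) * cnj (poly p (cis t))"
proof -
  have "poly (star n p) (cis t) = (\<Sum>i\<le>n. cnj (coeff p (n - i)) * cis t ^ i)"
    by (simp add: star_def poly_sum poly_monom)
  also have "\<dots> = (\<Sum>i\<le>n. cnj (coeff p i) * cis t ^ (n - i))"
    by (rule sum.reindex_bij_witness[of _ "\<lambda>i. n - i" "\<lambda>i. n - i"]) auto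
  also have "\<dots> = cis (real n * t) * cnj (poly p (cis t))"
    unfolding poly_eq_sum_coeff[OF assms] cnj_sum sum_distrib_left
  proof (rule sum.cong)
    fix i assume "i \<in> {..n}"
    then have "cis t ^ (n - i) = cis (real n * t) * cnj (cis t ^ i)"
      by (simp add: Complex.DeMoivre cis_cnj cis_mult of_nat_diff algebra_simps)
    then show "cnj (coeff p i) * cis t ^ (n - i) = cis (real n * t) * cnj (coeff p i * cis t ^ i)" by simp
  qed auto
  finally show ?thesis .
qed

section \<open>Existence and uniqueness of orthogonal polynomials for a positive weight\<close>

locale circle_weight =
  fixes w :: "real \<Rightarrow> real"
  assumes w_cont: "continuous_on UNIV w" and w_pos: "\<And>t. 0 < w t"
begin

lemma circ_inner_eq_cavg: "circ_inner w f h = cavg (\<lambda>t. f (cis t) * cnj (h (cis t)) * complex_of_real (w t))"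
  by (simp add: circ_inner_def cavg_def scaleR_conv_of_real field_simps)

lemma circ_inner_sum_right:
  assumes "finite I" "continuous_on UNIV (\<lambda>t. f (cis t))" "\<And>i. i \<in> I \<Longrightarrow> continuous_on UNIV (\<lambda>t. h i (cis t))"
  shows "circ_inner w f (\<lambda>z. \<Sum>i\<in>I. c i * h i z) = (\<Sum>i\<in>I. cnj (c i) * circ_inner w f (h i))"
proof -
  have "circ_inner w f (\<lambda>z. \<Sum>i\<in>I. c i * h i z)
      = cavg (\<lambda>t. \<Sum>i\<in>I. cnj (c i) * (f (cis t) * cnj (h i (cis t)) * complex_of_real (w t)))"
    unfolding circ_inner_eq_cavg
    by (rule arg_cong[where f=cavg]) (auto simp: sum_distrib_left sum_distrib_right mult_ac)
  also have "\<dots> = (\<Sum>i\<in>I. cavg (\<lambda>t. cnj (c i) * (f (cis t) * cnj (h i (cis t)) * complex_of_real (w t))))"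
    using assms by (intro cavg_sum circ_integrable_continuous continuous_intros w_cont)
  finally show ?thesis by (simp only: cavg_mult_left circ_inner_eq_cavg)
qed

lemma circ_inner_diff_left:
  assumes "continuous_on UNIV (\<lambda>t. f (cis t))" "continuous_on UNIV (\<lambda>t. g (cis t))" "continuous_on UNIV (\<lambda>t. h (cis t))"
  shows "circ_inner w (\<lambda>z. f z - c * g z) h = circ_inner w f h - c * circ_inner w g h"
proof -
  have "circ_inner w (\<lambda>z. f z - c * g z) h
    = cavg (\<lambda>t. f (cis t) * cnj (h (cis t)) * complex_of_real (w t) - c * (g (cis t) * cnj (h (cis t)) * complex_of_real (w t)))"
    unfolding circ_inner_eq_cavg by (rule arg_cong[where f=cavg]) (auto simp: algebra_simps)
  also have "\<dots> = cavg (\<lambda>t. f (cis t) * cnj (h (cis t)) * complex_of_real (w t)) - cavg (\<lambda>t. c * (g (cis t) * cnj (h (cis t)) * complex_of_real (w t)))"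
    using assms by (intro cavg_diff circ_integrable_continuous continuous_intros w_cont)
  finally show ?thesis by (simp only: cavg_mult_left circ_inner_eq_cavg)
qed

text \<open>The condition on the coefficients of \<open>q\<close> expresses degree below
  \<open>n\<close> in a form that also makes sense for \<open>n = 0\<close>, where it forces
  \<open>q = 0\<close>.\<close>

lemma circ_inner_poly_orth:
  assumes "\<And>j. j < n \<Longrightarrow> circ_inner w (poly p) (\<lambda>z. z ^ j) = 0" and "\<And>i. n \<le> i \<Longrightarrow> coeff q i = 0"
  shows "circ_inner w (poly p) (poly q) = 0"
proof -
  have "poly q = (\<lambda>z. \<Sum>i\<le>degree q. coeff q i * z ^ i)" by (intro ext poly_altdef)
  then have "circ_inner w (poly p) (poly q) = (\<Sum>i\<le>degree q. cnj (coeff q i) * circ_inner w (poly p) (\<lambda>z. z ^ i))"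
    by (simp only:) (intro circ_inner_sum_right continuous_intros; simp)
  also have "\<dots> = 0" using assms by (intro sum.neutral ballI) (metis complex_cnj_zero mult_eq_0_iff not_le)
  finally show ?thesis .
qed

lemma circ_inner_self:
  "circ_inner w (poly p) (poly p) = of_real (cavg (\<lambda>t. (norm (poly p (cis t)))\<^sup>2 * w t))"
proof -
  have "circ_inner w (poly p) (poly p) = cavg (\<lambda>t. complex_of_real ((norm (poly p (cis t)))\<^sup>2 * w t))"
    unfolding circ_inner_eq_cavg by (simp only: of_real_mult complex_norm_square)
  also have "\<dots> = of_real (cavg (\<lambda>t. (norm (poly p (cis t)))\<^sup>2 * w t))"
    by (intro cavg_of_real circ_integrable_continuous continuous_intros w_cont)
  finally show ?thesis .
qed

lemma circ_inner_self_eq_0: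
  assumes "circ_inner w (poly p) (poly p) = 0"
  shows "p = 0"
proof (rule poly_vanishing_on_circle)
  let ?f = "\<lambda>t. (norm (poly p (cis t)))\<^sup>2 * w t"
  have "cavg ?f = 0" using assms unfolding circ_inner_self by simp
  then have "integral {-pi..pi} ?f = 0" by (simp add: cavg_def)
  moreover have "continuous_on {-pi..pi} ?f"
    by (intro continuous_intros continuous_on_subset[OF w_cont]) auto
  moreover have "0 \<le> ?f t" for t by (intro mult_nonneg_nonneg zero_le_power2 less_imp_le[OF w_pos])
  ultimately have "\<forall>t\<in>{-pi..pi}. ?f t = 0"
    using integral_eq_0_iff[of "-pi" pi ?f] by simp
  then show "poly p (cis t) = 0" if "t \<in> {-pi..pi}" for t
    using that w_pos[of t] by fastforce
qed

definition is_OP :: "nat \<Rightarrow> complex poly \<Rightarrow> bool" where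
  "is_OP n p \<longleftrightarrow> degree p = n \<and> lead_coeff p = 1 \<and> (\<forall>j<n. circ_inner w (poly p) (\<lambda>z. z ^ j) = 0)"

text \<open>\<open>p - z ^ n\<close> has degree below \<open>n\<close> and is therefore orthogonal
  to \<open>p\<close>. The common value is the squared norm of \<open>p\<close>, hence nonzero, and
  its conjugate is the denominator in the recursion step below.\<close>

lemma is_OP_inner_power:
  assumes "is_OP n p"
  shows "circ_inner w (poly p) (\<lambda>z. z ^ n) = circ_inner w (poly p) (poly p)"
proof -
  define q where "q = p - monom 1 n"
  have "circ_inner w (poly p) (poly q) = 0"
  proof (rule circ_inner_poly_orth[of n])
    show "circ_inner w (poly p) (\<lambda>z. z ^ j) = 0" if "j < n" for j using assms that by (simp add: is_OP_def)
    show "coeff q i = 0" if "n \<le> i" for i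
      using assms that by (cases "i = n") (auto simp: q_def is_OP_def coeff_eq_0)
  qed
  moreover have "circ_inner w (poly p) (poly q) = circ_inner w (poly p) (poly p) - circ_inner w (poly p) (\<lambda>z. z ^ n)"
  proof -
    have "circ_inner w (poly p) (poly q) = cavg (\<lambda>t. poly p (cis t) * cnj (poly p (cis t)) * complex_of_real (w t)
        - poly p (cis t) * cnj (cis t ^ n) * complex_of_real (w t))"
      unfolding circ_inner_eq_cavg
      by (rule arg_cong[where f=cavg]) (auto simp: q_def poly_monom algebra_simps)
    also have "\<dots> = circ_inner w (poly p) (poly p) - circ_inner w (poly p) (\<lambda>z. z ^ n)"
      unfolding circ_inner_eq_cavg
      by (intro cavg_diff circ_integrable_continuous continuous_intros w_cont)
    finally show ?thesis .
  qed
  ultimately show ?thesis by simp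
qed

text \<open>One step of the Szego recursion: \<open>z p\<close> and \<open>star n p\<close> are both orthogonal to
  \<open>z, \<dots>, z ^ n\<close>, and a linear combination of them is also orthogonal to \<open>1\<close>.\<close>
lemma is_OP_exists: "\<exists>p. is_OP n p"
proof (induction n)
  case 0
  show ?case by (rule exI[of _ 1]) (simp add: is_OP_def)
next
  case (Suc n)
  then obtain p where p: "is_OP n p" by blast
  then have deg: "degree p = n" and lead: "coeff p n = 1" by (auto simp: is_OP_def)
  let ?s = "star n p"
  have star_inner: "circ_inner w (poly ?s) (\<lambda>z. z ^ j) = cnj (circ_inner w (poly p) (\<lambda>z. z ^ (n - j)))" if "j \<le> n" for j
  proof -
    have "circ_inner w (poly ?s) (\<lambda>z. z ^ j) = cavg (\<lambda>t. cnj (poly p (cis t) * cnj (cis t ^ (n - j)) * complex_of_real (w t)))"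
      unfolding circ_inner_eq_cavg
    proof (rule arg_cong[where f=cavg], rule ext)
      fix t
      have "cis (real n * t) * cnj (cis t ^ j) = cis t ^ (n - j)"
        using that by (simp add: Complex.DeMoivre cis_cnj cis_mult of_nat_diff algebra_simps)
      then show "poly ?s (cis t) * cnj (cis t ^ j) * complex_of_real (w t)
        = cnj (poly p (cis t) * cnj (cis t ^ (n - j)) * complex_of_real (w t))"
        using poly_star_cis[of p n t] deg by (simp add: mult_ac)
    qed
    also have "\<dots> = cnj (circ_inner w (poly p) (\<lambda>z. z ^ (n - j)))"
      unfolding circ_inner_eq_cavg
      by (intro cavg_cnj circ_integrable_continuous continuous_intros w_cont)
    finally show ?thesis .
  qed
  have shift: "circ_inner w (\<lambda>z. z * poly p z) (\<lambda>z. z ^ Suc j) = circ_inner w (poly p) (\<lambda>z. z ^ j)" for j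
  proof -
    have "cis t * poly p (cis t) * cnj (cis t ^ Suc j) * complex_of_real (w t)
        = poly p (cis t) * cnj (cis t ^ j) * complex_of_real (w t)" for t
    proof -
      have "cis t * cnj (cis t ^ Suc j) = cnj (cis t ^ j)"
        by (simp add: cis_cnj cis_mult flip: mult.assoc)
      then show ?thesis by (metis mult.assoc mult.commute)
    qed
    then show ?thesis unfolding circ_inner_eq_cavg by (simp only:)
  qed
  have nz: "circ_inner w (poly ?s) (\<lambda>z. z ^ 0) \<noteq> 0"
  proof
    assume "circ_inner w (poly ?s) (\<lambda>z. z ^ 0) = 0"
    then have "circ_inner w (poly p) (poly p) = 0"
      using star_inner[of 0] is_OP_inner_power[OF p] by simp
    then have "p = 0" by (rule circ_inner_self_eq_0)
    then show False using lead by simp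
  qed
  \<comment> \<open>Chosen to make \<open>z p - c * star n p\<close> orthogonal to \<open>1\<close>.
    As \<open>star n p\<close> has degree at most \<open>n\<close>, the leading coefficient 1 is
    untouched.\<close>
  define c where "c = circ_inner w (\<lambda>z. z * poly p z) (\<lambda>z. z ^ 0) / circ_inner w (poly ?s) (\<lambda>z. z ^ 0)"
  define q where "q = pCons 0 p - smult c ?s"
  have q: "poly q = (\<lambda>z. z * poly p z - c * poly ?s z)" by (auto simp: q_def)
  have cq: "coeff q (Suc n) = 1" by (simp add: q_def lead coeff_star)
  have "degree q \<le> Suc n"
    unfolding q_def
    by (intro degree_diff_le order_trans[OF degree_smult_le] order_trans[OF degree_star_le] order_trans[OF degree_pCons_le])
       (auto simp: deg)
  moreover have "Suc n \<le> degree q" using cq by (intro le_degree) simp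
  ultimately have dq: "degree q = Suc n" by simp
  have "circ_inner w (poly q) (\<lambda>z. z ^ j) = 0" if "j < Suc n" for j
  proof -
    have "circ_inner w (poly q) (\<lambda>z. z ^ j) = circ_inner w (\<lambda>z. z * poly p z) (\<lambda>z. z ^ j) - c * circ_inner w (poly ?s) (\<lambda>z. z ^ j)"
      unfolding q by (intro circ_inner_diff_left continuous_intros)
    also have "\<dots> = 0"
    proof (cases j)
      case 0
      then show ?thesis using nz by (simp add: c_def)
    next
      case (Suc i)
      then have "circ_inner w (\<lambda>z. z * poly p z) (\<lambda>z. z ^ j) = 0" 
        using p that shift[of i] by (simp add: is_OP_def)
      moreover have "circ_inner w (poly ?s) (\<lambda>z. z ^ j) = 0"
        using star_inner[of j] p that Suc by (simp add: is_OP_def)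
      ultimately show ?thesis by simp
    qed
    finally show ?thesis .
  qed
  then have "is_OP (Suc n) q" using dq cq by (simp add: is_OP_def)
  then show ?case by blast
qed

lemma is_OP_unique:
  assumes "is_OP n p" "is_OP n q"
  shows "p = q"
proof -
  have "circ_inner w (poly (p - q)) (poly (p - q)) = 0"
  proof (rule circ_inner_poly_orth[of n])
    fix j assume "j < n"
    moreover have "poly (p - q) = (\<lambda>z. poly p z - 1 * poly q z)" by auto
    moreover have "circ_inner w (\<lambda>z. poly p z - 1 * poly q z) (\<lambda>z. z ^ j)
        = circ_inner w (poly p) (\<lambda>z. z ^ j) - 1 * circ_inner w (poly q) (\<lambda>z. z ^ j)"
      by (intro circ_inner_diff_left continuous_intros)
    ultimately show "circ_inner w (poly (p - q)) (\<lambda>z. z ^ j) = 0"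
      using assms by (simp add: is_OP_def)
  next
    fix i assume "n \<le> i"
    then show "coeff (p - q) i = 0"
      using assms by (cases "i = n") (auto simp: is_OP_def coeff_eq_0)
  qed
  then show ?thesis using circ_inner_self_eq_0[of "p - q"] by simp
qed

lemma is_OP_monic_OP: "is_OP n (monic_OP w n)"
proof -
  have "\<exists>!p. is_OP n p" using is_OP_exists is_OP_unique by blast
  from theI'[OF this] show ?thesis unfolding monic_OP_def is_OP_def .
qed

end

section \<open>Comparison of the orthogonal polynomials with the Szego function\<close>

lemma maximum_modulus_disc:
  assumes "f holomorphic_on ball 0 1" "continuous_on (cball 0 1) f"
    and "\<And>t. norm (f (cis t)) \<le> B" and "norm z < 1"
  shows "norm (f z) \<le> B"
proof (rule maximum_modulus_frontier[of f "ball 0 1"])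
  fix w :: complex assume "w \<in> frontier (ball 0 1)"
  then have "norm w = 1" by (simp add: frontier_ball)
  then have "w = cis (Arg w)" using Arg_eq[of w] by (cases "w = 0") (auto simp: cis_conv_exp)
  then show "norm (f w) \<le> B" using assms(3) by metis
qed (use assms in auto)

section \<open>Szego factorisation of the weight\<close>

context circle_jet
begin

sublocale wt: circle_weight "\<lambda>t. exp (- d 0 t)"
proof
  have "continuous_on UNIV (d 0)"
    using bounded_lipschitz_jet[of 0] continuous_on_Re[OF cont_jet[of 0]] by simp
  then show "continuous_on UNIV (\<lambda>t. exp (- d 0 t))" by (intro continuous_intros)
qed auto

definition V0 :: real where
  "V0 = Re (u 0)"

lemma u_0: "u 0 = of_real V0"
proof -
  have "cnj (u 0) = u 0" using u_uminus[of 0] by simp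
  then show ?thesis by (simp add: V0_def complex_eq_iff)
qed

lemma fourier_series_cs: "of_real (d 0 t) = of_real V0 + cs v t + cnj (cs v t)"
proof -
  obtain L where L: "lipschitz_circle (\<lambda>t. complex_of_real (d 0 t)) L"
    using lipschitz_circle_jet[of 0] by blast
  have "(\<lambda>M. partial_jet 0 M t) \<longlonglongrightarrow> of_real (d 0 t)"
    using lipschitz_circle.fourier_series_tendsto[OF L, of t] by (simp add: partial_jet_def u_def)
  moreover have "(\<lambda>M. partial_jet 0 M t) \<longlonglongrightarrow> of_real V0 + (cs v t + cnj (cs v t))"
  proof -
    have eq: "partial_jet 0 M t = of_real V0 + ((\<Sum>l\<le>M. v l * cis t ^ l) + cnj (\<Sum>l\<le>M. v l * cis t ^ l))" for M
    proof -
      have "(\<Sum>j\<in>{0<..M}. u (int j) * cis (real j * t)) = (\<Sum>l\<le>M. v l * cis t ^ l)"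
        by (rule sum.mono_neutral_cong_left) (auto simp: v_def Complex.DeMoivre)
      moreover have "partial_jet 0 0 t = of_real V0" by (simp add: partial_jet_def u_0)
      ultimately show ?thesis using partial_jet_tail[of 0 M 0 t] by (simp add: algebra_simps)
    qed
    have "(\<lambda>M. \<Sum>l\<le>M. v l * cis t ^ l) \<longlonglongrightarrow> cs v t"
      unfolding cs_def by (rule summable_LIMSEQ'[OF cs_summable[OF summable_norm_v]])
    then show ?thesis unfolding eq by (intro tendsto_intros)
  qed
  ultimately show ?thesis by (metis LIMSEQ_unique add.assoc)
qed

text \<open>The Taylor coefficients of \<open>1 / g = exp (- v)\<close>; constructed directly, their
  absolute summability comes without inverting \<open>g\<close>.\<close>

definition h :: "nat \<Rightarrow> complex" where
  "h = expseq (\<lambda>i. - v i)"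

lemma h_0 [simp]: "h 0 = 1" by (simp add: h_def)

lemma summable_norm_h: "summable (\<lambda>l. norm (h l))"
  unfolding h_def by (rule summable_norm_expseq) (use summable_norm_v in simp)

lemma v_0 [simp]: "v 0 = 0" by (simp add: v_def)

lemma cs_g: "cs g t = exp (cs v t)"
  unfolding cs_def g_def by (rule expseq_power_series[OF summable_norm_v]) auto

lemma cs_h: "cs h t = exp (- cs v t)"
proof -
  have "cs h t = exp (\<Sum>i. - v i * cis t ^ i)"
    unfolding cs_def h_def by (rule expseq_power_series) (use summable_norm_v in auto)
  then show ?thesis using suminf_minus[OF cs_summable[OF summable_norm_v]] by (simp add: cs_def)
qed

lemma g_times_h: "cs g t * cs h t = 1"
  by (simp add: cs_g cs_h flip: exp_add)

lemma exp_d0_eq: "exp (d 0 t) = exp V0 * (norm (cs g t))\<^sup>2"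
proof -
  have "complex_of_real (d 0 t) = of_real (V0 + 2 * Re (cs v t))"
    unfolding fourier_series_cs by (simp add: complex_eq_iff)
  then have "d 0 t = V0 + 2 * Re (cs v t)" by (simp only: of_real_eq_iff)
  then show ?thesis by (simp add: cs_g norm_exp_eq_Re exp_add exp_double)
qed

lemma weight_eq: "exp (- d 0 t) = exp (- V0) * (norm (cs h t))\<^sup>2"
proof -
  have "(norm (cs g t))\<^sup>2 * (norm (cs h t))\<^sup>2 = 1"
    using g_times_h[of t] by (metis norm_mult norm_one power_mult_distrib power_one)
  then have "exp (d 0 t) * (exp (- V0) * (norm (cs h t))\<^sup>2) = 1"
    by (simp add: exp_d0_eq exp_minus field_simps)
  then show ?thesis by (simp add: exp_minus inverse_unique)
qed

text \<open>Boundary values of \<open>star n P / g\<close>, a function analytic in the disc. For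
  monic \<open>P\<close> of degree \<open>n\<close> its value at \<open>0\<close> is 1.\<close>

definition quot :: "nat \<Rightarrow> complex poly \<Rightarrow> real \<Rightarrow> complex" where
  "quot n P t = cis (real n * t) * cnj (poly P (cis t)) * cs h t"

lemma continuous_on_quot: "continuous_on S (quot n P)"
  unfolding quot_def by (intro continuous_intros continuous_on_cs summable_norm_h)

text \<open>The mean value property in terms of coefficients: the boundary function of
  \<open>1 / g\<close> has no negative frequencies, so only the leading coefficient of
  \<open>P\<close> meets a nonzero one.\<close>

lemma cavg_quot:
  assumes "degree P = n" "coeff P n = 1"
  shows "cavg (quot n P) = 1"
proof -
  have q: "quot n P t = (\<Sum>i\<le>n. cnj (coeff P i) * (cs h t * cis (- (of_int (int i - int n) * t))))" for t
  proof -
    have "cis (real n * t) * cnj (coeff P i * cis t ^ i) = cnj (coeff P i) * cis (- (of_int (int i - int n) * t))" for i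
      by (simp add: Complex.DeMoivre cis_cnj cis_mult algebra_simps)
    then have "cis (real n * t) * cnj (poly P (cis t)) = (\<Sum>i\<le>n. cnj (coeff P i) * cis (- (of_int (int i - int n) * t)))"
      by (simp only: poly_eq_sum_coeff[OF eq_refl[OF assms(1)]] cnj_sum sum_distrib_left)
    then have "quot n P t = (\<Sum>i\<le>n. cnj (coeff P i) * cis (- (of_int (int i - int n) * t))) * cs h t"
      by (simp only: quot_def)
    then show ?thesis by (simp only: sum_distrib_right mult.assoc mult.commute[of "cs h t"])
  qed
  have "cavg (quot n P) = cavg (\<lambda>t. \<Sum>i\<le>n. cnj (coeff P i) * (cs h t * cis (- (of_int (int i - int n) * t))))"
    by (rule arg_cong[where f=cavg]) (rule ext, rule q)
  also have "\<dots> = (\<Sum>i\<le>n. cavg (\<lambda>t. cnj (coeff P i) * (cs h t * cis (- (of_int (int i - int n) * t)))))"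
    by (intro cavg_sum circ_integrable_continuous continuous_intros continuous_on_cs summable_norm_h) auto
  also have "\<dots> = (\<Sum>i\<le>n. cnj (coeff P i) * (if 0 \<le> int i - int n then h (nat (int i - int n)) else 0))"
    by (simp only: cavg_mult_left cavg_cs_cis[OF summable_norm_h])
  also have "\<dots> = (\<Sum>i\<in>{n}. cnj (coeff P i) * (if 0 \<le> int i - int n then h (nat (int i - int n)) else 0))"
    by (rule sum.mono_neutral_right) auto
  finally show ?thesis using assms by simp
qed

text \<open>The weight is \<open>exp (- V0) / |g|^2\<close>, so the integrand is
  \<open>exp (- V0)\<close> times \<open>|q|^2\<close> with \<open>q = quot n P\<close>; since
  \<open>q\<close> has mean 1, its mean square is 1 plus that of \<open>q - 1\<close>. The excess
  over \<open>exp (- V0)\<close> thus measures exactly how far \<open>star n P\<close> is from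
  \<open>g\<close>.\<close>

lemma weighted_norm_eq:
  assumes "degree P = n" "coeff P n = 1"
  shows "cavg (\<lambda>t. (norm (poly P (cis t)))\<^sup>2 * exp (- d 0 t)) = exp (- V0) * (1 + cavg (\<lambda>t. (norm (quot n P t - 1))\<^sup>2))"
proof -
  have iq: "circ_integrable (quot n P)" by (intro circ_integrable_continuous continuous_on_quot)
  have iq2: "circ_integrable (\<lambda>t. (norm (quot n P t - 1))\<^sup>2)"
    by (intro circ_integrable_continuous continuous_intros continuous_on_quot)
  have "(norm (poly P (cis t)))\<^sup>2 * exp (- d 0 t) = exp (- V0) * (((norm (quot n P t - 1))\<^sup>2 + 2 * Re (quot n P t)) - 1)" for t
  proof -
    have "(norm (poly P (cis t)))\<^sup>2 * exp (- d 0 t) = exp (- V0) * (norm (quot n P t))\<^sup>2"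
      by (simp add: weight_eq quot_def norm_mult power_mult_distrib)
    moreover have "(norm (quot n P t))\<^sup>2 = ((norm (quot n P t - 1))\<^sup>2 + 2 * Re (quot n P t)) - 1"
      unfolding cmod_power2 by (simp add: power2_eq_square algebra_simps)
    ultimately show ?thesis by simp
  qed
  then have "cavg (\<lambda>t. (norm (poly P (cis t)))\<^sup>2 * exp (- d 0 t))
     = exp (- V0) * cavg (\<lambda>t. ((norm (quot n P t - 1))\<^sup>2 + 2 * Re (quot n P t)) - 1)"
    by (simp only: cavg_mult_left)
  also have "cavg (\<lambda>t. ((norm (quot n P t - 1))\<^sup>2 + 2 * Re (quot n P t)) - 1)
     = cavg (\<lambda>t. (norm (quot n P t - 1))\<^sup>2) + 2 * Re (cavg (quot n P)) - 1"
    using integrable_on_mult_right[OF circ_integrable_Re[OF iq], of 2]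
    by (simp only: cavg_diff[OF integrable_add[OF iq2 integrable_on_mult_right[OF circ_integrable_Re[OF iq], of 2]] integrable_const_ivl]
        cavg_add[OF iq2] cavg_mult_left cavg_Re[OF iq] cavg_const)
  finally show ?thesis by (simp add: cavg_quot[OF assms])
qed

section \<open>The approximating polynomials and the Taylor tail of the Szego function\<close>

definition psum :: "nat \<Rightarrow> real \<Rightarrow> complex" where
  "psum n t = (\<Sum>l\<le>n. g l * cis t ^ l)"

definition mpoly :: "nat \<Rightarrow> complex poly" where
  "mpoly n = star n (\<Sum>l\<le>n. monom (g l) l)"

lemma coeff_mpoly: "coeff (mpoly n) i = (if i \<le> n then cnj (g (n - i)) else 0)"
  unfolding mpoly_def coeff_star coeff_sum by simp

lemma poly_mpoly_cis: "poly (mpoly n) (cis t) = cis (real n * t) * cnj (psum n t)"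
proof -
  have "degree (\<Sum>l\<le>n. monom (g l) l) \<le> n"
    by (intro degree_sum_le) (auto intro: order_trans[OF degree_monom_le])
  then show ?thesis unfolding mpoly_def by (simp add: poly_star_cis psum_def poly_sum poly_monom)
qed

lemma degree_mpoly: "degree (mpoly n) = n"
proof (rule antisym)
  show "degree (mpoly n) \<le> n" unfolding mpoly_def by (rule degree_star_le)
  show "n \<le> degree (mpoly n)" by (rule le_degree) (simp add: coeff_mpoly)
qed

definition tail :: "nat \<Rightarrow> real \<Rightarrow> complex" where
  "tail n = cs (\<lambda>l. if l \<le> n then 0 else g l)"

lemma summable_norm_tail: "summable (\<lambda>l. norm (if l \<le> n then 0 else g l))"
  by (rule summable_comparison_test'[OF summable_norm_g]) auto

lemma continuous_on_tail: "continuous_on S (tail n)"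
  unfolding tail_def by (rule continuous_on_cs[OF summable_norm_tail])

lemma tail_eq: "tail n t = cs g t - psum n t"
proof -
  have "(\<lambda>l. if l \<in> {..n} then g l * cis t ^ l else 0) sums (\<Sum>l\<in>{..n}. g l * cis t ^ l)"
    by (rule sums_If_finite_set) auto
  moreover have "(\<lambda>l. g l * cis t ^ l) sums cs g t"
    unfolding cs_def by (rule summable_sums[OF cs_summable[OF summable_norm_g]])
  ultimately have "(\<lambda>l. g l * cis t ^ l - (if l \<in> {..n} then g l * cis t ^ l else 0)) sums (cs g t - psum n t)"
    unfolding psum_def by (intro sums_diff)
  moreover have "(\<lambda>l. g l * cis t ^ l - (if l \<in> {..n} then g l * cis t ^ l else 0)) = (\<lambda>l. (if l \<le> n then 0 else g l) * cis t ^ l)"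
    by auto
  ultimately show ?thesis unfolding tail_def cs_def by (simp add: sums_iff)
qed

text \<open>Parseval loses no logarithm, in contrast to the pointwise bound \<open>tail_sup\<close>;
  the comparison with \<open>OP n\<close> relies on this one only.\<close>

lemma tail_L2: "\<exists>C\<ge>0. \<forall>n. cavg (\<lambda>t. (norm (tail n t))\<^sup>2) \<le> C / real (Suc n) ^ (2 * Suc m)"
proof -
  obtain C where C0: "0 \<le> C" and C: "\<And>N M. (\<Sum>l\<in>{N<..M}. (norm (g l))\<^sup>2) \<le> C / real (Suc N) ^ (2 * Suc m)"
    using g_square_tail by metis
  have "cavg (\<lambda>t. (norm (tail n t))\<^sup>2) \<le> C / real (Suc n) ^ (2 * Suc m)" for n
  proof (rule LIMSEQ_le_const2)
    show "(\<lambda>M. \<Sum>l\<le>M. (norm (if l \<le> n then 0 else g l))\<^sup>2) \<longlonglongrightarrow> cavg (\<lambda>t. (norm (tail n t))\<^sup>2)"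
      using parseval_cs[OF summable_norm_tail[of n]] unfolding tail_def sums_def_le .
    have "(\<Sum>l\<le>M. (norm (if l \<le> n then 0 else g l))\<^sup>2) = (\<Sum>l\<in>{n<..M}. (norm (g l))\<^sup>2)" for M
      by (rule sum.mono_neutral_cong_right) auto
    then show "\<exists>N. \<forall>M\<ge>N. (\<Sum>l\<le>M. (norm (if l \<le> n then 0 else g l))\<^sup>2) \<le> C / real (Suc n) ^ (2 * Suc m)"
      using C by simp
  qed
  then show ?thesis using C0 by blast
qed

lemma tail_sup: "\<exists>C\<ge>0. \<forall>n\<ge>1. \<forall>t. norm (tail n t) \<le> C * (1 + ln (real (Suc n))) / real (Suc n) ^ Suc m"
proof -
  obtain C where C0: "0 \<le> C" and C: "\<And>N M \<theta>. 1 \<le> N \<Longrightarrow> norm (\<Sum>l\<in>{N<..M}. g l * cis (real l * \<theta>))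
      \<le> C * (1 + ln (real (Suc N))) / real (Suc N) ^ Suc m"
    using g_tail_log by metis
  have "norm (tail n t) \<le> C * (1 + ln (real (Suc n))) / real (Suc n) ^ Suc m" if "1 \<le> n" for n t
  proof (rule LIMSEQ_le_const2)
    have "(\<lambda>M. \<Sum>l\<le>M. (if l \<le> n then 0 else g l) * cis t ^ l) \<longlonglongrightarrow> tail n t"
      unfolding tail_def cs_def by (rule summable_LIMSEQ'[OF cs_summable[OF summable_norm_tail]])
    then show "(\<lambda>M. norm (\<Sum>l\<le>M. (if l \<le> n then 0 else g l) * cis t ^ l)) \<longlonglongrightarrow> norm (tail n t)"
      by (rule tendsto_norm)
    have "(\<Sum>l\<le>M. (if l \<le> n then 0 else g l) * cis t ^ l) = (\<Sum>l\<in>{n<..M}. g l * cis (real l * t))" for M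
      by (rule sum.mono_neutral_cong_right) (auto simp: Complex.DeMoivre)
    then show "\<exists>N. \<forall>M\<ge>N. norm (\<Sum>l\<le>M. (if l \<le> n then 0 else g l) * cis t ^ l) \<le> C * (1 + ln (real (Suc n))) / real (Suc n) ^ Suc m"
      using C[OF that] by simp
  qed
  then show ?thesis using C0 by blast
qed

section \<open>Comparison in the mean and in the supremum norm\<close>

definition OP :: "nat \<Rightarrow> complex poly" where
  "OP n = monic_OP (\<lambda>t. exp (- d 0 t)) n"

lemma OP_degree: "degree (OP n) = n" and OP_lead: "coeff (OP n) n = 1"
  and OP_orth: "j < n \<Longrightarrow> circ_inner (\<lambda>t. exp (- d 0 t)) (poly (OP n)) (\<lambda>z. z ^ j) = 0"
  using wt.is_OP_monic_OP[of n] by (auto simp: wt.is_OP_def OP_def)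

definition err :: "nat \<Rightarrow> complex poly" where
  "err n = OP n - mpoly n"

lemma coeff_err: "n \<le> i \<Longrightarrow> coeff (err n) i = 0"
  using OP_lead[of n] OP_degree[of n] by (cases "i = n") (auto simp: err_def coeff_mpoly coeff_eq_0)

lemma h_bounded: "\<exists>C>0. \<forall>t. norm (cs h t) \<le> C"
  using norm_cs_le[OF summable_norm_h] suminf_nonneg[OF summable_norm_h]
  by (intro exI[of _ "1 + (\<Sum>l. norm (h l))"]) (auto intro: order_trans add_increasing simp: add_pos_nonneg)

text \<open>\<open>OP n\<close> minimises the weighted norm among monic polynomials, and by \<open>weighted_norm_eq\<close> the minimum
  is at least \<open>exp (- V0)\<close>, so \<open>mpoly n\<close> is within its own excess of the minimiser.\<close>
lemma err_L2: "\<exists>C\<ge>0. \<forall>n. cavg (\<lambda>t. (norm (poly (err n) (cis t)))\<^sup>2) \<le> C / real (Suc n) ^ (2 * Suc m)"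
proof -
  obtain C where C0: "0 \<le> C" and C: "\<And>n. cavg (\<lambda>t. (norm (tail n t))\<^sup>2) \<le> C / real (Suc n) ^ (2 * Suc m)"
    using tail_L2 by metis
  obtain H where H0: "0 < H" and H: "\<And>t. norm (cs h t) \<le> H" using h_bounded by blast
  obtain B where B: "\<And>t. \<bar>d 0 t\<bar> \<le> B" using bounded_lipschitz_jet[of 0] unfolding bounded_lipschitz_def by auto
  define D where "D = exp B * exp (- V0) * (H\<^sup>2 * C)"
  have "cavg (\<lambda>t. (norm (poly (err n) (cis t)))\<^sup>2) \<le> D / real (Suc n) ^ (2 * Suc m)" for n
  proof -
    let ?w = "\<lambda>t. exp (- d 0 t)"
    let ?n2 = "\<lambda>p. cavg (\<lambda>t. (norm (poly p (cis t)))\<^sup>2 * ?w t)"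
    have cd: "continuous_on S ?w" for S using continuous_on_subset[OF wt.w_cont] by auto
    have ci: "circ_integrable (\<lambda>t. (norm (poly p (cis t)))\<^sup>2 * ?w t)" for p :: "complex poly"
      by (intro circ_integrable_continuous continuous_intros cd)
    have orth: "circ_inner ?w (poly (OP n)) (poly (err n)) = 0"
      by (rule wt.circ_inner_poly_orth[of n]) (auto intro: OP_orth coeff_err)
    \<comment> \<open>\<open>OP n\<close> and \<open>mpoly n\<close> are both monic of degree
      \<open>n\<close>, so their difference \<open>err n\<close> is orthogonal to
      \<open>OP n\<close>.\<close>
    have pyth: "?n2 (mpoly n) = ?n2 (OP n) + ?n2 (err n)"
    proof -
      have eq: "(norm (poly (mpoly n) (cis t)))\<^sup>2 * ?w t = ((norm (poly (OP n) (cis t)))\<^sup>2 * ?w t + (norm (poly (err n) (cis t)))\<^sup>2 * ?w t)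
          - 2 * Re (poly (OP n) (cis t) * cnj (poly (err n) (cis t)) * complex_of_real (?w t))" for t
      proof -
        have e: "poly (mpoly n) (cis t) = poly (OP n) (cis t) - poly (err n) (cis t)" by (simp add: err_def)
        show ?thesis unfolding e cmod_power2 by (simp add: power2_eq_square algebra_simps)
      qed
      have i3: "circ_integrable (\<lambda>t. poly (OP n) (cis t) * cnj (poly (err n) (cis t)) * complex_of_real (?w t))"
        by (intro circ_integrable_continuous continuous_intros cd)
      have "?n2 (mpoly n) = ?n2 (OP n) + ?n2 (err n) - 2 * Re (circ_inner ?w (poly (OP n)) (poly (err n)))"
        unfolding eq wt.circ_inner_eq_cavg
        by (simp only: cavg_diff[OF integrable_add[OF ci ci] integrable_on_mult_right[OF circ_integrable_Re[OF i3]]]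
            cavg_add[OF ci ci] cavg_mult_left cavg_Re[OF i3])
      then show ?thesis using orth by simp
    qed
    \<comment> \<open>Reversing \<open>mpoly n\<close> gives back the Taylor polynomial of
      \<open>g\<close>, and \<open>psum n * h - 1 = (psum n - g) * h\<close> by
      \<open>g_times_h\<close>.\<close>
    have q: "quot n (mpoly n) t - 1 = - (tail n t * cs h t)" for t
    proof -
      have "cis (real n * t) * cnj (cis (real n * t)) = 1" by (simp add: cis_cnj cis_mult)
      then have "quot n (mpoly n) t = psum n t * cs h t"
        unfolding quot_def poly_mpoly_cis by (metis complex_cnj_cnj complex_cnj_mult mult.assoc mult.left_neutral)
      then show ?thesis using g_times_h[of t] by (simp add: tail_eq algebra_simps)
    qed
    have "?n2 (err n) = exp (- V0) * (cavg (\<lambda>t. (norm (quot n (mpoly n) t - 1))\<^sup>2) - cavg (\<lambda>t. (norm (quot n (OP n) t - 1))\<^sup>2))"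
      using pyth weighted_norm_eq[OF degree_mpoly, of n] weighted_norm_eq[OF OP_degree OP_lead, of n]
      by (simp add: coeff_mpoly algebra_simps)
    also have "\<dots> \<le> exp (- V0) * cavg (\<lambda>t. (norm (quot n (mpoly n) t - 1))\<^sup>2)"
      using cavg_nonneg[of "\<lambda>t. (norm (quot n (OP n) t - 1))\<^sup>2"] by (intro mult_left_mono) auto
    also have "cavg (\<lambda>t. (norm (quot n (mpoly n) t - 1))\<^sup>2) \<le> cavg (\<lambda>t. H\<^sup>2 * (norm (tail n t))\<^sup>2)"
    proof (rule cavg_mono)
      fix t
      have "norm (quot n (mpoly n) t - 1) \<le> H * norm (tail n t)"
        unfolding q using mult_left_mono[OF H[of t], of "norm (tail n t)"] by (simp add: norm_mult mult.commute)
      then show "(norm (quot n (mpoly n) t - 1))\<^sup>2 \<le> H\<^sup>2 * (norm (tail n t))\<^sup>2"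
        unfolding power_mult_distrib[symmetric] by (intro power_mono) auto
    qed (intro circ_integrable_continuous continuous_intros continuous_on_quot continuous_on_tail)+
    also have "\<dots> = H\<^sup>2 * cavg (\<lambda>t. (norm (tail n t))\<^sup>2)" by (rule cavg_mult_left)
    also have "\<dots> \<le> H\<^sup>2 * (C / real (Suc n) ^ (2 * Suc m))" by (intro mult_left_mono C) auto
    finally have 1: "?n2 (err n) \<le> exp (- V0) * (H\<^sup>2 * (C / real (Suc n) ^ (2 * Suc m)))" by simp
    have "cavg (\<lambda>t. (norm (poly (err n) (cis t)))\<^sup>2) \<le> cavg (\<lambda>t. exp B * ((norm (poly (err n) (cis t)))\<^sup>2 * ?w t))"
    proof (rule cavg_mono)
      fix t
      have "1 \<le> exp B * ?w t" using B[of t] by (simp flip: exp_add)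
      then show "(norm (poly (err n) (cis t)))\<^sup>2 \<le> exp B * ((norm (poly (err n) (cis t)))\<^sup>2 * ?w t)"
        using mult_left_mono[of 1 "exp B * ?w t" "(norm (poly (err n) (cis t)))\<^sup>2"] by (simp add: mult_ac)
    qed (intro circ_integrable_continuous continuous_intros cd)+
    also have "\<dots> = exp B * ?n2 (err n)" by (rule cavg_mult_left)
    also have "\<dots> \<le> exp B * (exp (- V0) * (H\<^sup>2 * (C / real (Suc n) ^ (2 * Suc m))))"
      using 1 by (intro mult_left_mono) auto
    finally show ?thesis by (simp add: D_def mult_ac)
  qed
  moreover have "0 \<le> D" using C0 by (simp add: D_def)
  ultimately show ?thesis by blast
qed

lemma cavg_norm_le_of_L2:
  assumes "continuous_on UNIV f" "cavg (\<lambda>t. (norm (f t))\<^sup>2) \<le> C / real (Suc n) ^ (2 * Suc m)"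
  shows "cavg (\<lambda>t. norm (f t)) \<le> sqrt C / real (Suc n) ^ Suc m"
proof -
  have "(cavg (\<lambda>t. norm (f t)))\<^sup>2 \<le> C / real (Suc n) ^ (2 * Suc m)"
    using cavg_square_le[of "\<lambda>t. norm (f t)"] assms by (auto intro!: continuous_intros intro: order_trans)
  then have "cavg (\<lambda>t. norm (f t)) \<le> sqrt (C / real (Suc n) ^ (2 * Suc m))" by (rule real_le_rsqrt)
  also have "\<dots> = sqrt C / real (Suc n) ^ Suc m"
    by (simp only: power_even_eq real_sqrt_divide real_sqrt_abs) simp
  finally show ?thesis .
qed

text \<open>The Lipschitz increment of the weight, of order \<open>\<bar>y\<bar>\<close>, cancels
  the \<open>1 / \<bar>y\<bar>\<close> of the Dirichlet kernel, where \<open>y\<close> is the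
  representative of \<open>\<theta> - t\<close> modulo \<open>2 pi\<close> in
  \<open>[-pi, pi]\<close>. The product is bounded uniformly in \<open>n\<close>, so the passage to
  the supremum norm costs no logarithm.\<close>

lemma weight_kernel_bound:
  "\<exists>C\<ge>0. \<forall>n \<theta> t. norm (of_real (exp (- d 0 \<theta>) - exp (- d 0 t)) * (\<Sum>j<n. cis (real j * (\<theta> - t)))) \<le> C"
proof -
  have "bounded_lipschitz (\<lambda>t. exp (- 1 * d 0 t))"
    by (intro bounded_lipschitz_exp bounded_lipschitz_mult bounded_lipschitz_const bounded_lipschitz_jet) auto
  then obtain L where L: "\<And>x y. \<bar>exp (- d 0 x) - exp (- d 0 y)\<bar> \<le> L * \<bar>x - y\<bar>" "\<And>x. \<bar>exp (- d 0 x)\<bar> \<le> L"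
    unfolding bounded_lipschitz_def by auto
  have L0: "0 \<le> L" using order_trans[OF abs_ge_zero L(2)] .
  have "norm (of_real (exp (- d 0 \<theta>) - exp (- d 0 t)) * (\<Sum>j<n. cis (real j * (\<theta> - t)))) \<le> 6 * L" for n \<theta> t
  proof -
    define x where "x = \<theta> - t"
    obtain k :: int where k: "\<bar>\<theta> - t - 2 * pi * of_int k\<bar> \<le> pi" by (rule circle_reduce)
    define y where "y = x - 2 * pi * of_int k"
    define X where "X = (\<Sum>j<n. cis (real j * x))"
    have "d 0 \<theta> = d 0 (t + y)"
      using periodic_int[of "d 0" "t + y" k] periodic[of 0] by (simp add: y_def x_def)
    then have 1: "\<bar>exp (- d 0 \<theta>) - exp (- d 0 t)\<bar> \<le> L * \<bar>y\<bar>" using L(1)[of "t + y" t] by simp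
    have cy: "cis x = cis y"
    proof -
      have "cis y * cis (2 * pi * of_int k) = cis x" unfolding cis_mult by (simp add: y_def)
      then show ?thesis by simp
    qed
    have "X = (\<Sum>j<n. cis y ^ j)" unfolding X_def by (simp add: Complex.DeMoivre[symmetric] cy)
    then have "X * (cis y - 1) = cis y ^ n - 1" by (simp add: power_diff_1_eq mult.commute)
    then have "norm X * norm (cis y - 1) = norm (cis y ^ n - 1)" by (metis norm_mult)
    also have "\<dots> \<le> 2" using norm_triangle_ineq4[of "cis y ^ n" 1] by (simp add: norm_power)
    finally have 2: "norm X * norm (cis y - 1) \<le> 2" .
    have "norm X * (\<bar>y\<bar> / 3) \<le> norm X * norm (cis y - 1)"
      using k by (intro mult_left_mono norm_cis_diff_one_ge) (auto simp: y_def x_def)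
    with 2 have 3: "norm X * \<bar>y\<bar> \<le> 6" by linarith
    have "norm (of_real (exp (- d 0 \<theta>) - exp (- d 0 t)) * X) \<le> L * \<bar>y\<bar> * norm X"
      unfolding norm_mult norm_of_real using 1 by (intro mult_right_mono) auto
    also have "\<dots> \<le> 6 * L" using mult_left_mono[OF 3 L0] by (simp add: mult_ac)
    finally show ?thesis unfolding X_def x_def .
  qed
  then show ?thesis using L0 by (intro exI[of _ "6 * L"]) auto
qed

text \<open>Korous' comparison argument: \<open>OP n - z ^ n cnj g\<close> is orthogonal to \<open>1, \<dots>, z ^ (n - 1)\<close> with respect to the
  weight, and replacing the weight by its value at \<open>\<theta>\<close> inside the Dirichlet kernel centred at \<open>\<theta>\<close> costs only
  an \<open>L1\<close> norm because the weight is Lipschitz.\<close>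
lemma err_sup: "\<exists>C\<ge>0. \<forall>n t. norm (poly (err n) (cis t)) \<le> C / real (Suc n) ^ Suc m"
proof -
  obtain C1 where C1: "\<And>n. cavg (\<lambda>t. (norm (poly (err n) (cis t)))\<^sup>2) \<le> C1 / real (Suc n) ^ (2 * Suc m)" and C10: "0 \<le> C1"
    using err_L2 by metis
  obtain C2 where C2: "\<And>n. cavg (\<lambda>t. (norm (tail n t))\<^sup>2) \<le> C2 / real (Suc n) ^ (2 * Suc m)" and C20: "0 \<le> C2"
    using tail_L2 by metis
  obtain K where K0: "0 \<le> K" and K: "\<And>n \<theta> t. norm (of_real (exp (- d 0 \<theta>) - exp (- d 0 t)) * (\<Sum>j<n. cis (real j * (\<theta> - t)))) \<le> K"
    using weight_kernel_bound by metis
  obtain B where B: "\<And>t. \<bar>d 0 t\<bar> \<le> B" using bounded_lipschitz_jet[of 0] unfolding bounded_lipschitz_def by auto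
  let ?w = "\<lambda>t. exp (- d 0 t)"
  have cd: "continuous_on S ?w" for S using continuous_on_subset[OF wt.w_cont] by auto
  have "norm (poly (err n) (cis \<theta>)) \<le> exp B * (K * (sqrt C1 + sqrt C2)) / real (Suc n) ^ Suc m" for n \<theta>
  proof -
    \<comment> \<open>\<open>f\<close> has only negative frequencies because \<open>tail n\<close>
      starts at order \<open>n + 1\<close>. Adding it to \<open>err n\<close> leaves the
      coefficients \<open>0, \<dots>, n - 1\<close> unchanged, while the sum \<open>y\<close> is
      \<open>OP n - z ^ n cnj g\<close> on the circle.\<close>
    define f where "f t = - cis (real n * t) * cnj (tail n t)" for t
    define y where "y t = poly (err n) (cis t) + f t" for t
    have cf: "continuous_on UNIV f" unfolding f_def by (intro continuous_intros continuous_on_tail)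
    have cy: "continuous_on UNIV y" unfolding y_def by (intro continuous_intros cf)
    have y_eq: "y t = poly (OP n) (cis t) - cis (real n * t) * cnj (cs g t)" for t
      by (simp add: y_def f_def err_def poly_mpoly_cis tail_eq algebra_simps)
    \<comment> \<open>On the circle \<open>cnj g\<close> times the weight is
      \<open>exp (- V0) * h\<close>, so the second part of the integrand becomes
      \<open>z ^ (n - j) * h\<close> up to a constant, which has mean 0 for
      \<open>j < n\<close>.\<close>
    have orth: "cavg (\<lambda>t. y t * cis (- (real j * t)) * of_real (?w t)) = 0" if j: "j < n" for j
    proof -
      have a: "cavg (\<lambda>t. poly (OP n) (cis t) * cis (- (real j * t)) * of_real (?w t)) = 0"
        using OP_orth[OF j] unfolding wt.circ_inner_eq_cavg by (simp add: Complex.DeMoivre cis_cnj)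
      have "cis (real n * t) * cnj (cs g t) * cis (- (real j * t)) * of_real (?w t)
          = of_real (exp (- V0)) * (cs h t * cis (- (of_int (int j - int n) * t)))" for t
      proof -
        have "cnj (cs g t) * of_real (?w t) = of_real (exp (- V0)) * (cs h t * cnj (cs g t * cs h t))"
          unfolding weight_eq of_real_mult complex_norm_square by (simp add: mult_ac)
        then have "cnj (cs g t) * of_real (?w t) = of_real (exp (- V0)) * cs h t" unfolding g_times_h by simp
        moreover have "cis (real n * t) * cis (- (real j * t)) = cis (- (of_int (int j - int n) * t))"
          by (simp add: cis_mult algebra_simps)
        ultimately show ?thesis by (metis mult.assoc mult.commute)
      qed
      then have b: "cavg (\<lambda>t. cis (real n * t) * cnj (cs g t) * cis (- (real j * t)) * of_real (?w t)) = 0"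
        using j by (simp only: cavg_mult_left cavg_cs_cis[OF summable_norm_h]) simp
      have "cavg (\<lambda>t. y t * cis (- (real j * t)) * of_real (?w t))
        = cavg (\<lambda>t. poly (OP n) (cis t) * cis (- (real j * t)) * of_real (?w t)
            - cis (real n * t) * cnj (cs g t) * cis (- (real j * t)) * of_real (?w t))"
        unfolding y_eq by (rule arg_cong[where f=cavg]) (auto simp: algebra_simps)
      also have "\<dots> = 0"
        by (subst cavg_diff) (auto intro!: circ_integrable_continuous continuous_intros cd continuous_on_cs summable_norm_g simp: a b)
      finally show ?thesis .
    qed
    have coeff: "coeff (err n) j = cavg (\<lambda>t. y t * cis (- (real j * t)))" if j: "j < n" for j
    proof -
      have deg: "degree (err n) \<le> n" by (rule degree_le) (use coeff_err in auto)
      have "cavg (\<lambda>t. poly (err n) (cis t) * cis (- (real j * t)))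
          = cavg (\<lambda>t. \<Sum>i\<le>n. coeff (err n) i * cis (of_int (int i - int j) * t))"
      proof -
        have "cis t ^ i * cis (- (real j * t)) = cis (of_int (int i - int j) * t)" for i t
          by (simp add: Complex.DeMoivre cis_mult algebra_simps)
        then show ?thesis by (simp only: poly_eq_sum_coeff[OF deg] sum_distrib_right mult.assoc)
      qed
      also have "\<dots> = (\<Sum>i\<le>n. cavg (\<lambda>t. coeff (err n) i * cis (of_int (int i - int j) * t)))"
        by (intro cavg_sum circ_integrable_continuous continuous_intros) auto
      also have "\<dots> = (\<Sum>i\<le>n. if i = j then coeff (err n) i else 0)"
        by (simp only: cavg_mult_left cavg_cis) (simp add: if_distrib cong: if_cong)
      also have "\<dots> = coeff (err n) j" using j by simp
      finally have 1: "cavg (\<lambda>t. poly (err n) (cis t) * cis (- (real j * t))) = coeff (err n) j" .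
      have "f t * cis (- (real j * t)) = - cnj (tail n t * cis (- (of_int (int n - int j) * t)))" for t
        by (simp add: f_def cis_cnj cis_mult algebra_simps)
      then have "cavg (\<lambda>t. f t * cis (- (real j * t))) = cavg (\<lambda>t. (- 1) * cnj (tail n t * cis (- (of_int (int n - int j) * t))))"
        by simp
      also have "\<dots> = - cnj (cavg (\<lambda>t. tail n t * cis (- (of_int (int n - int j) * t))))"
        unfolding cavg_mult_left
        by (subst cavg_cnj) (auto intro!: circ_integrable_continuous continuous_intros continuous_on_tail)
      also have "\<dots> = 0"
        unfolding tail_def cavg_cs_cis[OF summable_norm_tail] using j by simp
      finally have 2: "cavg (\<lambda>t. f t * cis (- (real j * t))) = 0" .
      have "cavg (\<lambda>t. y t * cis (- (real j * t)))
        = cavg (\<lambda>t. poly (err n) (cis t) * cis (- (real j * t)) + f t * cis (- (real j * t)))"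
        unfolding y_def distrib_right ..
      also have "\<dots> = cavg (\<lambda>t. poly (err n) (cis t) * cis (- (real j * t))) + cavg (\<lambda>t. f t * cis (- (real j * t)))"
        by (intro cavg_add circ_integrable_continuous continuous_intros cf)
      finally show ?thesis using 1 2 by simp
    qed
    have coeff_term: "coeff (err n) j * cis \<theta> ^ j * of_real (?w \<theta>)
        = cavg (\<lambda>t. y t * (of_real (?w \<theta> - ?w t) * cis (real j * (\<theta> - t))))" if j: "j < n" for j
    proof -
      have i1: "circ_integrable (\<lambda>t. y t * cis (- (real j * t)) * (cis (real j * \<theta>) * of_real (?w \<theta>)))"
        by (intro circ_integrable_continuous continuous_intros cy)
      have i2: "circ_integrable (\<lambda>t. y t * cis (- (real j * t)) * of_real (?w t) * cis (real j * \<theta>))"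
        by (intro circ_integrable_continuous continuous_intros cy cd)
      \<comment> \<open>The subtracted zero is the orthogonality relation \<open>orth\<close>; it
        puts the difference of weights \<open>?w \<theta> - ?w t\<close> under the mean.\<close>
      have "coeff (err n) j * cis \<theta> ^ j * of_real (?w \<theta>) = coeff (err n) j * (cis (real j * \<theta>) * of_real (?w \<theta>)) - 0 * cis (real j * \<theta>)"
        by (simp add: Complex.DeMoivre)
      also have "\<dots> = cavg (\<lambda>t. y t * cis (- (real j * t)) * (cis (real j * \<theta>) * of_real (?w \<theta>)))
         - cavg (\<lambda>t. y t * cis (- (real j * t)) * of_real (?w t) * cis (real j * \<theta>))"
        by (simp only: cavg_mult_right coeff[OF j] orth[OF j])
      also have "\<dots> = cavg (\<lambda>t. y t * cis (- (real j * t)) * (cis (real j * \<theta>) * of_real (?w \<theta>))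
         - y t * cis (- (real j * t)) * of_real (?w t) * cis (real j * \<theta>))"
        by (rule cavg_diff[OF i1 i2, symmetric])
      also have "(\<lambda>t. y t * cis (- (real j * t)) * (cis (real j * \<theta>) * of_real (?w \<theta>))
         - y t * cis (- (real j * t)) * of_real (?w t) * cis (real j * \<theta>))
         = (\<lambda>t. y t * (of_real (?w \<theta> - ?w t) * cis (real j * (\<theta> - t))))"
      proof
        fix t
        have "cis (real j * (\<theta> - t)) = cis (real j * \<theta>) * cis (- (real j * t))" by (simp add: cis_mult algebra_simps)
        then show "y t * cis (- (real j * t)) * (cis (real j * \<theta>) * of_real (?w \<theta>))
         - y t * cis (- (real j * t)) * of_real (?w t) * cis (real j * \<theta>)
         = y t * (of_real (?w \<theta> - ?w t) * cis (real j * (\<theta> - t)))" by (simp add: algebra_simps)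
      qed
      finally show ?thesis .
    qed
    have perr: "poly (err n) (cis \<theta>) = (\<Sum>j<n. coeff (err n) j * cis \<theta> ^ j)"
    proof -
      have deg: "degree (err n) \<le> n" by (rule degree_le) (use coeff_err in auto)
      show ?thesis unfolding poly_eq_sum_coeff[OF deg]
        by (rule sum.mono_neutral_right) (use coeff_err in auto)
    qed
    have cD: "continuous_on UNIV (\<lambda>t. y t * (of_real (?w \<theta> - ?w t) * cis (real j * (\<theta> - t))))" for j
      by (intro continuous_intros cy cd)
    have "poly (err n) (cis \<theta>) * of_real (?w \<theta>) = (\<Sum>j<n. cavg (\<lambda>t. y t * (of_real (?w \<theta> - ?w t) * cis (real j * (\<theta> - t)))))"
      unfolding perr sum_distrib_right by (rule sum.cong) (auto simp: coeff_term)
    also have "\<dots> = cavg (\<lambda>t. \<Sum>j<n. y t * (of_real (?w \<theta> - ?w t) * cis (real j * (\<theta> - t))))"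
      by (rule cavg_sum[symmetric]) (simp, rule circ_integrable_continuous[OF cD])
    also have "norm \<dots> \<le> cavg (\<lambda>t. K * (norm (poly (err n) (cis t)) + norm (tail n t)))"
    proof (rule norm_cavg_le)
      show "circ_integrable (\<lambda>t. \<Sum>j<n. y t * (of_real (?w \<theta> - ?w t) * cis (real j * (\<theta> - t))))"
        by (intro circ_integrable_continuous continuous_on_sum cD)
      show "circ_integrable (\<lambda>t. K * (norm (poly (err n) (cis t)) + norm (tail n t)))"
        by (intro circ_integrable_continuous continuous_intros continuous_on_tail)
      fix t
      have "norm (\<Sum>j<n. y t * (of_real (?w \<theta> - ?w t) * cis (real j * (\<theta> - t))))
          = norm (y t) * norm (of_real (?w \<theta> - ?w t) * (\<Sum>j<n. cis (real j * (\<theta> - t))))"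
        by (simp only: norm_mult[symmetric] sum_distrib_left)
      also have "\<dots> \<le> norm (y t) * K" by (intro mult_left_mono K) auto
      also have "\<dots> \<le> (norm (poly (err n) (cis t)) + norm (tail n t)) * K"
        using norm_triangle_ineq[of "poly (err n) (cis t)" "f t"] K0
        by (intro mult_right_mono) (auto simp: y_def f_def norm_mult)
      finally show "norm (\<Sum>j<n. y t * (of_real (?w \<theta> - ?w t) * cis (real j * (\<theta> - t))))
          \<le> K * (norm (poly (err n) (cis t)) + norm (tail n t))" by (simp add: mult.commute)
    qed
    also have "\<dots> = K * (cavg (\<lambda>t. norm (poly (err n) (cis t))) + cavg (\<lambda>t. norm (tail n t)))"
      unfolding cavg_mult_left
      by (subst cavg_add) (auto intro!: circ_integrable_continuous continuous_intros continuous_on_tail)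
    \<comment> \<open>Only \<open>L1\<close> norms remain, and these are controlled by the
      \<open>L2\<close> bounds through Cauchy-Schwarz.\<close>
    also have "\<dots> \<le> K * (sqrt C1 / real (Suc n) ^ Suc m + sqrt C2 / real (Suc n) ^ Suc m)"
      using K0 C1[of n] C2[of n]
      by (intro mult_left_mono add_mono cavg_norm_le_of_L2 continuous_on_poly_cis continuous_on_tail) auto
    finally have A: "norm (poly (err n) (cis \<theta>)) * ?w \<theta> \<le> K * (sqrt C1 + sqrt C2) / real (Suc n) ^ Suc m"
      by (simp add: norm_mult add_divide_distrib distrib_left)
    have "1 \<le> exp B * ?w \<theta>" using B[of \<theta>] by (simp flip: exp_add)
    then have "norm (poly (err n) (cis \<theta>)) \<le> exp B * (norm (poly (err n) (cis \<theta>)) * ?w \<theta>)"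
      using mult_left_mono[of 1 "exp B * ?w \<theta>" "norm (poly (err n) (cis \<theta>))"] by (simp add: mult_ac)
    also have "\<dots> \<le> exp B * (K * (sqrt C1 + sqrt C2) / real (Suc n) ^ Suc m)"
      using A by (intro mult_left_mono) auto
    finally show ?thesis by simp
  qed
  then show ?thesis using K0 C10 C20 by (intro exI[of _ "exp B * (K * (sqrt C1 + sqrt C2))"]) auto
qed

lemma err_sup_disc: "\<exists>C\<ge>0. \<forall>n z. norm z < 1 \<longrightarrow> norm (poly (OP n) z - poly (mpoly n) z) \<le> C / real (Suc n) ^ Suc m"
proof -
  obtain C where "0 \<le> C" and C: "\<And>n t. norm (poly (err n) (cis t)) \<le> C / real (Suc n) ^ Suc m"
    using err_sup by metis
  moreover have "norm (poly (err n) z) \<le> C / real (Suc n) ^ Suc m" if "norm z < 1" for n z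
    by (rule maximum_modulus_disc[where f="poly (err n)", OF _ _ C that]) (auto intro!: holomorphic_intros continuous_intros)
  ultimately show ?thesis unfolding err_def by auto
qed

end

section \<open>Taylor expansion at the boundary\<close>

lemma exp_minus_power_le:
  fixes x :: real
  assumes "0 \<le> x"
  shows "exp (- x) * x ^ k \<le> fact k"
proof -
  have "(\<Sum>n\<in>{k}. x ^ n /\<^sub>R fact n) \<le> (\<Sum>n. x ^ n /\<^sub>R fact n)"
    using assms by (intro sum_le_suminf summable_exp_generic) auto
  then have "x ^ k / fact k \<le> exp x" by (simp add: exp_def divide_inverse mult.commute)
  then have "x ^ k \<le> fact k * exp x" by (simp add: field_simps)
  then show ?thesis by (simp add: exp_minus field_simps)
qed

text \<open>The powers \<open>q ^ j\<close> are monotone in \<open>j\<close>, so their total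
  variation telescopes to \<open>\<bar>q - q ^ N\<bar>\<close> and summation by parts costs no
  factor \<open>N\<close>. Both \<open>q \<le> 1\<close> and \<open>q > 1\<close> occur, for
  frequencies of opposite sign.\<close>

lemma geometric_abel:
  fixes a :: "nat \<Rightarrow> complex"
  assumes A: "\<And>J. 1 \<le> J \<Longrightarrow> J \<le> N \<Longrightarrow> norm (\<Sum>j=1..J. a j) \<le> B" and N: "1 \<le> N" and q: "0 < q"
  shows "norm (\<Sum>j=1..N. a j * of_real (q ^ j)) \<le> 2 * B * max 1 (q ^ N)"
proof -
  define T where "T J = (\<Sum>j=1..J. a j * of_real (q ^ j))" for J
  define P where "P J = (\<Sum>j=1..J. a j)" for J
  have B0: "0 \<le> B" using order_trans[OF norm_ge_zero A[of 1]] N by simp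
  have "norm (T J - of_real (q ^ J) * P J) \<le> B * \<bar>q - q ^ J\<bar>" if "1 \<le> J" "J \<le> N" for J
    using that
  proof (induction J rule: dec_induct)
    case base
    then show ?case by (simp add: T_def P_def mult.commute)
  next
    case (step J)
    have "T (Suc J) - of_real (q ^ Suc J) * P (Suc J) = (T J - of_real (q ^ J) * P J) + of_real (q ^ J - q ^ Suc J) * P J"
      by (simp add: T_def P_def algebra_simps)
    also have "norm \<dots> \<le> B * \<bar>q - q ^ J\<bar> + \<bar>q ^ J - q ^ Suc J\<bar> * B"
      unfolding P_def using step A[of J]
      by (intro norm_triangle_mono) (auto simp: norm_mult P_def simp flip: of_real_diff of_real_mult of_real_power simp del: power_Suc intro!: mult_left_mono)
    also have "\<dots> = B * (\<bar>q - q ^ J\<bar> + \<bar>q ^ J - q ^ Suc J\<bar>)" by (simp add: algebra_simps)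
    also have "\<bar>q - q ^ J\<bar> + \<bar>q ^ J - q ^ Suc J\<bar> = \<bar>q - q ^ Suc J\<bar>"
    proof (cases "q \<le> 1")
      case True
      then have "q ^ Suc J \<le> q ^ J" "q ^ J \<le> q ^ 1" using q step by (intro power_decreasing; simp)+
      then show ?thesis by simp
    next
      case False
      then have "q ^ J \<le> q ^ Suc J" "q ^ 1 \<le> q ^ J" using step by (intro power_increasing; simp)+
      then show ?thesis by simp
    qed
    finally show ?case .
  qed
  from this[OF N order_refl]
  have "norm (T N) \<le> B * \<bar>q - q ^ N\<bar> + norm (of_real (q ^ N) * P N)"
    using norm_triangle_ineq[of "T N - of_real (q ^ N) * P N" "of_real (q ^ N) * P N"] by simp
  also have "norm (of_real (q ^ N) * P N) \<le> q ^ N * B"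
    using q A[OF N order_refl] unfolding norm_mult norm_of_real P_def by (intro mult_mono) auto
  also have "B * \<bar>q - q ^ N\<bar> + q ^ N * B = B * (\<bar>q - q ^ N\<bar> + q ^ N)" by (simp add: algebra_simps)
  also have "\<dots> \<le> B * (2 * max 1 (q ^ N))"
  proof (intro mult_left_mono B0)
    show "\<bar>q - q ^ N\<bar> + q ^ N \<le> 2 * max 1 (q ^ N)"
    proof (cases "q \<le> 1")
      case True
      then have "q ^ N \<le> q ^ 1" using q N by (intro power_decreasing) auto
      then show ?thesis using True by simp
    next
      case False
      then have "q ^ 1 \<le> q ^ N" using N by (intro power_increasing) auto
      then show ?thesis using q by simp
    qed
  qed
  finally show ?thesis by (simp add: T_def mult_ac)
qed

lemma sum_symmetric_int:
  fixes F :: "int \<Rightarrow> 'a::comm_monoid_add"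
  shows "(\<Sum>j=-int N..int N. F j) = F 0 + ((\<Sum>j=1..N. F (int j)) + (\<Sum>j=1..N. F (- int j)))"
proof (induction N)
  case (Suc N)
  have "{-int (Suc N)..int (Suc N)} = insert (int (Suc N)) (insert (-int (Suc N)) {-int N..int N})" by auto
  then show ?case using Suc by (simp add: ac_simps)
qed simp

context circle_jet
begin

text \<open>The analytic continuation off the circle of the Fourier partial sum of order
  \<open>N\<close>, in logarithmic coordinates: at \<open>s = ln r\<close> it is the value at radius
  \<open>r\<close> and angle \<open>\<theta>\<close>.\<close>

definition ext :: "nat \<Rightarrow> real \<Rightarrow> complex \<Rightarrow> complex" where
  "ext N \<theta> s = (\<Sum>j=-int N..int N. u j * cis (of_int j * \<theta>) * exp (of_int j * s))"

text \<open>Taylor's formula in \<open>s\<close> at the boundary point \<open>s = 0\<close>.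
  Differentiating in \<open>s\<close> is \<open>- \<i>\<close> times differentiating in
  \<open>\<theta>\<close>, so the coefficients are partial jets. The remainder is a sum of
  \<open>j ^ Suc m * u j * cis (j * \<theta>) * exp (j * s)\<close>; Abel summation in
  \<open>exp (j * s)\<close> keeps it logarithmic up to the growth
  \<open>exp (N * \<bar>s\<bar>)\<close>, which \<open>|z| ^ n\<close> later absorbs. The factor 4
  is 2 from Abel summation for each sign of \<open>j\<close>.\<close>

lemma ext_taylor:
  "\<exists>C\<ge>0. \<forall>N\<ge>1. \<forall>\<theta>. \<forall>s\<le>0. norm (ext N \<theta> (of_real s) - (\<Sum>p\<le>m. partial_jet p N \<theta> * (- \<i> * of_real s) ^ p / fact p))
     \<le> C * (1 + ln (real N)) * \<bar>s\<bar> ^ Suc m * exp (real N * \<bar>s\<bar>)"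
proof -
  obtain C where C0: "0 \<le> C" and C: "\<And>J \<theta>. 1 \<le> J \<Longrightarrow>
      norm (\<Sum>j=1..J. of_nat j ^ Suc m * u (int j) * cis (real j * \<theta>)) \<le> C * (1 + ln (real J))"
    using partial_sum_log by metis
  have "norm (ext N \<theta> (of_real s) - (\<Sum>p\<le>m. partial_jet p N \<theta> * (- \<i> * of_real s) ^ p / fact p))
     \<le> 4 * C * (1 + ln (real N)) * \<bar>s\<bar> ^ Suc m * exp (real N * \<bar>s\<bar>)" if N: "1 \<le> N" and s: "s \<le> 0" for N \<theta> s
  proof -
    define B where "B = C * (1 + ln (real N))"
    have B0: "0 \<le> B" using C0 N by (simp add: B_def)
    define f where "f p \<sigma> = (\<Sum>j=-int N..int N. u j * cis (of_int j * \<theta>) * of_int j ^ p * exp (of_int j * \<sigma>))" for p and \<sigma> :: complex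
    have df: "(f p has_field_derivative f (Suc p) \<sigma>) (at \<sigma> within X)" for p \<sigma> X
      unfolding f_def
      by (auto intro!: derivative_eq_intros sum.cong simp: mult_ac)
    let ?a = "\<lambda>j. of_nat j ^ Suc m * u (int j) * cis (real j * \<theta>)"
    have part: "norm (\<Sum>j=1..J. ?a j) \<le> B" if "1 \<le> J" "J \<le> N" for J
      using that C0 by (intro order_trans[OF C[OF that(1)]]) (auto simp: B_def intro!: mult_left_mono)
    have bound: "norm (f (Suc m) \<sigma>) \<le> 4 * B * exp (real N * \<bar>s\<bar>)" if "\<sigma> \<in> closed_segment 0 (of_real s)" for \<sigma>
    proof -
      obtain x where x: "\<sigma> = of_real x" "s \<le> x" "x \<le> 0"
      proof -
        obtain c where c: "0 \<le> c" "c \<le> 1" "\<sigma> = c *\<^sub>R of_real s"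
          using \<open>\<sigma> \<in> closed_segment 0 (of_real s)\<close> by (auto simp: in_segment)
        show ?thesis
        proof (rule that)
          show "\<sigma> = of_real (c * s)" using c by (simp add: scaleR_conv_of_real)
          show "s \<le> c * s" using c s mult_right_mono_neg[of c 1 s] by simp
          show "c * s \<le> 0" using c s by (simp add: mult_nonneg_nonpos)
        qed
      qed
      define P1 where "P1 = (\<Sum>j=1..N. ?a j * of_real (exp x ^ j))"
      define P2 where "P2 = (\<Sum>j=1..N. ?a j * of_real (exp (- x) ^ j))"
      have e1: "u (int j) * cis (of_int (int j) * \<theta>) * of_int (int j) ^ Suc m * exp (of_int (int j) * \<sigma>) = ?a j * of_real (exp x ^ j)" for j
        by (simp add: x exp_of_nat_mult exp_of_real)
      have e2: "u (- int j) * cis (of_int (- int j) * \<theta>) * of_int (- int j) ^ Suc m * exp (of_int (- int j) * \<sigma>)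
          = (- 1) ^ Suc m * cnj (?a j * of_real (exp (- x) ^ j))" for j
      proof -
        have "exp (of_int (- int j) * \<sigma>) = of_real (exp (- x) ^ j)"
          by (simp add: x exp_of_real[symmetric] exp_of_nat_mult[symmetric] mult.commute)
        moreover have "complex_of_int (- int j) ^ Suc m = (- 1) ^ Suc m * of_nat j ^ Suc m"
          by (simp add: power_mult_distrib[symmetric] del: power_Suc)
        moreover have "cis (of_int (- int j) * \<theta>) = cnj (cis (real j * \<theta>))" by (simp add: cis_cnj)
        ultimately show ?thesis
          by (simp only: u_uminus complex_cnj_mult complex_cnj_power complex_cnj_of_nat complex_cnj_complex_of_real mult_ac)
      qed
      have le: "max 1 (exp y ^ N) \<le> exp (real N * \<bar>s\<bar>)" if "y \<le> \<bar>s\<bar>" for y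
        using that by (auto simp: exp_of_nat_mult[symmetric] intro!: mult_left_mono)
      have "f (Suc m) \<sigma> = P1 + (- 1) ^ Suc m * cnj P2"
        unfolding f_def sum_symmetric_int e1 e2 P1_def P2_def cnj_sum sum_distrib_left by simp
      then have "norm (f (Suc m) \<sigma>) \<le> norm P1 + norm P2"
        using norm_triangle_ineq[of P1 "(- 1) ^ Suc m * cnj P2"] by (simp add: norm_mult norm_power)
      moreover have "norm P1 \<le> 2 * B * max 1 (exp x ^ N)"
        unfolding P1_def by (rule geometric_abel[OF part N]) auto
      moreover have "norm P2 \<le> 2 * B * max 1 (exp (- x) ^ N)"
        unfolding P2_def by (rule geometric_abel[OF part N]) auto
      moreover have "2 * B * max 1 (exp x ^ N) \<le> 2 * B * exp (real N * \<bar>s\<bar>)"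
        using le[of x] x s B0 by (intro mult_left_mono) auto
      moreover have "2 * B * max 1 (exp (- x) ^ N) \<le> 2 * B * exp (real N * \<bar>s\<bar>)"
        using le[of "- x"] x s B0 by (intro mult_left_mono) auto
      ultimately show ?thesis by linarith
    qed
    have "norm (f 0 (of_real s) - (\<Sum>p\<le>m. f p 0 * (of_real s - 0) ^ p / fact p)) \<le> 4 * B * exp (real N * \<bar>s\<bar>) * norm (of_real s - 0 :: complex) ^ Suc m / fact m"
      by (rule complex_Taylor[of "closed_segment 0 (of_real s)"]) (use df bound in auto)
    also have "\<dots> \<le> 4 * B * exp (real N * \<bar>s\<bar>) * norm (of_real s - 0 :: complex) ^ Suc m"
    proof -
      have "X / fact m \<le> X" if "0 \<le> X" for X :: real
        using that fact_ge_1[of m, where 'a=real] by (simp add: divide_le_eq mult_le_cancel_left1)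
      then show ?thesis using B0 by simp
    qed
    also have "f 0 (of_real s) = ext N \<theta> (of_real s)" by (simp add: f_def ext_def)
    also have "(\<Sum>p\<le>m. f p 0 * (of_real s - 0) ^ p / fact p) = (\<Sum>p\<le>m. partial_jet p N \<theta> * (- \<i> * of_real s) ^ p / fact p)"
    proof (rule sum.cong)
      fix p
      have i: "(\<i> * x) ^ p * (- \<i> * y) ^ p = x ^ p * y ^ p" for x y :: complex
      proof -
        have "(\<i> * x) * (- \<i> * y) = x * y" by (simp add: complex_eq_iff algebra_simps)
        then show ?thesis by (simp only: power_mult_distrib[symmetric])
      qed
      have "partial_jet p N \<theta> * (- \<i> * of_real s) ^ p = f p 0 * of_real s ^ p"
        unfolding partial_jet_def f_def sum_distrib_right
      proof (rule sum.cong)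
        fix j
        have "(\<i> * of_int j) ^ p * u j * cis (of_int j * \<theta>) * (- \<i> * of_real s) ^ p
           = u j * cis (of_int j * \<theta>) * ((\<i> * of_int j) ^ p * (- \<i> * of_real s) ^ p)" by (simp only: mult_ac)
        then show "(\<i> * of_int j) ^ p * u j * cis (of_int j * \<theta>) * (- \<i> * of_real s) ^ p
           = u j * cis (of_int j * \<theta>) * of_int j ^ p * exp (of_int j * 0) * of_real s ^ p"
          unfolding i by simp
      qed auto
      then show "f p 0 * (of_real s - 0) ^ p / fact p = partial_jet p N \<theta> * (- \<i> * of_real s) ^ p / fact p" by simp
    qed auto
    finally show ?thesis by (simp add: B_def mult_ac)
  qed
  then show ?thesis using C0 by (intro exI[of _ "4 * C"]) auto
qed

text \<open>The Taylor coefficients of \<open>t \<mapsto> exp (d 0 \<theta> + d 1 \<theta> t + \<dots>)\<close> up to order \<open>m\<close> are those given by the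
  recursion for the exponential of the jet; truncating the jet does not change them.\<close>
lemma exp_jet_remainder:
  "\<exists>C\<ge>0. \<forall>\<theta>. \<forall>t::complex. norm t \<le> r \<longrightarrow>
     norm (exp (\<Sum>p\<le>m. of_real (d p \<theta> / fact p) * t ^ p) - (\<Sum>p\<le>m. of_real (exp_jet p \<theta>) * t ^ p)) \<le> C * norm t ^ Suc m"
proof -
  \<comment> \<open>Besides \<open>norm t \<le> q\<close>, the bound \<open>1 \<le> q\<close> is
    what allows \<open>Suc m\<close> powers of \<open>norm t\<close> to be split off from every term
    of the remainder.\<close>
  define q where "q = max 1 r"
  have q: "1 \<le> q" "r \<le> q" by (auto simp: q_def)
  have "\<exists>B. \<forall>p\<le>m. \<forall>x. \<bar>d p x\<bar> \<le> B"
  proof -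
    have "\<forall>p. \<exists>B. p \<le> m \<longrightarrow> (\<forall>x. \<bar>d p x\<bar> \<le> B)"
      using bounded_lipschitz_jet unfolding bounded_lipschitz_def by blast
    then obtain Bs where Bs: "\<And>p x. p \<le> m \<Longrightarrow> \<bar>d p x\<bar> \<le> Bs p" by metis
    have "\<bar>d p x\<bar> \<le> Max (Bs ` {..m})" if "p \<le> m" for p x
      using Bs[OF that, of x] that by (intro order_trans[OF _ Max_ge]) auto
    then show ?thesis by blast
  qed
  then obtain B where B: "\<And>p x. p \<le> m \<Longrightarrow> \<bar>d p x\<bar> \<le> B" by blast
  have B0: "0 \<le> B" using order_trans[OF abs_ge_zero B[of 0 0]] by simp
  define K where "K = exp B * exp (\<Sum>p\<le>m. B * q ^ p)"
  have "norm (exp (\<Sum>p\<le>m. of_real (d p \<theta> / fact p) * t ^ p) - (\<Sum>p\<le>m. of_real (exp_jet p \<theta>) * t ^ p)) \<le> K * norm t ^ Suc m"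
    if t: "norm t \<le> r" for \<theta> and t :: complex
  proof -
    \<comment> \<open>Zero at index 0, because \<open>exp (d 0 \<theta>)\<close> is factored out,
      and zero beyond \<open>m\<close>, which changes none of the coefficients up to order
      \<open>m\<close>.\<close>
    define a :: "nat \<Rightarrow> complex" where "a p = (if 1 \<le> p \<and> p \<le> m then of_real (d p \<theta> / fact p) else 0)" for p
    define c where "c = expseq a"
    have sa: "summable (\<lambda>p. norm (a p * x ^ p))" for x
      by (rule summable_finite[of "{..m}"]) (auto simp: a_def)
    have cx: "expseq (\<lambda>p. a p * x ^ p) l = c l * x ^ l" for x l unfolding c_def by (rule expseq_scale)
    have sc: "summable (\<lambda>l. norm (c l * x ^ l))" for x
      using summable_norm_expseq[OF sa[of x]] by (simp only: cx)
    have csum: "(\<Sum>l. norm (c l * of_real q ^ l)) \<le> exp (\<Sum>p\<le>m. B * q ^ p)"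
    proof -
      have "(\<Sum>l. norm (c l * of_real q ^ l)) \<le> exp (\<Sum>p. norm (a p * of_real q ^ p))"
        using suminf_norm_expseq_le[OF sa[of "of_real q"]] by (simp only: cx)
      also have "(\<Sum>p. norm (a p * of_real q ^ p)) = (\<Sum>p\<le>m. norm (a p * of_real q ^ p))"
        by (rule suminf_finite) (auto simp: a_def)
      also have "\<dots> \<le> (\<Sum>p\<le>m. B * q ^ p)"
      proof (rule sum_mono)
        fix p assume p: "p \<in> {..m}"
        have "\<bar>d p \<theta> / fact p\<bar> \<le> \<bar>d p \<theta>\<bar>"
          using fact_ge_1[of p, where 'a=real] by (simp add: divide_le_eq mult_le_cancel_left1)
        then have "norm (a p) \<le> B" using B[of p \<theta>] p B0 by (auto simp: a_def norm_divide)
        then show "norm (a p * of_real q ^ p) \<le> B * q ^ p"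
          using q by (auto simp: norm_mult norm_power intro!: mult_right_mono)
      qed
      finally show ?thesis by simp
    qed
    have "exp (\<Sum>p\<le>m. of_real (d p \<theta> / fact p) * t ^ p) = of_real (exp (d 0 \<theta>)) * exp (\<Sum>p. a p * t ^ p)"
    proof -
      have "(\<Sum>p. a p * t ^ p) = (\<Sum>p\<le>m. a p * t ^ p)" by (rule suminf_finite) (auto simp: a_def)
      then have "of_real (d 0 \<theta>) + (\<Sum>p. a p * t ^ p) = (\<Sum>p\<le>m. of_real (d p \<theta> / fact p) * t ^ p)"
        by (simp add: sum.atMost_shift a_def)
      then show ?thesis by (metis exp_add exp_of_real)
    qed
    also have "exp (\<Sum>p. a p * t ^ p) = (\<Sum>l. c l * t ^ l)"
    proof -
      have "(\<Sum>l. expseq (\<lambda>p. a p * t ^ p) l * 1 ^ l) = exp (\<Sum>p. a p * t ^ p * 1 ^ p)"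
        by (rule expseq_power_series[OF sa]) (auto simp: a_def)
      then show ?thesis by (simp add: cx)
    qed
    also have "\<dots> = (\<Sum>l. c (l + Suc m) * t ^ (l + Suc m)) + (\<Sum>l\<le>m. c l * t ^ l)"
      using suminf_split_initial_segment[OF summable_norm_cancel[OF sc[of t]], of "Suc m"]
      by (simp only: lessThan_Suc_atMost)
    finally have "exp (\<Sum>p\<le>m. of_real (d p \<theta> / fact p) * t ^ p) - (\<Sum>p\<le>m. of_real (exp_jet p \<theta>) * t ^ p)
      = of_real (exp (d 0 \<theta>)) * (\<Sum>l. c (l + Suc m) * t ^ (l + Suc m)) + (of_real (exp (d 0 \<theta>)) * (\<Sum>l\<le>m. c l * t ^ l) - (\<Sum>p\<le>m. of_real (exp_jet p \<theta>) * t ^ p))"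
      by (simp add: algebra_simps)
    also have "of_real (exp (d 0 \<theta>)) * (\<Sum>l\<le>m. c l * t ^ l) = (\<Sum>p\<le>m. of_real (exp_jet p \<theta>) * t ^ p)"
      unfolding sum_distrib_left
    proof (rule sum.cong)
      fix l assume "l \<in> {..m}"
      then have "c l = expseq (\<lambda>i. complex_of_real (d i \<theta> / fact i)) l"
        unfolding c_def by (intro expseq_cong) (auto simp: a_def)
      then have "c l = of_real (expseq (\<lambda>i. d i \<theta> / fact i) l)" by (simp only: expseq_of_real)
      then show "of_real (exp (d 0 \<theta>)) * (c l * t ^ l) = of_real (exp_jet l \<theta>) * t ^ l"
        by (simp add: exp_jet_def)
    qed auto
    also have "of_real (exp (d 0 \<theta>)) * (\<Sum>l. c (l + Suc m) * t ^ (l + Suc m)) + ((\<Sum>p\<le>m. of_real (exp_jet p \<theta>) * t ^ p) - (\<Sum>p\<le>m. of_real (exp_jet p \<theta>) * t ^ p))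
       = of_real (exp (d 0 \<theta>)) * (\<Sum>l. c (l + Suc m) * t ^ (l + Suc m))" by simp
    also have "norm \<dots> \<le> exp B * (exp (\<Sum>p\<le>m. B * q ^ p) * norm t ^ Suc m)"
      unfolding norm_mult
    proof (rule mult_mono)
      show "norm (complex_of_real (exp (d 0 \<theta>))) \<le> exp B" using B[of 0 \<theta>] by simp
      have le: "norm (c (l + Suc m) * t ^ (l + Suc m)) \<le> norm (c (l + Suc m) * of_real q ^ (l + Suc m)) * norm t ^ Suc m" for l
      proof -
        have "norm t ^ l \<le> q ^ l" using t q by (intro power_mono) auto
        moreover have "1 \<le> q ^ Suc m" using q(1) by (rule one_le_power)
        ultimately have "norm t ^ l * 1 \<le> q ^ l * q ^ Suc m" using q by (intro mult_mono) auto
        then have "norm t ^ (l + Suc m) \<le> q ^ (l + Suc m) * norm t ^ Suc m"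
          unfolding power_add by (intro mult_right_mono) auto
        then have "norm (c (l + Suc m)) * norm t ^ (l + Suc m) \<le> norm (c (l + Suc m)) * (q ^ (l + Suc m) * norm t ^ Suc m)"
          by (rule mult_left_mono) auto
        then show ?thesis
          using q by (simp add: norm_mult norm_power mult.assoc del: power_Suc)
      qed
      have s2: "summable (\<lambda>l. norm (c (l + Suc m) * of_real q ^ (l + Suc m)))"
        by (rule summable_ignore_initial_segment[OF sc])
      have s1: "summable (\<lambda>l. norm (c (l + Suc m) * t ^ (l + Suc m)))"
        by (rule summable_ignore_initial_segment[OF sc])
      have "norm (\<Sum>l. c (l + Suc m) * t ^ (l + Suc m)) \<le> (\<Sum>l. norm (c (l + Suc m) * t ^ (l + Suc m)))"
        by (rule summable_norm[OF s1])
      also have "\<dots> \<le> (\<Sum>l. norm (c (l + Suc m) * of_real q ^ (l + Suc m)) * norm t ^ Suc m)"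
        by (rule suminf_le[OF le s1 summable_mult2[OF s2]])
      also have "\<dots> = (\<Sum>l. norm (c (l + Suc m) * of_real q ^ (l + Suc m))) * norm t ^ Suc m"
        by (rule suminf_mult2[OF s2, symmetric])
      also have "\<dots> \<le> exp (\<Sum>p\<le>m. B * q ^ p) * norm t ^ Suc m"
      proof (rule mult_right_mono)
        have "(\<Sum>l. norm (c (l + Suc m) * of_real q ^ (l + Suc m))) \<le> (\<Sum>l. norm (c l * of_real q ^ l))"
          using suminf_split_initial_segment[OF sc[of "of_real q"], of "Suc m"] sum_nonneg[of "{..<Suc m}" "\<lambda>l. norm (c l * of_real q ^ l)"]
          by simp
        then show "(\<Sum>l. norm (c (l + Suc m) * of_real q ^ (l + Suc m))) \<le> exp (\<Sum>p\<le>m. B * q ^ p)"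
          using csum by linarith
      qed auto
      finally show "norm (\<Sum>l. c (l + Suc m) * t ^ (l + Suc m)) \<le> exp (\<Sum>p\<le>m. B * q ^ p) * norm t ^ Suc m" .
    qed auto
    finally show ?thesis by (simp add: K_def mult_ac)
  qed
  moreover have "0 \<le> K" by (simp add: K_def)
  ultimately show ?thesis by blast
qed

text \<open>The coefficient of \<open>z ^ i\<close> is \<open>cnj (g (n - i))\<close>. The power
  \<open>n ^ Suc m\<close> is shared between \<open>n - i\<close>, where the decay of
  \<open>g\<close> absorbs it, and \<open>i\<close>, where the geometric decay of
  \<open>\<rho> ^ i\<close> does. Neither side produces a logarithm.\<close>

lemma mpoly_small_disc:
  assumes \<rho>: "0 < \<rho>" "\<rho> < 1"
  shows "\<exists>C\<ge>0. \<forall>n\<ge>1. \<forall>z. norm z < \<rho> \<longrightarrow> norm (poly (mpoly n) z) \<le> C / real n ^ Suc m"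
proof -
  obtain D where D0: "0 \<le> D" and D: "\<And>l. real l ^ Suc m * norm (g l) \<le> D" using g_decay by metis
  define G where "G = (\<Sum>l. norm (g l))"
  have G0: "0 \<le> G" unfolding G_def by (intro suminf_nonneg summable_norm_g) auto
  define s where "s = - ln \<rho>"
  have s: "0 < s" using \<rho> by (simp add: s_def)
  define E where "E = fact (Suc m) / s ^ Suc m"
  have E0: "0 \<le> E" using s by (simp add: E_def)
  have E: "real j ^ Suc m * \<rho> ^ j \<le> E" for j
  proof -
    have "\<rho> ^ j = exp (- (real j * s))" using \<rho> by (simp add: s_def exp_of_nat_mult)
    then have "s ^ Suc m * (real j ^ Suc m * \<rho> ^ j) = exp (- (real j * s)) * (real j * s) ^ Suc m"
      by (simp only: power_mult_distrib mult_ac)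
    also have "\<dots> \<le> fact (Suc m)" using s by (intro exp_minus_power_le) auto
    finally show ?thesis using s by (simp add: E_def pos_le_divide_eq mult.commute del: power_Suc fact_Suc)
  qed
  have "norm (poly (mpoly n) z) \<le> 2 ^ Suc m * (D / (1 - \<rho>) + G * E) / real n ^ Suc m"
    if n: "1 \<le> n" and z: "norm z < \<rho>" for n z
  proof -
    have "norm (poly (mpoly n) z) \<le> (\<Sum>i\<le>n. norm (g (n - i)) * \<rho> ^ i)"
      unfolding poly_eq_sum_coeff[OF eq_refl[OF degree_mpoly]]
    proof (rule sum_norm_le)
      fix i assume "i \<in> {..n}"
      then show "norm (coeff (mpoly n) i * z ^ i) \<le> norm (g (n - i)) * \<rho> ^ i"
        using z by (auto simp: coeff_mpoly norm_mult norm_power intro!: mult_left_mono power_mono)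
    qed
    then have "real n ^ Suc m * norm (poly (mpoly n) z) \<le> real n ^ Suc m * (\<Sum>i\<le>n. norm (g (n - i)) * \<rho> ^ i)"
      by (intro mult_left_mono) auto
    also have "\<dots> = (\<Sum>i\<le>n. real n ^ Suc m * (norm (g (n - i)) * \<rho> ^ i))" by (rule sum_distrib_left)
    also have "\<dots> \<le> (\<Sum>i\<le>n. 2 ^ Suc m * (D * \<rho> ^ i + norm (g (n - i)) * E))"
    proof (rule sum_mono)
      fix i assume i: "i \<in> {..n}"
      have "real n ^ Suc m \<le> 2 ^ Suc m * (real (n - i) ^ Suc m + real i ^ Suc m)"
        using add_power_le[of "real (n - i)" "real i" "Suc m"] i by simp
      then have "real n ^ Suc m * (norm (g (n - i)) * \<rho> ^ i) \<le> 2 ^ Suc m * (real (n - i) ^ Suc m + real i ^ Suc m) * (norm (g (n - i)) * \<rho> ^ i)"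
        using \<rho> by (intro mult_right_mono) auto
      also have "\<dots> = 2 ^ Suc m * ((real (n - i) ^ Suc m * norm (g (n - i))) * \<rho> ^ i + norm (g (n - i)) * (real i ^ Suc m * \<rho> ^ i))"
        by (simp only: distrib_left distrib_right mult_ac)
      also have "\<dots> \<le> 2 ^ Suc m * (D * \<rho> ^ i + norm (g (n - i)) * E)"
        using \<rho> D E by (intro mult_left_mono add_mono mult_right_mono) auto
      finally show "real n ^ Suc m * (norm (g (n - i)) * \<rho> ^ i) \<le> 2 ^ Suc m * (D * \<rho> ^ i + norm (g (n - i)) * E)" .
    qed
    also have "\<dots> = 2 ^ Suc m * (D * (\<Sum>i\<le>n. \<rho> ^ i) + (\<Sum>i\<le>n. norm (g (n - i))) * E)"
      by (simp only: sum_distrib_left[symmetric] sum_distrib_right[symmetric] sum.distrib)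
    also have "\<dots> \<le> 2 ^ Suc m * (D * (1 / (1 - \<rho>)) + G * E)"
    proof (intro mult_left_mono add_mono mult_right_mono D0 E0)
      have "(\<Sum>i\<le>n. \<rho> ^ i) \<le> (\<Sum>i. \<rho> ^ i)" using \<rho> by (intro sum_le_suminf summable_geometric) auto
      then show "(\<Sum>i\<le>n. \<rho> ^ i) \<le> 1 / (1 - \<rho>)" using \<rho> by (simp add: suminf_geometric)
      have "(\<Sum>i\<le>n. norm (g (n - i))) = (\<Sum>i\<le>n. norm (g i))"
        by (rule sum.nat_diff_reindex[of "\<lambda>i. norm (g i)" "Suc n", simplified lessThan_Suc_atMost diff_Suc_Suc])
      also have "\<dots> \<le> G" unfolding G_def by (intro sum_le_suminf summable_norm_g) auto
      finally show "(\<Sum>i\<le>n. norm (g (n - i))) \<le> G" .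
    qed auto
    finally show ?thesis using n by (simp add: pos_le_divide_eq mult.commute del: power_Suc)
  qed
  moreover have "0 \<le> 2 ^ Suc m * (D / (1 - \<rho>) + G * E)" using D0 G0 E0 \<rho> by simp
  ultimately show ?thesis by blast
qed

end

section \<open>Asymptotics in the annulus\<close>

context circle_jet
begin

lemma v_series_bound: "norm z \<le> 1 \<Longrightarrow> norm (\<Sum>i. v i * z ^ i) \<le> (\<Sum>i. norm (v i))"
proof -
  assume z: "norm z \<le> 1"
  have s: "summable (\<lambda>i. norm (v i * z ^ i))" by (rule summable_power_series_disc[OF summable_norm_v z])
  have "norm (\<Sum>i. v i * z ^ i) \<le> (\<Sum>i. norm (v i * z ^ i))" by (rule summable_norm[OF s])
  also have "\<dots> \<le> (\<Sum>i. norm (v i))"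
    using z by (intro suminf_le s summable_norm_v) (auto simp: norm_mult norm_power intro!: mult_left_le power_le_one)
  finally show ?thesis .
qed

lemma mpoly_annulus:
  assumes \<rho>: "0 < \<rho>" "\<rho> < 1"
  shows "\<exists>C\<ge>0. \<forall>n\<ge>2. \<forall>z. \<rho> < norm z \<and> norm z < 1 \<longrightarrow>
     norm (poly (mpoly n) z - z ^ n * exp (- of_real V0 - (\<Sum>i. v i * z ^ i))
        * exp (\<Sum>p\<le>m. of_real (d p (Arg z) / fact p) * (- \<i> * of_real (ln (norm z))) ^ p))
     \<le> C * (1 + ln (real (Suc n))) / real n ^ Suc m"
proof -
  interpret U: circle_jet m "\<lambda>p x. fact p * exp_jet p x" by (rule circle_jet_exp)
  obtain Cu where Cu0: "0 \<le> Cu" and Cu': "\<forall>p\<le>m. \<forall>N\<ge>1. \<forall>\<theta>.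
      norm (of_real (fact p * exp_jet p \<theta>) - U.partial_jet p N \<theta>) \<le> Cu * (1 + ln (real (Suc N))) / real (Suc N) ^ (Suc m - p)"
    using U.partial_jet_error by (elim exE conjE) (rule that)
  have Cu: "norm (of_real (fact p * exp_jet p \<theta>) - U.partial_jet p N \<theta>) \<le> Cu * (1 + ln (real (Suc N))) / real (Suc N) ^ (Suc m - p)"
    if "p \<le> m" "1 \<le> N" for p N \<theta>
    using Cu'[rule_format, OF that] .
  obtain Ct where Ct0: "0 \<le> Ct" and Ct: "\<forall>n\<ge>1. \<forall>t. norm (tail n t) \<le> Ct * (1 + ln (real (Suc n))) / real (Suc n) ^ Suc m"
    using tail_sup by (elim exE conjE) (rule that)
  obtain Cx where Cx0: "0 \<le> Cx" and Cx: "\<forall>N\<ge>1. \<forall>\<theta>. \<forall>s\<le>0.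
      norm (U.ext N \<theta> (of_real s) - (\<Sum>p\<le>m. U.partial_jet p N \<theta> * (- \<i> * of_real s) ^ p / fact p))
       \<le> Cx * (1 + ln (real N)) * \<bar>s\<bar> ^ Suc m * exp (real N * \<bar>s\<bar>)"
    using U.ext_taylor by (elim exE conjE) (rule that)
  obtain Ce where Ce0: "0 \<le> Ce" and Ce: "\<forall>\<theta>. \<forall>t::complex. norm t \<le> - ln \<rho> \<longrightarrow>
      norm (exp (\<Sum>p\<le>m. of_real (d p \<theta> / fact p) * t ^ p) - (\<Sum>p\<le>m. of_real (exp_jet p \<theta>) * t ^ p)) \<le> Ce * norm t ^ Suc m"
    using exp_jet_remainder[of "- ln \<rho>"] by (elim exE conjE) (rule that)
  define Gb where "Gb = (\<Sum>l. norm (g l))"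
  have Gb0: "0 \<le> Gb" unfolding Gb_def by (intro suminf_nonneg summable_norm_g) auto
  define A where "A = (\<Sum>i. norm (v i))"
  define vp where "vp z = (\<Sum>i. v i * z ^ i)" for z
  define C1 where "C1 = 2 ^ Suc m * (Cu + exp V0 * Gb * Ct)"
  define C2 where "C2 = 2 ^ Suc m * fact (Suc m) * (Cx + real (Suc m) * Cu + Ce)"
  define K where "K = exp (A - V0) * (C1 + C2)"
  have C10: "0 \<le> C1" using Cu0 Gb0 Ct0 by (simp add: C1_def)
  have C20: "0 \<le> C2" using Cu0 Cx0 Ce0 by (simp add: C2_def)
  have "norm (poly (mpoly n) z - z ^ n * exp (- of_real V0 - vp z)
        * exp (\<Sum>p\<le>m. of_real (d p (Arg z) / fact p) * (- \<i> * of_real (ln (norm z))) ^ p))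
     \<le> K * (1 + ln (real (Suc n))) / real n ^ Suc m"
    if n: "2 \<le> n" and z: "\<rho> < norm z" "norm z < 1" for n z
  proof -
    \<comment> \<open>With half the order, \<open>|z| ^ n * exp (N * \<bar>s\<bar>)\<close> is still
      at most \<open>exp (- n * \<bar>s\<bar> / 2)\<close>; and \<open>2 \<le> n\<close> makes
      \<open>N\<close> positive.\<close>
    define N where "N = n div 2"
    define \<Lambda> where "\<Lambda> = 1 + ln (real (Suc n))"
    define Q where "Q = \<Lambda> / real n ^ Suc m"
    have N: "1 \<le> N" "N \<le> n" "real N \<le> real n / 2" "real n / 2 \<le> real (Suc N)" using n by (auto simp: N_def)
    have L1: "1 \<le> \<Lambda>" by (simp add: \<Lambda>_def)
    have lnN: "1 + ln (real (Suc N)) \<le> \<Lambda>" "1 + ln (real N) \<le> \<Lambda>" using N by (auto simp: \<Lambda>_def)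
    have n0: "0 < real n" using n by simp
    have invN: "1 / real (Suc N) ^ e \<le> 2 ^ Suc m / real n ^ e" if "e \<le> Suc m" for e
    proof -
      have "(real n / 2) ^ e \<le> real (Suc N) ^ e" using N by (intro power_mono) auto
      then have "1 / real (Suc N) ^ e \<le> 1 / (real n / 2) ^ e" using n0 by (intro divide_left_mono) auto
      also have "\<dots> = 2 ^ e / real n ^ e" by (simp add: power_divide)
      also have "\<dots> \<le> 2 ^ Suc m / real n ^ e" using that by (intro divide_right_mono power_increasing) auto
      finally show ?thesis .
    qed
    \<comment> \<open>A function analytic in the disc: \<open>N \<le> n\<close> makes all exponents
      \<open>n + j\<close> nonnegative, so \<open>nat\<close> truncates nothing.\<close>
    define F where "F z = poly (mpoly n) z * exp (vp z) * of_real (exp V0) - (\<Sum>j=-int N..int N. U.u j * z ^ nat (int n + j))" for z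
    have bdry: "norm (F (cis t)) \<le> C1 * Q" for t
    proof -
      have "(\<Sum>j=-int N..int N. U.u j * cis t ^ nat (int n + j)) = cis (real n * t) * U.partial_jet 0 N t"
        unfolding U.partial_jet_def sum_distrib_left
      proof (rule sum.cong)
        fix j assume "j \<in> {-int N..int N}"
        then have "real (nat (int n + j)) = real n + of_int j" using N by auto
        then have "cis t ^ nat (int n + j) = cis (real n * t) * cis (of_int j * t)"
          by (simp add: Complex.DeMoivre cis_mult distrib_right)
        then show "U.u j * cis t ^ nat (int n + j) = cis (real n * t) * ((\<i> * of_int j) ^ 0 * U.u j * cis (of_int j * t))" by simp
      qed auto
      moreover have "vp (cis t) = cs v t" by (simp add: vp_def cs_def)
      moreover have "of_real (exp (d 0 t)) = of_real (exp V0) * (cs g t * cnj (cs g t))"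
        unfolding exp_d0_eq of_real_mult complex_norm_square ..
      \<comment> \<open>On the circle \<open>exp V\<close> is \<open>exp V0 * g * cnj g\<close>.
        Replacing \<open>cnj g\<close> by its Taylor polynomial produces the term with
        \<open>tail n\<close>, and replacing \<open>exp V\<close> by its Fourier partial sum
        produces the other one.\<close>
      ultimately have "F (cis t) = cis (real n * t) * ((of_real (fact 0 * exp_jet 0 t) - U.partial_jet 0 N t) - of_real (exp V0) * cs g t * cnj (tail n t))"
        by (simp add: F_def poly_mpoly_cis tail_eq exp_jet_def algebra_simps flip: cs_g)
      also have "norm \<dots> \<le> norm (of_real (fact 0 * exp_jet 0 t) - U.partial_jet 0 N t) + exp V0 * norm (cs g t) * norm (tail n t)"
        unfolding norm_mult[of "cis (real n * t)"] norm_cis mult_1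
        by (rule order_trans[OF norm_triangle_ineq4]) (simp add: norm_mult)
      also have "\<dots> \<le> Cu * \<Lambda> * (2 ^ Suc m / real n ^ Suc m) + exp V0 * Gb * (Ct * \<Lambda> * (2 ^ Suc m / real n ^ Suc m))"
      proof -
        have "norm (of_real (fact 0 * exp_jet 0 t) - U.partial_jet 0 N t) \<le> Cu * (1 + ln (real (Suc N))) * (1 / real (Suc N) ^ Suc m)"
          using Cu[OF le0 N(1), of t] by (simp only: diff_zero times_divide_eq_right mult_1_right)
        also have "\<dots> \<le> Cu * \<Lambda> * (2 ^ Suc m / real n ^ Suc m)"
          using Cu0 L1 by (intro mult_mono[OF mult_left_mono[OF lnN(1) Cu0] invN]) auto
        finally have a: "norm (of_real (fact 0 * exp_jet 0 t) - U.partial_jet 0 N t) \<le> Cu * \<Lambda> * (2 ^ Suc m / real n ^ Suc m)" .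
        have "norm (cs g t) \<le> Gb" unfolding Gb_def by (rule norm_cs_le[OF summable_norm_g])
        then have b: "exp V0 * norm (cs g t) \<le> exp V0 * Gb" by simp
        have "1 / real (Suc n) ^ Suc m \<le> 1 / real (Suc N) ^ Suc m" using N by (intro divide_left_mono power_mono) auto
        also have "\<dots> \<le> 2 ^ Suc m / real n ^ Suc m" by (rule invN) simp
        finally have "Ct * \<Lambda> * (1 / real (Suc n) ^ Suc m) \<le> Ct * \<Lambda> * (2 ^ Suc m / real n ^ Suc m)"
          using Ct0 L1 by (intro mult_left_mono) auto
        moreover have "norm (tail n t) \<le> Ct * \<Lambda> * (1 / real (Suc n) ^ Suc m)"
          using Ct[rule_format, of n t] n by (simp add: \<Lambda>_def del: of_nat_Suc power_Suc)
        ultimately have c: "norm (tail n t) \<le> Ct * \<Lambda> * (2 ^ Suc m / real n ^ Suc m)" by (rule order_trans[rotated])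
        show ?thesis by (rule add_mono[OF a mult_mono[OF b c]]) (use Gb0 in auto)
      qed
      also have "\<dots> = C1 * Q" by (simp add: C1_def Q_def algebra_simps add_divide_distrib)
      finally show ?thesis .
    qed
    have Fz: "norm (F z) \<le> C1 * Q"
    proof (rule maximum_modulus_disc[where f=F, OF _ _ bdry z(2)])
      show "F holomorphic_on ball 0 1"
        unfolding F_def vp_def by (intro holomorphic_intros holomorphic_power_series_disc summable_norm_v)
      show "continuous_on (cball 0 1) F"
        unfolding F_def vp_def by (intro continuous_intros continuous_on_power_series_disc summable_norm_v)
    qed
    define \<theta> where "\<theta> = Arg z"
    define s where "s = ln (norm z)"
    define w where "w = of_real s + \<i> * of_real \<theta>"
    define EE where "EE = exp (\<Sum>p\<le>m. of_real (d p \<theta> / fact p) * (- \<i> * of_real s) ^ p)"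
    let ?PJ = "\<Sum>p\<le>m. U.partial_jet p N \<theta> * (- \<i> * of_real s) ^ p / fact p"
    let ?EJ = "\<Sum>p\<le>m. of_real (exp_jet p \<theta>) * (- \<i> * of_real s) ^ p"
    have zpos: "0 < norm z" using z \<rho> by linarith
    have s0: "s \<le> 0" "\<bar>s\<bar> \<le> - ln \<rho>" using z \<rho> zpos by (auto simp: s_def)
    have zw: "z = exp w"
    proof -
      have "exp w = of_real (norm z) * exp (\<i> * of_real \<theta>)"
        unfolding w_def exp_add using zpos by (simp add: s_def exp_of_real)
      then show ?thesis using Arg_eq[of z] zpos by (simp add: \<theta>_def)
    qed
    have sumz: "(\<Sum>j=-int N..int N. U.u j * z ^ nat (int n + j)) = z ^ n * U.ext N \<theta> (of_real s)"
      unfolding U.ext_def sum_distrib_left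
    proof (rule sum.cong)
      fix j assume j: "j \<in> {-int N..int N}"
      have "z ^ nat (int n + j) = exp (of_nat (nat (int n + j)) * w)" unfolding zw by (rule exp_of_nat_mult[symmetric])
      also have "of_nat (nat (int n + j)) = (of_nat n + of_int j :: complex)"
      proof -
        have "int (nat (int n + j)) = int n + j" using j N by auto
        then show ?thesis by (metis of_int_add of_int_of_nat_eq)
      qed
      also have "exp ((of_nat n + of_int j) * w) = z ^ n * exp (of_int j * w)"
        unfolding zw by (simp add: distrib_right exp_add exp_of_nat_mult)
      also have "exp (of_int j * w) = cis (of_int j * \<theta>) * exp (of_int j * of_real s)"
        by (simp add: w_def cis_conv_exp algebra_simps flip: exp_add)
      finally show "U.u j * z ^ nat (int n + j) = z ^ n * (U.u j * cis (of_int j * \<theta>) * exp (of_int j * of_real s))" by simp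
    qed auto
    have zn: "norm (z ^ n) = exp (- (real n * \<bar>s\<bar>))"
      using s0 zpos by (simp add: norm_power s_def exp_of_nat_mult)
    have decay: "exp (- (real n * \<bar>s\<bar>)) * \<bar>s\<bar> ^ p \<le> fact (Suc m) / real n ^ p" if "p \<le> Suc m" for p
    proof -
      have "exp (- (real n * \<bar>s\<bar>)) * (real n * \<bar>s\<bar>) ^ p \<le> fact p" by (rule exp_minus_power_le) simp
      also have "\<dots> \<le> fact (Suc m)" using that by (rule fact_mono)
      finally show ?thesis using n0 by (simp add: pos_le_divide_eq power_mult_distrib mult_ac del: fact_Suc)
    qed
    \<comment> \<open>First of three interior errors: the Taylor remainder at the boundary, where
      the \<open>Suc m\<close> powers of \<open>\<bar>s\<bar>\<close> become
      \<open>n ^ - Suc m\<close>.\<close>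
    have B1: "norm (z ^ n) * norm (U.ext N \<theta> (of_real s) - ?PJ)
       \<le> 2 ^ Suc m * fact (Suc m) * Cx * Q"
    proof -
      have "norm (z ^ n) * norm (U.ext N \<theta> (of_real s) - ?PJ)
        \<le> exp (- (real n * \<bar>s\<bar>)) * (Cx * (1 + ln (real N)) * \<bar>s\<bar> ^ Suc m * exp (real N * \<bar>s\<bar>))"
        unfolding zn using Cx[rule_format, OF N(1) s0(1), of \<theta>] by (intro mult_left_mono) auto
      also have "\<dots> = Cx * (1 + ln (real N)) * ((exp (- (real n * \<bar>s\<bar>)) * exp (real N * \<bar>s\<bar>)) * \<bar>s\<bar> ^ Suc m)"
        by (simp only: mult_ac)
      also have "\<dots> \<le> Cx * \<Lambda> * (exp (- (real n / 2 * \<bar>s\<bar>)) * \<bar>s\<bar> ^ Suc m)"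
      proof -
        have "real N * \<bar>s\<bar> \<le> real n / 2 * \<bar>s\<bar>" using N by (intro mult_right_mono) auto
        then have "- (real n * \<bar>s\<bar>) + real N * \<bar>s\<bar> \<le> - (real n / 2 * \<bar>s\<bar>)" by simp
        then have e: "exp (- (real n * \<bar>s\<bar>)) * exp (real N * \<bar>s\<bar>) \<le> exp (- (real n / 2 * \<bar>s\<bar>))"
          unfolding exp_add[symmetric] exp_le_cancel_iff .
        show ?thesis
          by (rule mult_mono[OF mult_left_mono[OF lnN(2) Cx0] mult_right_mono[OF e]]) (use Cx0 L1 in auto)
      qed
      also have "\<dots> \<le> Cx * \<Lambda> * (fact (Suc m) * 2 ^ Suc m / real n ^ Suc m)"
      proof (rule mult_left_mono)
        have "exp (- (real n / 2 * \<bar>s\<bar>)) * (real n / 2 * \<bar>s\<bar>) ^ Suc m \<le> fact (Suc m)"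
          by (rule exp_minus_power_le) simp
        then have "exp (- (real n / 2 * \<bar>s\<bar>)) * \<bar>s\<bar> ^ Suc m * (real n ^ Suc m / 2 ^ Suc m) \<le> fact (Suc m)"
          by (simp only: power_mult_distrib power_divide mult_ac)
        then show "exp (- (real n / 2 * \<bar>s\<bar>)) * \<bar>s\<bar> ^ Suc m \<le> fact (Suc m) * 2 ^ Suc m / real n ^ Suc m"
          using n0 by (simp add: field_simps del: fact_Suc power_Suc)
      qed (use Cx0 L1 in simp)
      finally show ?thesis by (simp add: Q_def mult_ac del: fact_Suc power_Suc)
    qed
    \<comment> \<open>Second error: Fourier partial sums of the jet against the jet itself. The loss
      of \<open>p\<close> powers of \<open>n\<close> in the \<open>p\<close>-th derivative is
      repaired by \<open>\<bar>s\<bar> ^ p\<close>, so every term has the same order.\<close>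
    have B2: "norm (z ^ n) * norm (?PJ - ?EJ)
       \<le> 2 ^ Suc m * fact (Suc m) * (real (Suc m) * Cu) * Q"
    proof -
      have "norm (?PJ - ?EJ)
         \<le> (\<Sum>p\<le>m. Cu * \<Lambda> * (2 ^ Suc m / real n ^ (Suc m - p)) * \<bar>s\<bar> ^ p)"
        unfolding sum_subtractf[symmetric]
      proof (rule sum_norm_le)
        fix p assume "p \<in> {..m}"
        then have p: "p \<le> m" by simp
        have "U.partial_jet p N \<theta> * (- \<i> * of_real s) ^ p / fact p - of_real (exp_jet p \<theta>) * (- \<i> * of_real s) ^ p
           = - ((of_real (fact p * exp_jet p \<theta>) - U.partial_jet p N \<theta>) * (- \<i> * of_real s) ^ p / fact p)"
          by (simp add: field_simps)
        also have "norm \<dots> = norm (of_real (fact p * exp_jet p \<theta>) - U.partial_jet p N \<theta>) * \<bar>s\<bar> ^ p / fact p"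
          by (simp add: norm_mult norm_divide norm_power)
        also have "\<dots> \<le> norm (of_real (fact p * exp_jet p \<theta>) - U.partial_jet p N \<theta>) * \<bar>s\<bar> ^ p"
        proof -
          have "X / fact p \<le> X" if "0 \<le> X" for X :: real
            using that fact_ge_1[of p, where 'a=real] by (simp add: divide_le_eq mult_le_cancel_left1)
          then show ?thesis by simp
        qed
        also have "\<dots> \<le> Cu * \<Lambda> * (2 ^ Suc m / real n ^ (Suc m - p)) * \<bar>s\<bar> ^ p"
        proof (rule mult_right_mono)
          have "norm (of_real (fact p * exp_jet p \<theta>) - U.partial_jet p N \<theta>) \<le> Cu * (1 + ln (real (Suc N))) * (1 / real (Suc N) ^ (Suc m - p))"
            using Cu[OF p N(1), of \<theta>] by simp
          also have "\<dots> \<le> Cu * \<Lambda> * (2 ^ Suc m / real n ^ (Suc m - p))"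
            using Cu0 L1 by (intro mult_mono[OF mult_left_mono[OF lnN(1) Cu0] invN]) auto
          finally show "norm (of_real (fact p * exp_jet p \<theta>) - U.partial_jet p N \<theta>) \<le> Cu * \<Lambda> * (2 ^ Suc m / real n ^ (Suc m - p))" .
        qed auto
        finally show "norm (U.partial_jet p N \<theta> * (- \<i> * of_real s) ^ p / fact p - of_real (exp_jet p \<theta>) * (- \<i> * of_real s) ^ p)
           \<le> Cu * \<Lambda> * (2 ^ Suc m / real n ^ (Suc m - p)) * \<bar>s\<bar> ^ p" .
      qed
      then have "norm (z ^ n) * norm (?PJ - ?EJ)
         \<le> exp (- (real n * \<bar>s\<bar>)) * (\<Sum>p\<le>m. Cu * \<Lambda> * (2 ^ Suc m / real n ^ (Suc m - p)) * \<bar>s\<bar> ^ p)"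
        unfolding zn by (rule mult_left_mono) auto
      also have "\<dots> = (\<Sum>p\<le>m. Cu * \<Lambda> * (2 ^ Suc m / real n ^ (Suc m - p)) * (exp (- (real n * \<bar>s\<bar>)) * \<bar>s\<bar> ^ p))"
        by (simp only: sum_distrib_left mult_ac)
      also have "\<dots> \<le> (\<Sum>p\<le>m. Cu * \<Lambda> * (2 ^ Suc m / real n ^ Suc m) * fact (Suc m))"
      proof (rule sum_mono)
        fix p assume p: "p \<in> {..m}"
        have "Cu * \<Lambda> * (2 ^ Suc m / real n ^ (Suc m - p)) * (exp (- (real n * \<bar>s\<bar>)) * \<bar>s\<bar> ^ p)
           \<le> Cu * \<Lambda> * (2 ^ Suc m / real n ^ (Suc m - p)) * (fact (Suc m) / real n ^ p)"
          using p Cu0 L1 by (intro mult_left_mono decay) auto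
        also have "\<dots> = Cu * \<Lambda> * 2 ^ Suc m * fact (Suc m) / (real n ^ (Suc m - p) * real n ^ p)" by simp
        also have "real n ^ (Suc m - p) * real n ^ p = real n ^ Suc m" using p by (simp flip: power_add)
        finally show "Cu * \<Lambda> * (2 ^ Suc m / real n ^ (Suc m - p)) * (exp (- (real n * \<bar>s\<bar>)) * \<bar>s\<bar> ^ p)
           \<le> Cu * \<Lambda> * (2 ^ Suc m / real n ^ Suc m) * fact (Suc m)" by simp
      qed
      also have "\<dots> = 2 ^ Suc m * fact (Suc m) * (real (Suc m) * Cu) * Q"
        by (simp add: Q_def mult_ac del: fact_Suc power_Suc)
      finally show ?thesis .
    qed
    \<comment> \<open>Third error: the truncated Taylor expansion of the exponential against the
      exponential of the truncated expansion, which differ only from order \<open>Suc m\<close>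
      on.\<close>
    have B3: "norm (z ^ n) * norm (?EJ - EE)
       \<le> 2 ^ Suc m * fact (Suc m) * Ce * Q"
    proof -
      have "norm (EE - ?EJ) \<le> Ce * \<bar>s\<bar> ^ Suc m"
        using Ce[rule_format, of "- \<i> * of_real s" \<theta>] s0(2) by (simp add: EE_def norm_mult)
      then have "norm (z ^ n) * norm (?EJ - EE) \<le> exp (- (real n * \<bar>s\<bar>)) * (Ce * \<bar>s\<bar> ^ Suc m)"
        unfolding zn by (intro mult_left_mono) (auto simp: norm_minus_commute)
      also have "\<dots> = Ce * (exp (- (real n * \<bar>s\<bar>)) * \<bar>s\<bar> ^ Suc m)" by (simp only: mult_ac)
      also have "\<dots> \<le> Ce * (fact (Suc m) / real n ^ Suc m)" using Ce0 by (intro mult_left_mono decay) auto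
      also have "\<dots> = fact (Suc m) * Ce / real n ^ Suc m * (1 * 1)" by simp
      also have "\<dots> \<le> fact (Suc m) * Ce / real n ^ Suc m * (2 ^ Suc m * \<Lambda>)"
        using Ce0 L1 n0 one_le_power[of "2::real" "Suc m"] by (intro mult_left_mono mult_mono) auto
      finally show ?thesis by (simp add: Q_def mult_ac del: fact_Suc power_Suc)
    qed
    have zP: "norm (z ^ n * (U.ext N \<theta> (of_real s) - EE)) \<le> C2 * Q"
    proof -
      have tri: "norm (a - e) \<le> norm (a - b) + norm (b - c) + norm (c - e)" for a b c e :: complex
        using norm_triangle_ineq[of "a - b" "b - c"] norm_triangle_ineq[of "a - c" "c - e"] by simp
      have "norm (z ^ n * (U.ext N \<theta> (of_real s) - EE)) \<le> norm (z ^ n) * (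
           norm (U.ext N \<theta> (of_real s) - ?PJ)
         + norm (?PJ - ?EJ)
         + norm (?EJ - EE))"
        unfolding norm_mult[of "z ^ n"] by (intro mult_left_mono tri norm_ge_zero)
      also have "\<dots> \<le> 2 ^ Suc m * fact (Suc m) * Cx * Q + 2 ^ Suc m * fact (Suc m) * (real (Suc m) * Cu) * Q + 2 ^ Suc m * fact (Suc m) * Ce * Q"
        unfolding distrib_left by (intro add_mono B1 B2 B3)
      also have "\<dots> = C2 * Q" by (simp only: C2_def distrib_left distrib_right)
      finally show ?thesis .
    qed
    \<comment> \<open>Undoes the multiplication by \<open>g * exp V0\<close> that made the boundary
      comparison possible; the factor is bounded since \<open>v\<close> is bounded on the
      disc.\<close>
    have "exp (- of_real V0 - vp z) * (exp (vp z) * of_real (exp V0)) = 1"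
      by (simp add: exp_of_real[symmetric] exp_diff exp_minus)
    then have "poly (mpoly n) z - z ^ n * exp (- of_real V0 - vp z) * EE = exp (- of_real V0 - vp z) * (F z + z ^ n * (U.ext N \<theta> (of_real s) - EE))"
      unfolding F_def sumz by (simp add: algebra_simps)
    also have "norm \<dots> \<le> exp (A - V0) * (C1 * Q + C2 * Q)"
      unfolding norm_mult[of "exp (- of_real V0 - vp z)"]
    proof (rule mult_mono)
      have "norm (vp z) \<le> A" unfolding vp_def A_def using z by (intro v_series_bound) auto
      then have "- Re (vp z) \<le> A" using abs_Re_le_cmod[of "vp z"] by linarith
      then show "norm (exp (- complex_of_real V0 - vp z)) \<le> exp (A - V0)" by (simp add: norm_exp_eq_Re)
      show "norm (F z + z ^ n * (U.ext N \<theta> (of_real s) - EE)) \<le> C1 * Q + C2 * Q"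
        by (rule norm_triangle_mono[OF Fz zP])
    qed auto
    also have "\<dots> = K * (1 + ln (real (Suc n))) / real n ^ Suc m"
      by (simp add: K_def Q_def \<Lambda>_def algebra_simps add_divide_distrib del: power_Suc)
    finally show ?thesis by (simp only: EE_def \<theta>_def s_def)
  qed
  moreover have "0 \<le> K" using C10 C20 by (simp add: K_def)
  ultimately show ?thesis unfolding vp_def by blast
qed

end

section \<open>Combination of the estimates\<close>

lemma log_factor_le:
  assumes "3 \<le> n"
  shows "1 + ln (real (Suc n)) \<le> 3 * ln (real n)"
proof -
  have "exp 1 \<le> real n" using exp_le assms by linarith
  then have 1: "1 \<le> ln (real n)" using assms by (subst ln_ge_iff) auto
  have "ln (real (Suc n)) \<le> ln (2 * real n)" using assms by (subst ln_le_cancel_iff) auto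
  also have "\<dots> \<le> 1 + ln (real n)" using assms ln_le_minus_one[of "2::real"] by (simp add: ln_mult)
  finally show ?thesis using 1 by linarith
qed

theorem theorem3p4:
  fixes V :: "real \<Rightarrow> real" and k :: nat
  assumes "k \<ge> 1" and "C_k_minus_1_1 k V"
  shows "\<forall>\<rho>. 0 < \<rho> \<and> \<rho> < 1 \<longrightarrow>
    (\<exists>Km Kp. Km > 0 \<and> Kp > 0 \<and>
      (\<forall>\<^sub>F n in sequentially.
         (\<forall>z. \<rho> < cmod z \<and> cmod z < 1 \<longrightarrow>
            cmod (poly (monic_OP (\<lambda>\<theta>. exp (- V \<theta>)) n) z
                  - z ^ n * exp (- fourier_coeff V 0 - cnj (N_fun V (1 / cnj z)))
                    * exp (E_ext k V (cmod z) (Arg z)))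
            \<le> Km * ln (real n) / real n ^ k) \<and>
         (\<forall>z. cmod z < \<rho> \<longrightarrow>
            cmod (poly (monic_OP (\<lambda>\<theta>. exp (- V \<theta>)) n) z) \<le> Kp / real n ^ k)))"
proof (intro allI impI)
  fix \<rho> :: real assume \<rho>: "0 < \<rho> \<and> \<rho> < 1"
  define m where "m = k - 1"
  have k: "k = Suc m" using assms(1) by (simp add: m_def)
  interpret circle_jet m "\<lambda>p. (deriv ^^ p) V"
    unfolding m_def by (rule circle_jet_of_C_k_minus_1_1[OF assms])
  have fcV: "fourier_coeff V j = u j" for j
    by (simp add: fourier_coeff_def u_def fc_def cavg_def scaleR_conv_of_real field_simps)
  \<comment> \<open>Conjugation turns \<open>V\<^sub>-\<^sub>j\<close> into the coefficient
    \<open>u j\<close> and \<open>cnj z\<close> into \<open>z\<close>. At \<open>z = 0\<close> both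
    divisions return 0, so the identity holds there as well.\<close>
  have N: "cnj (N_fun V (1 / cnj z)) = (\<Sum>i. v i * z ^ i)" if "norm z < 1" for z
  proof -
    have s: "summable (\<lambda>i. v i * z ^ i)" by (rule summable_power_series_disc[OF summable_norm_v]) (use that in simp)
    then have "(\<lambda>j. v (Suc j) * z ^ Suc j) sums (\<Sum>i. v i * z ^ i)"
      using sums_Suc_iff[of "\<lambda>i. v i * z ^ i"] by (simp add: summable_sums)
    then have "(\<lambda>j. cnj (v (Suc j) * z ^ Suc j)) sums cnj (\<Sum>i. v i * z ^ i)" by (simp only: sums_cnj)
    moreover have "(\<lambda>j. cnj (v (Suc j) * z ^ Suc j)) = (\<lambda>j. fourier_coeff V (- int (Suc j)) * (1 / (1 / cnj z)) ^ Suc j)"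
      unfolding fcV u_uminus by (simp add: v_def)
    ultimately have "N_fun V (1 / cnj z) = cnj (\<Sum>i. v i * z ^ i)" unfolding N_fun_def by (simp add: sums_iff)
    then show ?thesis by simp
  qed
  have E: "E_ext k V r \<theta> = (\<Sum>p\<le>m. of_real ((deriv ^^ p) V \<theta> / fact p) * (- \<i> * of_real (ln r)) ^ p)" for r \<theta>
    unfolding E_ext_def k lessThan_Suc_atMost ..
  have OPV: "monic_OP (\<lambda>\<theta>. exp (- V \<theta>)) n = OP n" for n by (simp add: OP_def)
  obtain C1 where C10: "0 \<le> C1" and C1: "\<And>n z. norm z < 1 \<Longrightarrow> norm (poly (OP n) z - poly (mpoly n) z) \<le> C1 / real (Suc n) ^ Suc m"
    using err_sup_disc by metis
  obtain C2 where C20: "0 \<le> C2" and C2: "\<And>n z. 1 \<le> n \<Longrightarrow> norm z < \<rho> \<Longrightarrow> norm (poly (mpoly n) z) \<le> C2 / real n ^ Suc m"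
    using mpoly_small_disc \<rho> by metis
  obtain C3 where C30: "0 \<le> C3" and C3: "\<forall>n\<ge>2. \<forall>z. \<rho> < norm z \<and> norm z < 1 \<longrightarrow>
     norm (poly (mpoly n) z - z ^ n * exp (- of_real V0 - (\<Sum>i. v i * z ^ i))
        * exp (\<Sum>p\<le>m. of_real ((deriv ^^ p) V (Arg z) / fact p) * (- \<i> * of_real (ln (norm z))) ^ p))
     \<le> C3 * (1 + ln (real (Suc n))) / real n ^ Suc m"
    using mpoly_annulus[OF conjunct1[OF \<rho>] conjunct2[OF \<rho>]] by (elim exE conjE) (rule that)
  have C1': "norm (poly (OP n) z - poly (mpoly n) z) \<le> C1 / real n ^ Suc m" if "1 \<le> n" "norm z < 1" for n z
  proof -
    have "C1 / real (Suc n) ^ Suc m \<le> C1 / real n ^ Suc m"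
      using that C10 by (intro divide_left_mono power_mono mult_pos_pos) auto
    then show ?thesis using C1[OF that(2), of n] by linarith
  qed
  \<comment> \<open>The factor 3 is that of \<open>log_factor_le\<close>; the added 1 makes the
    constants strictly positive and appears below as the extra \<open>ln (real n)\<close>.\<close>
  let ?Km = "3 * (C1 + C3) + 1" and ?Kp = "C1 + C2 + 1"
  have "(\<forall>z. \<rho> < cmod z \<and> cmod z < 1 \<longrightarrow>
            cmod (poly (OP n) z - z ^ n * exp (- fourier_coeff V 0 - cnj (N_fun V (1 / cnj z))) * exp (E_ext k V (cmod z) (Arg z)))
            \<le> ?Km * ln (real n) / real n ^ k) \<and>
         (\<forall>z. cmod z < \<rho> \<longrightarrow> cmod (poly (OP n) z) \<le> ?Kp / real n ^ k)" if n: "3 \<le> n" for n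
  proof (intro conjI allI impI)
    fix z assume z: "\<rho> < cmod z \<and> cmod z < 1"
    let ?X = "z ^ n * exp (- fourier_coeff V 0 - cnj (N_fun V (1 / cnj z))) * exp (E_ext k V (cmod z) (Arg z))"
    have "norm (poly (mpoly n) z - ?X) \<le> C3 * (1 + ln (real (Suc n))) / real n ^ Suc m"
      using C3[rule_format, of n z] n z by (simp add: E N fcV u_0)
    then have "norm (poly (OP n) z - ?X) \<le> C1 / real n ^ Suc m + C3 * (1 + ln (real (Suc n))) / real n ^ Suc m"
      using C1'[of n z] n z norm_triangle_ineq[of "poly (OP n) z - poly (mpoly n) z" "poly (mpoly n) z - ?X"] by simp
    also have "\<dots> = (C1 * 1 + C3 * (1 + ln (real (Suc n)))) / real n ^ Suc m" by (simp add: add_divide_distrib)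
    also have "\<dots> \<le> (C1 * (3 * ln (real n)) + C3 * (3 * ln (real n)) + ln (real n)) / real n ^ Suc m"
    proof -
      have 1: "1 \<le> 3 * ln (real n)" 
      proof -
        have "0 \<le> ln (real (Suc n))" by (rule ln_ge_zero) simp
        then show ?thesis using log_factor_le[OF n] by linarith
      qed
      have "C1 * 1 \<le> C1 * (3 * ln (real n))" using C10 1 by (rule mult_left_mono[rotated])
      moreover have "C3 * (1 + ln (real (Suc n))) \<le> C3 * (3 * ln (real n))"
        using C30 log_factor_le[OF n] by (rule mult_left_mono[rotated])
      moreover have "0 \<le> ln (real n)" using n by simp
      ultimately show ?thesis by (intro divide_right_mono) (linarith, simp)
    qed
    also have "\<dots> = ?Km * ln (real n) / real n ^ k" by (simp add: k algebra_simps)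
    finally show "norm (poly (OP n) z - ?X) \<le> ?Km * ln (real n) / real n ^ k" .
  next
    fix z assume z: "cmod z < \<rho>"
    have "norm (poly (OP n) z) \<le> C1 / real n ^ Suc m + C2 / real n ^ Suc m"
      using C1'[of n z] C2[of n z] n z \<rho> norm_triangle_ineq[of "poly (OP n) z - poly (mpoly n) z" "poly (mpoly n) z"] by simp
    also have "\<dots> \<le> ?Kp / real n ^ k" by (simp add: k add_divide_distrib)
    finally show "norm (poly (OP n) z) \<le> ?Kp / real n ^ k" .
  qed
  then have "\<forall>\<^sub>F n in sequentially. (\<forall>z. \<rho> < cmod z \<and> cmod z < 1 \<longrightarrow>
            cmod (poly (OP n) z - z ^ n * exp (- fourier_coeff V 0 - cnj (N_fun V (1 / cnj z))) * exp (E_ext k V (cmod z) (Arg z)))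
            \<le> ?Km * ln (real n) / real n ^ k) \<and>
         (\<forall>z. cmod z < \<rho> \<longrightarrow> cmod (poly (OP n) z) \<le> ?Kp / real n ^ k)"
    by (rule eventually_sequentiallyI)
  then show "\<exists>Km Kp. Km > 0 \<and> Kp > 0 \<and>
      (\<forall>\<^sub>F n in sequentially.
         (\<forall>z. \<rho> < cmod z \<and> cmod z < 1 \<longrightarrow>
            cmod (poly (monic_OP (\<lambda>\<theta>. exp (- V \<theta>)) n) z
                  - z ^ n * exp (- fourier_coeff V 0 - cnj (N_fun V (1 / cnj z)))
                    * exp (E_ext k V (cmod z) (Arg z)))
            \<le> Km * ln (real n) / real n ^ k) \<and>
         (\<forall>z. cmod z < \<rho> \<longrightarrow>
            cmod (poly (monic_OP (\<lambda>\<theta>. exp (- V \<theta>)) n) z) \<le> Kp / real n ^ k))"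
    unfolding OPV using C10 C20 C30 by (intro exI[of _ ?Km] exI[of _ ?Kp]) auto
qed

end
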